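(* Let $a\ge0$ and let $(q,r)$ be $a$-admissible. There is $C(a,r)>0$ such that for every $\varphi\in\mathscr S^+$ and $F\in\mathbb S^+$, the solution $u(x,t)=S_a(t)\varphi(x)+\int_0^tS_a(t-s)\big(F(\cdot,s)\big)(x)\,ds$ of the Cauchy problem $\partial_tu-i\mathcal B_au=F$ on $\mathbb R^+\times\mathbb R$, $\lim_{x\to0^+}x^a\partial_xu=0$, $u(\cdot,0)=\varphi$, satisfies $$\|u\|_{L^q_tL^r_a}\le C(a,r)\big(\|\varphi\|_{L^2_a}+\|F\|_{L^{q'}_tL^{r'}_a}\big).$$
   Context: $\mathbb R^+=(0,\infty)$, $d\omega_a(x)=x^a\,dx$, $L^r_a=L^r(\mathbb R^+,d\omega_a)$, $\|u\|_{L^q_tL^r_a}=(\int_{\mathbb R}\|u(\cdot,t)\|_{L^r_a}^q\,dt)^{1/q}$; primes denote conjugate exponents. $\mathcal B_au=\partial_{xx}u+\frac ax\partial_xu$. A pair $(q,r)$ is $a$-admissible if $r>2$, additionally $r<\frac{2(a+1)}{a-1}$ when $a>1$, and $\frac2q=(a+1)(\frac12-\frac1r)$. $\mathscr S^+$: $\varphi\in C^\infty(\mathbb R^+;\mathbb C)$ with $\sup_{x>0}|x^m(x^{-1}\partial_x)^k\varphi(x)|<\infty$ for all $m,k\in\mathbb N_0$. $\mathbb S^+$: $F\in C^\infty(\mathbb R^+\times\mathbb R;\mathbb C)$ with $\sup_{k+\ell\le p}\sup_{(x,t)}(1+x^2+t^2)^{p/2}|(x^{-1}\partial_x)^k\partial_t^\ell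 F(x,t)|<\infty$ for every $p\in\mathbb N_0$. Kernel: for $x,y>0$, $S_a(x,y,t)=\frac{e^{-i(a+1)\pi/4}}{(2|t|)^{(a+1)/2}}\big(\frac{xy}{2|t|}\big)^{\frac{1-a}2}J_{\frac{a-1}2}\big(\frac{xy}{2|t|}\big)e^{i\frac{x^2+y^2}{4|t|}}$ if $t>0$, its analogue with $e^{i(a+1)\pi/4}$ and $e^{-i\frac{x^2+y^2}{4|t|}}$ if $t<0$ ($J_\nu$ Bessel function of the first kind); $S_a(t)\varphi(x)=\int_0^\infty S_a(x,y,t)\varphi(y)\,d\omega_a(y)$, $S_a(0)=\mathrm{Id}$. *)

theory Defs
  imports "HOL-Analysis.Analysis"
begin

text \<open>Bessel function of the first kind (real order nu > -1, real argument z > 0).\<close>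
definition besselJ :: "real \<Rightarrow> real \<Rightarrow> real" where
  "besselJ nu z = (\<Sum>k. (-1) ^ k / (fact k * Gamma (real k + nu + 1)) * (z / 2) powr (2 * real k + nu))"

text \<open>The kernel S_a(x,y,t), for x, y > 0 and t \<noteq> 0.\<close>
definition Skernel :: "real \<Rightarrow> real \<Rightarrow> real \<Rightarrow> real \<Rightarrow> complex" where
  "Skernel a x y t =
     (if t > 0 then
        cis (- (a + 1) * pi / 4) / complex_of_real ((2 * \<bar>t\<bar>) powr ((a + 1) / 2))
        * complex_of_real ((x * y / (2 * \<bar>t\<bar>)) powr ((1 - a) / 2) * besselJ ((a - 1) / 2) (x * y / (2 * \<bar>t\<bar>)))
        * cis ((x\<^sup>2 + y\<^sup>2) / (4 * \<bar>t\<bar>))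
      else
        cis ((a + 1) * pi / 4) / complex_of_real ((2 * \<bar>t\<bar>) powr ((a + 1) / 2))
        * complex_of_real ((x * y / (2 * \<bar>t\<bar>)) powr ((1 - a) / 2) * besselJ ((a - 1) / 2) (x * y / (2 * \<bar>t\<bar>)))
        * cis (- (x\<^sup>2 + y\<^sup>2) / (4 * \<bar>t\<bar>)))"

definition Sa :: "real \<Rightarrow> real \<Rightarrow> (real \<Rightarrow> complex) \<Rightarrow> real \<Rightarrow> complex" where
  "Sa a t phi x = (if t = 0 then phi x
     else (LINT y:{0<..}|lborel. Skernel a x y t * phi y * complex_of_real (y powr a)))"

definition sol :: "real \<Rightarrow> (real \<Rightarrow> complex) \<Rightarrow> (real \<Rightarrow> real \<Rightarrow> complex) \<Rightarrow> real \<Rightarrow> real \<Rightarrow> complex" where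
  "sol a phi F x t = Sa a t phi x + (LBINT s=ereal 0..ereal t. Sa a (t - s) (\<lambda>y. F y s) x)"

definition xD :: "(real \<Rightarrow> complex) \<Rightarrow> real \<Rightarrow> complex" where
  "xD f = (\<lambda>x. vector_derivative f (at x) / complex_of_real x)"

definition xDx :: "(real \<Rightarrow> real \<Rightarrow> complex) \<Rightarrow> real \<Rightarrow> real \<Rightarrow> complex" where
  "xDx G = (\<lambda>x t. vector_derivative (\<lambda>y. G y t) (at x) / complex_of_real x)"

definition Dt :: "(real \<Rightarrow> real \<Rightarrow> complex) \<Rightarrow> real \<Rightarrow> real \<Rightarrow> complex" where
  "Dt G = (\<lambda>x t. vector_derivative (\<lambda>s. G x s) (at t))"

text \<open>The class \<open>\<S>\<^sup>+\<close>: smooth on (0,oo) with sup_{x>0} |x^m (x^{-1} d/dx)^k phi(x)| < oo.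
  Smoothness on (0,oo) is expressed as: every iterate (x^{-1} d/dx)^k phi is differentiable at every x>0.\<close>
definition SchwartzPlus :: "(real \<Rightarrow> complex) set" where
  "SchwartzPlus = {phi.
     (\<forall>k::nat. \<forall>x>0. ((xD ^^ k) phi) differentiable (at x)) \<and>
     (\<forall>m k::nat. \<exists>B. \<forall>x>0. x ^ m * norm ((xD ^^ k) phi x) \<le> B)}"

text \<open>The class \<open>\<bbbS>\<^sup>+\<close> of functions F(x,t) on (0,oo) x R (x first, t second).
  Smoothness: every mixed derivative (x^{-1} d_x)^k d_t^l F is (jointly) differentiable at every (x,t), x>0.\<close>
definition SSPlus :: "(real \<Rightarrow> real \<Rightarrow> complex) set" where
  "SSPlus = {F.
     (\<forall>k l::nat. \<forall>x>0. \<forall>t. (\<lambda>z::real \<times> real. ((xDx ^^ k) ((Dt ^^ l) F)) (fst z) (snd z)) differentiable (at (x, t))) \<and>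
     (\<forall>p::nat. \<exists>B. \<forall>k l. k + l \<le> p \<longrightarrow> (\<forall>x>0. \<forall>t.
         (1 + x\<^sup>2 + t\<^sup>2) powr (real p / 2) * norm (((xDx ^^ k) ((Dt ^^ l) F)) x t) \<le> B))}"

definition enn_powr :: "ennreal \<Rightarrow> real \<Rightarrow> ennreal" where
  "enn_powr v p = (if v = \<infinity> then \<infinity> else ennreal (enn2real v powr p))"

definition Lnorm :: "real \<Rightarrow> real \<Rightarrow> (real \<Rightarrow> complex) \<Rightarrow> ennreal" where
  "Lnorm r a f = enn_powr (\<integral>\<^sup>+ x\<in>{0<..}. ennreal (norm (f x) powr r * x powr a) \<partial>lborel) (1 / r)"

definition mixed_norm :: "real \<Rightarrow> real \<Rightarrow> real \<Rightarrow> (real \<Rightarrow> real \<Rightarrow> complex) \<Rightarrow> ennreal" where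
  "mixed_norm q r a u = enn_powr (\<integral>\<^sup>+ t. enn_powr (Lnorm r a (\<lambda>x. u x t)) q \<partial>lborel) (1 / q)"

definition admissible :: "real \<Rightarrow> real \<Rightarrow> real \<Rightarrow> bool" where
  "admissible a q r \<longleftrightarrow> r > 2 \<and> (a > 1 \<longrightarrow> r < 2 * (a + 1) / (a - 1)) \<and> 2 / q = (a + 1) * (1/2 - 1/r)"

definition conj_exp :: "real \<Rightarrow> real" where
  "conj_exp p = p / (p - 1)"

end

theory Submission
  imports Defs "HOL-Complex_Analysis.Complex_Analysis"
begin


text \<open>
  Put \<open>m = (a + 1) / 2\<close> and \<open>C\<^sub>m(w) = \<Sum> w\<^sup>k / (k! \<Gamma>(k + m))\<close>. Up to unimodular factors depending on
  \<open>x\<close> alone and on \<open>y\<close> alone, the kernel of \<open>S\<^sub>a(t)\<close> is a multiple of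
  \<open>\<bar>t\<bar> powr (-m) * C\<^sub>m(-(x y / 4 t)\<^sup>2)\<close>. Everything rests on Weber's integral
  \<open>\<integral> y\<^sup>a exp (-\<beta> y\<^sup>2) C\<^sub>m(X y\<^sup>2) C\<^sub>m(Y y\<^sup>2) dy = \<beta> powr (-m) / 2 * exp ((X + Y) / \<beta>) * C\<^sub>m(X Y / \<beta>\<^sup>2)\<close>
  for \<open>Re \<beta> > 0\<close>. For real \<open>\<beta>\<close> it yields the \<open>L\<^sup>2\<close> bound through a Schur test. For complex \<open>\<beta>\<close>,
  together with \<open>\<bar>C\<^sub>m(u\<^sup>2 / 4)\<bar> \<le> exp \<bar>Re u\<bar> / \<Gamma>(m)\<close>, it bounds the kernel of
  \<open>S\<^sub>a(-t) exp (-\<delta> y\<^sup>2) S\<^sub>a(s)\<close> by a multiple of \<open>\<bar>t - s\<bar> powr (-m)\<close> uniformly in \<open>\<delta>\<close>, so the group law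
  is never needed in the \<open>T T\<^sup>*\<close> argument. Interpolation with the \<open>L\<^sup>2\<close> bound turns both kernel
  bounds into decay \<open>\<bar>t - s\<bar> powr (-2/q)\<close> from \<open>L\<^sup>r\<^sup>'\<close> to \<open>L\<^sup>r\<close>, and the
  Hardy--Littlewood--Sobolev inequality in time gives the estimate.
\<close>

section \<open>Hoelder, layer cake, interpolation and fractional integration\<close>

text \<open>Without damping the kernel of a composition of two propagators is a Fresnel-type
  integral, convergent only conditionally, and identifying the composition with a third propagator
  would need Hankel inversion. The Gaussian factor makes the integral absolutely convergent and
  brings it within the range of Weber's formula. Operator bounds are stated for integrable
  functions: there the Bochner integrals are genuine (a non-integrable integrand would silently give
  0), and the pieces produced by truncation stay in the class. Duality serves the free term alone.
  The Duhamel term carries the same pair of exponents on both sides, so decay, Minkowski's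
  inequality and fractional integration bound it directly, with absolute values inside the time
  integral; this also absorbs the cut-off at s = t. The condition a >= 0 enters as m >= 1/2, the
  range of Poisson's bound. The upper limit on r enters as q > 2, which makes the time kernel |t -
  s|^(-2/q) locally integrable.\<close>

lemma enn_powr_top [simp]: "enn_powr \<infinity> p = \<infinity>" "enn_powr top p = top"
  by (auto simp: enn_powr_def)

lemma enn_powr_ennreal [simp]: "0 \<le> x \<Longrightarrow> enn_powr (ennreal x) p = ennreal (x powr p)"
  by (simp add: enn_powr_def)

lemma enn_powr_zero [simp]: "enn_powr 0 p = 0"
  by (simp add: enn_powr_def)

lemma enn_powr_1 [simp]: "enn_powr v 1 = v"
  by (cases v) auto

lemma enn_powr_eq_0_iff [simp]: "enn_powr v p = 0 \<longleftrightarrow> v = 0"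
  by (cases v) (auto simp: powr_def)

lemma enn_powr_eq_top_iff [simp]: "enn_powr v p = top \<longleftrightarrow> v = top"
  by (cases v) auto

lemma enn_powr_mono: "0 \<le> p \<Longrightarrow> v \<le> w \<Longrightarrow> enn_powr v p \<le> enn_powr w p"
  by (cases v; cases w) (auto simp: top_unique intro!: ennreal_leI powr_mono2)

text \<open>\<open>enn_powr\<close> fixes 0 and \<open>top\<close> for every exponent, even zero or
  negative, so no sign condition on the exponents arises.\<close>

lemma enn_powr_powr: "enn_powr (enn_powr v p) q = enn_powr v (p * q)"
  by (cases v) (auto simp: powr_powr)

lemma enn_powr_mult: "enn_powr (v * w) p = enn_powr v p * enn_powr w p"
proof (cases "v = 0 \<or> w = 0")
  case False
  then show ?thesis
    by (cases v; cases w)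
      (auto simp: ennreal_mult[symmetric] powr_mult ennreal_top_mult ennreal_mult_top
        ennreal_mult_eq_top_iff)
qed auto

lemma enn_powr_add: "0 < p \<Longrightarrow> 0 < q \<Longrightarrow> enn_powr v p * enn_powr v q = enn_powr v (p + q)"
  by (cases v) (auto simp: ennreal_mult[symmetric] powr_add)

lemma enn_powr_measurable [measurable (raw)]:
  assumes [measurable]: "f \<in> borel_measurable M"
  shows "(\<lambda>x. enn_powr (f x) p) \<in> borel_measurable M"
  unfolding enn_powr_def by measurable

text \<open>The sum is at most twice the maximum. This crude constant lets one inequality serve
  exponents above and below 1.\<close>

lemma enn_powr_add_le:
  assumes "0 \<le> p"
  shows "enn_powr (v + w) p \<le> ennreal (2 powr p) * (enn_powr v p + enn_powr w p)"
proof -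
  have "enn_powr (v + w) p \<le> enn_powr (ennreal 2 * max v w) p"
    using assms by (intro enn_powr_mono) (auto simp: mult_2 max_def intro: add_mono)
  also have "\<dots> = ennreal (2 powr p) * enn_powr (max v w) p"
    by (simp only: enn_powr_mult enn_powr_ennreal)
  also have "enn_powr (max v w) p \<le> enn_powr v p + enn_powr w p"
    by (auto simp: max_def)
  finally show ?thesis by (simp add: mult_left_mono)
qed

section \<open>Hoelder's inequality and the layer-cake formula\<close>

lemma nn_Hoelder:
  fixes f g :: "'a \<Rightarrow> ennreal"
  assumes [measurable]: "f \<in> borel_measurable M" "g \<in> borel_measurable M"
    and p: "p > 1" "1/p + 1/q = 1"
  shows "(\<integral>\<^sup>+x. f x * g x \<partial>M) \<le>
    enn_powr (\<integral>\<^sup>+x. enn_powr (f x) p \<partial>M) (1/p) * enn_powr (\<integral>\<^sup>+x. enn_powr (g x) q \<partial>M) (1/q)"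
proof -
  have q: "q > 1" using p by (smt (verit) divide_less_eq_1_pos div_by_1 divide_eq_0_iff zero_less_divide_iff le_divide_eq_1)
  define A where "A = (\<integral>\<^sup>+x. enn_powr (f x) p \<partial>M)"
  define B where "B = (\<integral>\<^sup>+x. enn_powr (g x) q \<partial>M)"
  \<comment> \<open>The vanishing case comes before the infinite one: with
    \<open>0 * top = 0\<close> the right-hand side is then 0, so the integrand has to vanish almost
    everywhere even if the other integral is infinite.\<close>
  consider "A = 0 \<or> B = 0" | "A \<noteq> 0" "B \<noteq> 0" "A = top \<or> B = top"
    | a b where "a > 0" "b > 0" "A = ennreal a" "B = ennreal b"
    by (cases A; cases B) (auto simp: less_le)
  thus ?thesis
  proof cases
    case 1
    have "AE x in M. f x * g x = 0"
      using 1
    proof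
      assume "A = 0"
      hence "AE x in M. enn_powr (f x) p = 0" unfolding A_def by (subst (asm) nn_integral_0_iff_AE) auto
      thus ?thesis by eventually_elim auto
    next
      assume "B = 0"
      hence "AE x in M. enn_powr (g x) q = 0" unfolding B_def by (subst (asm) nn_integral_0_iff_AE) auto
      thus ?thesis by eventually_elim auto
    qed
    hence "(\<integral>\<^sup>+x. f x * g x \<partial>M) = 0" by (subst nn_integral_0_iff_AE) auto
    thus ?thesis by simp
  next
    case 2
    hence "enn_powr A (1/p) * enn_powr B (1/q) = top"
      by (auto simp: ennreal_mult_eq_top_iff)
    thus ?thesis by (simp add: A_def B_def)
  next
    case 3
    \<comment> \<open>The two norms. Young's inequality is applied to f / \<alpha> and g / \<beta>
      and multiplied back, so that after integration only the weights 1/p + 1/q = 1 remain.\<close>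
    define \<alpha> where "\<alpha> = a powr (1/p)"
    define \<beta> where "\<beta> = b powr (1/q)"
    have pos: "\<alpha> > 0" "\<beta> > 0" using 3 by (auto simp: \<alpha>_def \<beta>_def)
    have ap: "\<alpha> powr p = a" "\<beta> powr q = b" using 3 p q by (auto simp: \<alpha>_def \<beta>_def powr_powr)
    have pw: "f x * g x \<le> ennreal (\<alpha> * \<beta> / (p * a)) * enn_powr (f x) p + ennreal (\<alpha> * \<beta> / (q * b)) * enn_powr (g x) q" for x
    proof (cases "f x = top \<or> g x = top")
      case True
      thus ?thesis using 3 pos p q by (auto simp: ennreal_mult_top)
    next
      case False
      then obtain u v where uv: "u \<ge> 0" "v \<ge> 0" "f x = ennreal u" "g x = ennreal v"
        by (cases "f x"; cases "g x") auto
      have "(u/\<alpha>) * (v/\<beta>) \<le> (u/\<alpha>) powr p / p + (v/\<beta>) powr q / q"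
        using uv pos p q by (intro Youngs_inequality) auto
      hence "\<alpha> * \<beta> * ((u/\<alpha>) * (v/\<beta>)) \<le> \<alpha> * \<beta> * ((u/\<alpha>) powr p / p + (v/\<beta>) powr q / q)"
        using pos by (intro mult_left_mono) auto
      also have "\<alpha> * \<beta> * ((u/\<alpha>) * (v/\<beta>)) = u * v" using pos by (simp add: field_simps)
      also have "\<alpha> * \<beta> * ((u/\<alpha>) powr p / p + (v/\<beta>) powr q / q)
         = \<alpha> * \<beta> / (p * a) * u powr p + \<alpha> * \<beta> / (q * b) * v powr q"
        using pos uv p q 3 by (simp add: powr_divide ap field_simps)
      finally show ?thesis using uv pos 3 p q
        by (simp add: ennreal_mult[symmetric] ennreal_plus[symmetric] del: ennreal_plus)
    qed
    have "(\<integral>\<^sup>+x. f x * g x \<partial>M) \<le> (\<integral>\<^sup>+x. ennreal (\<alpha> * \<beta> / (p * a)) * enn_powr (f x) p + ennreal (\<alpha> * \<beta> / (q * b)) * enn_powr (g x) q \<partial>M)"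
      by (intro nn_integral_mono pw)
    also have "\<dots> = ennreal (\<alpha> * \<beta> / (p * a)) * A + ennreal (\<alpha> * \<beta> / (q * b)) * B"
      by (simp add: nn_integral_add nn_integral_cmult A_def B_def)
    also have "\<dots> = ennreal (\<alpha> * \<beta> / p + \<alpha> * \<beta> / q)"
      using 3 pos p q by (simp add: ennreal_mult[symmetric] ennreal_plus[symmetric] del: ennreal_plus)
    also have "\<alpha> * \<beta> / p + \<alpha> * \<beta> / q = \<alpha> * \<beta> * (1/p + 1/q)" by (simp add: field_simps)
    also have "\<dots> = \<alpha> * \<beta>" using p by simp
    finally show ?thesis using 3 pos by (simp add: A_def[symmetric] B_def[symmetric] \<alpha>_def \<beta>_def ennreal_mult)
  qed
qed

lemma nn_integral_powr_layer:
  fixes s v :: real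
  assumes "s > 0" "v \<ge> 0"
  shows "(\<integral>\<^sup>+l. ennreal (l powr (s - 1)) * indicator {0<..v} l \<partial>lborel) = ennreal (v powr s / s)"
proof -
  have "((\<lambda>l. l powr (s - 1)) has_integral (v powr (s - 1 + 1) / (s - 1 + 1))) {0..v}"
    using assms by (intro has_integral_powr_from_0) auto
  hence "(\<integral>\<^sup>+l. ennreal (indicator {0..v} l * l powr (s-1)) \<partial>lborel) = ennreal (v powr s / s)"
    by (subst nn_integral_has_integral_lebesgue) auto
  moreover have "(\<integral>\<^sup>+l. ennreal (l powr (s - 1)) * indicator {0<..v} l \<partial>lborel)
     = (\<integral>\<^sup>+l. ennreal (indicator {0..v} l * l powr (s-1)) \<partial>lborel)"
    by (intro nn_integral_cong) (auto simp: indicator_def)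
  ultimately show ?thesis by simp
qed

lemma ennreal_top_unique_nat:
  assumes "\<And>n::nat. ennreal (real n) \<le> x"
  shows "x = top"
proof (cases x)
  case (real y)
  obtain n :: nat where "y < real n" using reals_Archimedean2 by blast
  with assms[of n] real show ?thesis by simp
qed

lemma enn_powr_layer:
  assumes q: "q > 0"
  shows "(\<integral>\<^sup>+l. ennreal (q * l powr (q - 1)) * indicator {0<..} l * (if ennreal l \<le> v then 1 else 0) \<partial>lborel) = enn_powr v q"
    (is "?I v = _")
proof -
  have real: "?I (ennreal x) = ennreal (x powr q)" if x: "x \<ge> 0" for x
  proof -
    have "?I (ennreal x) = (\<integral>\<^sup>+l. ennreal q * (ennreal (l powr (q - 1)) * indicator {0<..x} l) \<partial>lborel)"
      using q x by (intro nn_integral_cong) (auto simp: indicator_def ennreal_mult)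
    also have "\<dots> = ennreal q * ennreal (x powr q / q)"
      using q x by (subst nn_integral_cmult) (auto simp: nn_integral_powr_layer)
    finally show ?thesis using q by (simp add: ennreal_mult[symmetric])
  qed
  show ?thesis
  proof (cases v)
    case top
    have "ennreal (real k) \<le> ?I v" for k :: nat
    proof -
      have "ennreal (real k) = ?I (ennreal (real k powr (1/q)))"
        using q by (subst real) (auto simp: powr_powr)
      also have "\<dots> \<le> ?I v" using top by (intro nn_integral_mono) (auto simp: indicator_def)
      finally show ?thesis .
    qed
    hence "?I v = top" by (rule ennreal_top_unique_nat)
    thus ?thesis using top by simp
  qed (use real in simp)
qed

text \<open>\<open>enn_powr_layer\<close> at each point, then Tonelli. Levels with
  \<open>l \<le> f x\<close> also give the right value where f is \<open>top\<close>: every level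
  counts there.\<close>

lemma layer_cake:
  fixes f :: "'a \<Rightarrow> ennreal"
  assumes "sigma_finite_measure M" and [measurable]: "f \<in> borel_measurable M" and r: "r > 0"
  shows "(\<integral>\<^sup>+x. enn_powr (f x) r \<partial>M) =
    (\<integral>\<^sup>+l. ennreal (r * l powr (r - 1)) * indicator {0<..} l * emeasure M {x\<in>space M. ennreal l \<le> f x} \<partial>lborel)"
proof -
  interpret M: sigma_finite_measure M by fact
  interpret L: pair_sigma_finite M lborel ..
  define c where "c l = ennreal (r * l powr (r - 1)) * indicator {0<..} l" for l :: real
  have [measurable]: "c \<in> borel_measurable borel" unfolding c_def by measurable
  have "(\<integral>\<^sup>+x. enn_powr (f x) r \<partial>M) = (\<integral>\<^sup>+x. (\<integral>\<^sup>+l. c l * (if ennreal l \<le> f x then 1 else 0) \<partial>lborel) \<partial>M)"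
    unfolding c_def by (simp only: enn_powr_layer[OF r])
  also have "\<dots> = (\<integral>\<^sup>+l. (\<integral>\<^sup>+x. c l * (if ennreal l \<le> f x then 1 else 0) \<partial>M) \<partial>lborel)"
    by (rule L.Fubini'[symmetric]) measurable
  also have "\<dots> = (\<integral>\<^sup>+l. (\<integral>\<^sup>+x. c l * indicator {x\<in>space M. ennreal l \<le> f x} x \<partial>M) \<partial>lborel)"
    by (intro nn_integral_cong) (auto simp: indicator_def)
  also have "\<dots> = (\<integral>\<^sup>+l. c l * emeasure M {x\<in>space M. ennreal l \<le> f x} \<partial>lborel)"
    by (subst nn_integral_cmult) auto
  finally show ?thesis by (simp add: c_def)
qed


text \<open>
  At level \<open>l\<close> the function is cut at the height \<open>\<gamma> l\<close> for which the \<open>L\<^sup>1\<close>-\<open>L\<^sup>\<infinity>\<close> bound keeps the image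
  of the large part below \<open>l / 2\<close> everywhere. Only the small part is left, and for it Chebyshev's inequality
  in \<open>L\<^sup>2\<close> suffices.
\<close>

lemma marcinkiewicz_1_inf_2_2:
  fixes K :: "'a \<Rightarrow> 'b \<Rightarrow> complex" and f :: "'b \<Rightarrow> complex"
  assumes sf: "sigma_finite_measure M" "sigma_finite_measure N"
    and K [measurable]: "case_prod K \<in> borel_measurable (M \<Otimes>\<^sub>M N)"
    and KD: "\<And>x y. x \<in> space M \<Longrightarrow> y \<in> space N \<Longrightarrow> norm (K x y) \<le> D" and D: "D > 0"
    and L2: "\<And>g. integrable N g \<Longrightarrow>
      (\<integral>\<^sup>+x. ennreal ((norm (\<integral>y. K x y * g y \<partial>N))\<^sup>2) \<partial>M) \<le> ennreal A * (\<integral>\<^sup>+y. ennreal ((norm (g y))\<^sup>2) \<partial>N)"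
    and A: "A > 0" and r: "r > 2" and p: "p = r / (r - 1)"
    and f: "integrable N f"
  shows "(\<integral>\<^sup>+x. ennreal (norm (\<integral>y. K x y * f y \<partial>N) powr r) \<partial>M)
    \<le> ennreal (4 * A * r / (r - 2) * (2 * D) powr (r - 2)) * enn_powr (\<integral>\<^sup>+y. ennreal (norm (f y) powr p) \<partial>N) (r - 1)"
proof -
  interpret M: sigma_finite_measure M by fact
  interpret N: sigma_finite_measure N by fact
  interpret MN: pair_sigma_finite M N ..
  interpret NL: pair_sigma_finite N lborel ..
  have fm [measurable]: "f \<in> borel_measurable N" using f by auto
  have p1: "p > 1" "p - 1 = 1 / (r - 1)" using r by (auto simp: p field_simps)
  define T where "T g x = (\<integral>y. K x y * g y \<partial>N)" for g x
  have Tm [measurable]: "T g \<in> borel_measurable M" if [measurable]: "g \<in> borel_measurable N" for g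
    unfolding T_def by measurable
  define I where "I = (\<integral>\<^sup>+y. ennreal (norm (f y) powr p) \<partial>N)"
  consider "I = 0" | "I = top" | n where "n > 0" "I = ennreal n" by (cases I) (auto simp: less_le)
  thus ?thesis
  proof cases
    case 1
    hence "AE y in N. f y = 0" unfolding I_def
      by (subst (asm) nn_integral_0_iff_AE) auto
    hence "T f x = 0" if "x \<in> space M" for x unfolding T_def using that
      by (intro integral_eq_zero_AE) auto
    hence "(\<integral>\<^sup>+x. ennreal (norm (T f x) powr r) \<partial>M) = 0"
      by (subst nn_integral_0_iff_AE) auto
    thus ?thesis by (simp add: T_def)
  next
    case 2
    hence "ennreal (4 * A * r / (r - 2) * (2 * D) powr (r - 2)) * enn_powr I (r - 1) = top"
      using A r D by (auto simp: ennreal_mult_top)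
    thus ?thesis by (simp add: I_def)
  next
    case (3 n)
    \<comment> \<open>Where |f| exceeds the height \<gamma> one has |f| <= \<gamma>^(1-p) |f|^p, so
      the image of the large part is at most D \<gamma>^(1-p) n. Equating this with l / 2 gives
      \<gamma>^(1-p) = l / c for c = 2 D n, and (r - 1) (1 - p) = -1 solves it for \<gamma>.\<close>
    define c where "c = 2 * D * n"
    have c: "c > 0" using 3 D by (auto simp: c_def)
    define \<gamma> where "\<gamma> l = (c / l) powr (r - 1)" for l
    have \<gamma>pos: "\<gamma> l > 0" if "l > 0" for l using that c by (auto simp: \<gamma>_def)
    have \<gamma>p: "\<gamma> l powr (1 - p) = l / c" if "l > 0" for l
    proof -
      have "(r - 1) * (1 - p) = -1" using r by (simp add: p field_simps)
      thus ?thesis using that c unfolding \<gamma>_def powr_powr by (simp add: powr_minus divide_simps)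
    qed
    have [measurable]: "\<gamma> \<in> borel_measurable borel" unfolding \<gamma>_def by measurable
    define fb where "fb l y = (if norm (f y) \<le> \<gamma> l then 0 else f y)" for l y
    define fs where "fs l y = (if norm (f y) \<le> \<gamma> l then f y else 0)" for l y
    have fbm [measurable]: "fb l \<in> borel_measurable N" "fs l \<in> borel_measurable N" for l unfolding fb_def fs_def by auto
    have fbi: "integrable N (fb l)" "integrable N (fs l)" for l
      by (auto intro!: Bochner_Integration.integrable_bound[OF f] simp: fb_def fs_def)
    have Ki: "integrable N (\<lambda>y. K x y * g y)" if "x \<in> space M" "integrable N g" for x g
    proof (rule Bochner_Integration.integrable_bound[where f = "\<lambda>y. of_real D * g y"])
      show "integrable N (\<lambda>y. complex_of_real D * g y)" using that by auto
      have [measurable]: "g \<in> borel_measurable N" using that by auto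
      show "(\<lambda>y. K x y * g y) \<in> borel_measurable N" using that by measurable
      show "AE y in N. norm (K x y * g y) \<le> norm (complex_of_real D * g y)"
        using KD that D by (auto simp: norm_mult intro!: mult_right_mono)
    qed
    have Tsum: "T f x = T (fb l) x + T (fs l) x" if "x \<in> space M" for l x
    proof -
      have "T (fb l) x + T (fs l) x = (\<integral>y. K x y * fb l y + K x y * fs l y \<partial>N)"
        unfolding T_def by (rule Bochner_Integration.integral_add[symmetric]) (use that fbi Ki in auto)
      also have "\<dots> = T f x" unfolding T_def by (intro Bochner_Integration.integral_cong) (auto simp: fb_def fs_def)
      finally show ?thesis by simp
    qed
    have Tb: "norm (T (fb l) x) \<le> l / 2" if x: "x \<in> space M" and l: "l > 0" for x l
    proof -
      have "ennreal (norm (T (fb l) x)) \<le> (\<integral>\<^sup>+y. ennreal (norm (K x y * fb l y)) \<partial>N)"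
        unfolding T_def by (intro integral_norm_bound_ennreal Ki x fbi)
      also have "\<dots> \<le> (\<integral>\<^sup>+y. ennreal (D * \<gamma> l powr (1 - p)) * ennreal (norm (f y) powr p) \<partial>N)"
      proof (intro nn_integral_mono)
        fix y assume y: "y \<in> space N"
        show "ennreal (norm (K x y * fb l y)) \<le> ennreal (D * \<gamma> l powr (1 - p)) * ennreal (norm (f y) powr p)"
        proof (cases "norm (f y) \<le> \<gamma> l")
          case False
          have nf: "norm (f y) > 0" using False \<gamma>pos[OF l] by linarith
          have "norm (f y) = norm (f y) powr (1 - p) * norm (f y) powr p"
            using nf by (simp add: powr_add[symmetric])
          also have "\<dots> \<le> \<gamma> l powr (1 - p) * norm (f y) powr p"
            using False \<gamma>pos[OF l] p1 by (intro mult_right_mono powr_mono2') auto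
          finally have "norm (f y) \<le> \<gamma> l powr (1 - p) * norm (f y) powr p" .
          hence "norm (K x y) * norm (f y) \<le> D * (\<gamma> l powr (1 - p) * norm (f y) powr p)"
            using KD[OF x y] D by (intro mult_mono) auto
          thus ?thesis using D False by (simp add: fb_def norm_mult ennreal_mult[symmetric] mult.assoc)
        qed (auto simp: fb_def)
      qed
      also have "\<dots> = ennreal (D * \<gamma> l powr (1 - p)) * I"
        by (subst nn_integral_cmult) (auto simp: I_def)
      also have "\<dots> = ennreal (l / 2)" using 3 D l c
        by (simp add: \<gamma>p ennreal_mult[symmetric] c_def)
      finally show ?thesis using l by (subst (asm) ennreal_le_iff) auto
    qed
    \<comment> \<open>Where |T f| >= l, the image of the small part is at least l / 2; squaring this
      is the source of the factor 4 / l^2.\<close>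
    have lev: "emeasure M {x\<in>space M. l \<le> norm (T f x)} \<le> ennreal (4 * A / l\<^sup>2) * (\<integral>\<^sup>+y. ennreal ((norm (fs l y))\<^sup>2) \<partial>N)"
      if l: "l > 0" for l
    proof -
      have "emeasure M {x\<in>space M. l \<le> norm (T f x)} = (\<integral>\<^sup>+x. indicator {x\<in>space M. l \<le> norm (T f x)} x \<partial>M)" by simp
      also have "\<dots> \<le> (\<integral>\<^sup>+x. ennreal (4 / l\<^sup>2) * ennreal ((norm (T (fs l) x))\<^sup>2) \<partial>M)"
      proof (intro nn_integral_mono)
        fix x assume x: "x \<in> space M"
        show "indicator {x \<in> space M. l \<le> cmod (T f x)} x \<le> ennreal (4 / l\<^sup>2) * ennreal ((cmod (T (fs l) x))\<^sup>2)"
        proof (cases "l \<le> norm (T f x)")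
          case True
          have "norm (T f x) \<le> norm (T (fb l) x) + norm (T (fs l) x)" using Tsum[OF x, of l] norm_triangle_ineq by simp
          hence "l / 2 \<le> norm (T (fs l) x)" using Tb[OF x l] True by linarith
          hence "(l/2)^2 \<le> (norm (T (fs l) x))\<^sup>2" using l by (intro power_mono) auto
          hence "1 \<le> 4 / l\<^sup>2 * (norm (T (fs l) x))\<^sup>2" using l by (simp add: field_simps)
          hence "ennreal 1 \<le> ennreal (4 / l\<^sup>2 * (norm (T (fs l) x))\<^sup>2)" by (rule ennreal_leI)
          also have "\<dots> = ennreal (4 / l\<^sup>2) * ennreal ((norm (T (fs l) x))\<^sup>2)" by (rule ennreal_mult'') simp
          finally show ?thesis using True x by (simp only: indicator_def) simp
        qed auto
      qed
      also have "\<dots> = ennreal (4 / l\<^sup>2) * (\<integral>\<^sup>+x. ennreal ((norm (T (fs l) x))\<^sup>2) \<partial>M)"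
        by (subst nn_integral_cmult) auto
      also have "\<dots> \<le> ennreal (4 / l\<^sup>2) * (ennreal A * (\<integral>\<^sup>+y. ennreal ((norm (fs l y))\<^sup>2) \<partial>N))"
        unfolding T_def by (intro mult_left_mono L2 fbi) auto
      also have "\<dots> = ennreal (4 * A / l\<^sup>2) * (\<integral>\<^sup>+y. ennreal ((norm (fs l y))\<^sup>2) \<partial>N)"
        using A l by (simp add: mult.assoc[symmetric] ennreal_mult[symmetric])
      finally show ?thesis .
    qed
    have "(\<integral>\<^sup>+x. ennreal (norm (T f x) powr r) \<partial>M) =
      (\<integral>\<^sup>+l. ennreal (r * l powr (r - 1)) * indicator {0<..} l * emeasure M {x\<in>space M. l \<le> norm (T f x)} \<partial>lborel)"
      using layer_cake[OF sf(1), of "\<lambda>x. ennreal (norm (T f x))" r] r by simp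
    also have "\<dots> \<le> (\<integral>\<^sup>+l. (\<integral>\<^sup>+y. ennreal (r * 4 * A) * (ennreal (l powr (r - 3)) * indicator {0<..} l * ennreal ((norm (fs l y))\<^sup>2)) \<partial>N) \<partial>lborel)"
    proof (intro nn_integral_mono)
      fix l :: real
      show "ennreal (r * l powr (r - 1)) * indicator {0<..} l * emeasure M {x\<in>space M. l \<le> norm (T f x)}
        \<le> (\<integral>\<^sup>+y. ennreal (r * 4 * A) * (ennreal (l powr (r - 3)) * indicator {0<..} l * ennreal ((norm (fs l y))\<^sup>2)) \<partial>N)"
      proof (cases "l > 0")
        case True
        have "r * l powr (r - 1) * (4 * A / l\<^sup>2) = r * 4 * A * l powr (r - 3)"
          using True powr_diff[of l "r - 1" 2] by simp
        hence e: "ennreal (r * l powr (r - 1)) * ennreal (4 * A / l\<^sup>2) = ennreal (r * 4 * A * l powr (r - 3))"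
          using r True A by (subst ennreal_mult[symmetric]) auto
        have "ennreal (r * l powr (r - 1)) * emeasure M {x\<in>space M. l \<le> norm (T f x)} \<le>
          ennreal (r * l powr (r - 1)) * (ennreal (4 * A / l\<^sup>2) * (\<integral>\<^sup>+y. ennreal ((norm (fs l y))\<^sup>2) \<partial>N))"
          by (intro mult_left_mono lev True) auto
        also have "\<dots> = (\<integral>\<^sup>+y. ennreal (r * 4 * A * l powr (r - 3)) * ennreal ((norm (fs l y))\<^sup>2) \<partial>N)"
          by (simp add: mult.assoc[symmetric] e nn_integral_cmult)
        finally show ?thesis using True r A by (simp add: ennreal_mult mult.assoc)
      qed auto
    qed
    also have "\<dots> = (\<integral>\<^sup>+y. (\<integral>\<^sup>+l. ennreal (r * 4 * A) * (ennreal (l powr (r - 3)) * indicator {0<..} l * ennreal ((norm (fs l y))\<^sup>2)) \<partial>lborel) \<partial>N)"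
      by (rule NL.Fubini') (unfold fs_def, measurable)
    also have "\<dots> \<le> (\<integral>\<^sup>+y. ennreal (4 * A * r / (r - 2) * c powr (r - 2)) * ennreal (norm (f y) powr p) \<partial>N)"
    proof (intro nn_integral_mono)
      fix y
      \<comment> \<open>For fixed y, the condition |f y| <= \<gamma> l reads l <= \<Lambda>. The
        integral over l therefore runs over \<open>(0, \<Lambda>]\<close> only, and r > 2 makes
        l^(r-3) integrable at 0.\<close>
      define \<Lambda> where "\<Lambda> = c * norm (f y) powr (1 - p)"
      show "(\<integral>\<^sup>+l. ennreal (r * 4 * A) * (ennreal (l powr (r - 3)) * indicator {0<..} l * ennreal ((norm (fs l y))\<^sup>2)) \<partial>lborel) \<le> ennreal (4 * A * r / (r - 2) * c powr (r - 2)) * ennreal (norm (f y) powr p)"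
      proof (cases "f y = 0")
        case False
        have "(\<integral>\<^sup>+l. ennreal (r * 4 * A) * (ennreal (l powr (r - 3)) * indicator {0<..} l * ennreal ((norm (fs l y))\<^sup>2)) \<partial>lborel)
          \<le> (\<integral>\<^sup>+l. ennreal (r * 4 * A * (norm (f y))\<^sup>2) * (ennreal (l powr ((r - 2) - 1)) * indicator {0<..\<Lambda>} l) \<partial>lborel)"
        proof (intro nn_integral_mono)
          fix l :: real
          have "l \<le> \<Lambda>" if "l > 0" "norm (f y) \<le> \<gamma> l"
          proof -
            have "norm (f y) powr (p - 1) \<le> \<gamma> l powr (p - 1)" using that p1 r by (intro powr_mono2) auto
            also have "\<dots> = inverse (\<gamma> l powr (1 - p))" by (simp flip: powr_minus)
            also have "\<dots> = c / l" using \<gamma>p that by simp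
            finally have "l * norm (f y) powr (p - 1) \<le> c" using that by (simp add: field_simps)
            moreover have "norm (f y) powr (1 - p) * norm (f y) powr (p - 1) = 1"
              using False by (simp add: powr_add[symmetric])
            ultimately have "(l * norm (f y) powr (p - 1)) * norm (f y) powr (1 - p) \<le> \<Lambda>"
              unfolding \<Lambda>_def by (intro mult_right_mono) auto
            thus ?thesis using \<open>norm (f y) powr (1 - p) * norm (f y) powr (p - 1) = 1\<close>
              by (simp add: algebra_simps)
          qed
          thus "ennreal (r * 4 * A) * (ennreal (l powr (r - 3)) * indicator {0<..} l * ennreal ((norm (fs l y))\<^sup>2))
            \<le> ennreal (r * 4 * A * (norm (f y))\<^sup>2) * (ennreal (l powr ((r - 2) - 1)) * indicator {0<..\<Lambda>} l)"
            using r A by (auto simp: fs_def indicator_def ennreal_mult[symmetric] intro!: ennreal_leI)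
        qed
        also have "\<dots> = ennreal (r * 4 * A * (norm (f y))\<^sup>2) * ennreal (\<Lambda> powr (r - 2) / (r - 2))"
          using r c by (subst nn_integral_cmult, simp, subst nn_integral_powr_layer) (auto simp: \<Lambda>_def)
        also have "\<dots> = ennreal (4 * A * r / (r - 2) * c powr (r - 2)) * ennreal (norm (f y) powr p)"
        proof -
          have "(1 - p) * (r - 2) = p - 2" using r by (simp add: p field_simps)
          hence "\<Lambda> powr (r - 2) = c powr (r - 2) * norm (f y) powr (p - 2)"
            using c by (simp add: \<Lambda>_def powr_mult powr_powr)
          moreover have "norm (f y) powr (p - 2) * (norm (f y))\<^sup>2 = norm (f y) powr p"
            using False powr_add[of "norm (f y)" "p - 2" 2] by simp
          ultimately have "r * 4 * A * (norm (f y))\<^sup>2 * (\<Lambda> powr (r - 2) / (r - 2)) = 4 * A * r / (r - 2) * c powr (r - 2) * norm (f y) powr p"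
            by (simp add: field_simps)
          thus ?thesis using r A by (simp add: ennreal_mult[symmetric])
        qed
        finally show ?thesis .
      next
        case True
        hence "fs l y = 0" for l by (simp add: fs_def)
        thus ?thesis by simp
      qed
    qed
    also have "\<dots> = ennreal (4 * A * r / (r - 2) * c powr (r - 2)) * I"
      by (subst nn_integral_cmult) (auto simp: I_def)
    also have "\<dots> = ennreal (4 * A * r / (r - 2) * (2 * D) powr (r - 2)) * enn_powr I (r - 1)"
    proof -
      have "c powr (r - 2) * n = (2 * D) powr (r - 2) * n powr (r - 1)"
        using 3 D powr_add[of n "r - 2" 1] by (simp add: c_def powr_mult)
      hence "4 * A * r / (r - 2) * c powr (r - 2) * n = 4 * A * r / (r - 2) * (2 * D) powr (r - 2) * n powr (r - 1)"
        by simp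
      thus ?thesis using 3 r A by (simp add: ennreal_mult[symmetric])
    qed
    finally show ?thesis by (simp add: T_def I_def)
  qed
qed


section \<open>Fractional integration on the line and Minkowski's inequality\<close>

lemma nn_integral_abs_powr_ball:
  assumes "0 < \<alpha>" "\<alpha> < 1" "R > 0"
  shows "(\<integral>\<^sup>+s. ennreal (\<bar>t - s\<bar> powr (- \<alpha>)) * indicator {s. \<bar>t - s\<bar> \<le> R} s \<partial>lborel) = ennreal (2 * R powr (1 - \<alpha>) / (1 - \<alpha>))"
proof -
  \<comment> \<open>A one-sided profile; its two reflections cover s < t and s > t. The point s = t
    contributes nothing on either side, because \<open>0 powr b = 0\<close>.\<close>
  define h where "h u = ennreal (u powr ((1 - \<alpha>) - 1)) * indicator {0<..R} u" for u :: real
  have [measurable]: "h \<in> borel_measurable borel" unfolding h_def by measurable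
  have h: "(\<integral>\<^sup>+u. h u \<partial>lborel) = ennreal (R powr (1 - \<alpha>) / (1 - \<alpha>))"
    unfolding h_def using assms by (intro nn_integral_powr_layer) auto
  have 1: "(\<integral>\<^sup>+s. h (t - s) \<partial>lborel) = (\<integral>\<^sup>+u. h u \<partial>lborel)"
    by (subst nn_integral_real_affine[of h "-1" t]) auto
  have 2: "(\<integral>\<^sup>+s. h (s - t) \<partial>lborel) = (\<integral>\<^sup>+u. h u \<partial>lborel)"
    by (subst nn_integral_real_affine[of h "1" "-t"]) auto
  have "(\<integral>\<^sup>+s. ennreal (\<bar>t - s\<bar> powr (- \<alpha>)) * indicator {s. \<bar>t - s\<bar> \<le> R} s \<partial>lborel) = (\<integral>\<^sup>+s. h (t - s) + h (s - t) \<partial>lborel)"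
    by (intro nn_integral_cong) (auto simp: h_def indicator_def abs_if)
  also have "\<dots> = ennreal (R powr (1 - \<alpha>) / (1 - \<alpha>)) + ennreal (R powr (1 - \<alpha>) / (1 - \<alpha>))"
    by (subst nn_integral_add) (auto simp: 1 2 h)
  also have "\<dots> = ennreal (2 * R powr (1 - \<alpha>) / (1 - \<alpha>))"
    using assms by (simp add: ennreal_plus[symmetric] del: ennreal_plus)
  finally show ?thesis .
qed

lemma nn_integral_inverse_square_tail:
  assumes "R > 0"
  shows "(\<integral>\<^sup>+s. ennreal (\<bar>t - s\<bar> powr (- 2)) * indicator {s. \<bar>t - s\<bar> \<ge> R} s \<partial>lborel) = ennreal (2 / R)"
proof -
  define h where "h u = ennreal (u powr (- 2)) * indicator {R..} u" for u :: real
  have [measurable]: "h \<in> borel_measurable borel" unfolding h_def by measurable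
  have "((\<lambda>x. x powr (-2)) has_integral - (R powr (-2 + 1)) / (-2 + 1)) {R..}"
    using assms by (intro has_integral_powr_to_inf) auto
  hence "(\<integral>\<^sup>+u. ennreal (indicator {R..} u * u powr (- 2)) \<partial>lborel) = ennreal (1 / R)"
    using assms by (subst nn_integral_has_integral_lebesgue) (auto simp: powr_minus divide_simps)
  moreover have "(\<integral>\<^sup>+u. h u \<partial>lborel) = (\<integral>\<^sup>+u. ennreal (indicator {R..} u * u powr (- 2)) \<partial>lborel)"
    by (intro nn_integral_cong) (auto simp: h_def indicator_def)
  ultimately have h: "(\<integral>\<^sup>+u. h u \<partial>lborel) = ennreal (1 / R)" by simp
  have 1: "(\<integral>\<^sup>+s. h (t - s) \<partial>lborel) = (\<integral>\<^sup>+u. h u \<partial>lborel)"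
    by (subst nn_integral_real_affine[of h "-1" t]) auto
  have 2: "(\<integral>\<^sup>+s. h (s - t) \<partial>lborel) = (\<integral>\<^sup>+u. h u \<partial>lborel)"
    by (subst nn_integral_real_affine[of h "1" "-t"]) auto
  have "(\<integral>\<^sup>+s. ennreal (\<bar>t - s\<bar> powr (- 2)) * indicator {s. \<bar>t - s\<bar> \<ge> R} s \<partial>lborel) = (\<integral>\<^sup>+s. h (t - s) + h (s - t) \<partial>lborel)"
    using assms by (intro nn_integral_cong) (auto simp: h_def indicator_def abs_if)
  also have "\<dots> = ennreal (1 / R) + ennreal (1 / R)"
    by (subst nn_integral_add) (auto simp: 1 2 h)
  also have "\<dots> = ennreal (2 / R)"
    using assms by (simp add: ennreal_plus[symmetric] del: ennreal_plus)
  finally show ?thesis .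
qed

text \<open>The Riesz potential of order 1 - \<alpha> on the line, without its normalising
  constant.\<close>

definition riesz :: "real \<Rightarrow> (real \<Rightarrow> ennreal) \<Rightarrow> real \<Rightarrow> ennreal" where
  "riesz \<alpha> g t = (\<integral>\<^sup>+s. ennreal (\<bar>t - s\<bar> powr (- \<alpha>)) * g s \<partial>lborel)"

lemma riesz_measurable [measurable]:
  assumes [measurable]: "g \<in> borel_measurable borel"
  shows "riesz \<alpha> g \<in> borel_measurable borel"
  unfolding riesz_def by measurable

text \<open>The bound from L^(q') to L^q raised to the power q, which keeps both sides integrals;
  the exponent q - 1 is q / q'. Naming the admissible constants lets later estimates carry them
  explicitly.\<close>

definition hls_const :: "real \<Rightarrow> real \<Rightarrow> bool" where
  "hls_const q C \<longleftrightarrow> C > 0 \<and> (\<forall>g\<in>borel_measurable borel.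
    (\<integral>\<^sup>+t. enn_powr (riesz (2/q) g t) q \<partial>lborel) \<le> ennreal C * enn_powr (\<integral>\<^sup>+s. enn_powr (g s) (q / (q - 1)) \<partial>lborel) (q - 1))"

text \<open>
  At level \<open>l\<close> the kernel is cut at the radius \<open>R l\<close> for which Hoelder bounds the tail by \<open>l / 2\<close>, and
  simultaneously \<open>g\<close> at the height \<open>\<gamma> l\<close> for which the truncated kernel maps the small part below \<open>l / 4\<close>.
  Chebyshev in \<open>L\<^sup>1\<close> for the remaining piece gives the strong type directly.
\<close>

lemma hardy_littlewood_sobolev:
  fixes q :: real
  assumes q: "q > 2"
  obtains C where "hls_const q C"
proof -
  define p where "p = q / (q - 1)"
  define \<alpha> where "\<alpha> = 2 / q"
  have p: "p > 1" "1/q + 1/p = 1" using q by (auto simp: p_def field_simps)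
  have \<alpha>: "0 < \<alpha>" "\<alpha> < 1" using q by (auto simp: \<alpha>_def)
  define c1 where "c1 = 2 / (1 - \<alpha>)"
  have c1: "c1 > 0" using \<alpha> by (auto simp: c1_def)
  define C where "C = q * (4 * c1 * (2 powr (q + 1)) powr (1 - \<alpha>)) powr p"
  have C: "C > 0" using c1 q by (auto simp: C_def)
  have main: "(\<integral>\<^sup>+t. enn_powr (riesz \<alpha> g t) q \<partial>lborel) \<le> ennreal C * enn_powr (\<integral>\<^sup>+s. enn_powr (g s) p \<partial>lborel) (q - 1)"
    if gm [measurable]: "g \<in> borel_measurable borel" for g
  proof -
    define I where "I = (\<integral>\<^sup>+s. enn_powr (g s) p \<partial>lborel)"
    consider "I = 0" | "I = top" | n where "n > 0" "I = ennreal n" by (cases I) (auto simp: less_le)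
    thus ?thesis
    proof cases
      case 1
      hence "AE s in lborel. g s = 0" unfolding I_def by (subst (asm) nn_integral_0_iff_AE) auto
      hence "riesz \<alpha> g t = 0" for t unfolding riesz_def
        by (subst nn_integral_0_iff_AE) auto
      thus ?thesis by simp
    next
      case 2
      thus ?thesis using C by (simp add: I_def[symmetric] ennreal_mult_top)
    next
      case (3 n)
      \<comment> \<open>The q-th power of the kernel is |t - s|^(-2), whose integral over |t - s| >=
        R is 2 / R. Hoelder bounds the tail by (2/R)^(1/q) n^(1/p), and setting this equal to l / 2
        gives R = 2^(q+1) n^(q-1) l^(-q).\<close>
      define c2 where "c2 = 2 powr (q + 1) * n powr (q - 1)"
      define R where "R l = c2 * l powr (- q)" for l :: real
      have c2: "c2 > 0" using 3 by (auto simp: c2_def)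
      have R: "R l > 0" if "l > 0" for l using that c2 by (auto simp: R_def)
      \<comment> \<open>The truncated kernel has mass c1 R^(1-\<alpha>), proportional to l^(-(q-2)).
        Requiring mass times \<gamma> to be l / 4 forces \<gamma> = l^(q-1) / H with this H.\<close>
      define H where "H = 4 * c1 * c2 powr (1 - \<alpha>)"
      have H: "H > 0" using c1 c2 by (auto simp: H_def)
      define \<gamma> where "\<gamma> l = l powr (q - 1) / H" for l :: real
      have \<gamma>: "\<gamma> l > 0" if "l > 0" for l using that H by (auto simp: \<gamma>_def)
      have [measurable]: "\<gamma> \<in> borel_measurable borel" unfolding \<gamma>_def by measurable
      have \<kappa>: "c1 * R l powr (1 - \<alpha>) = l / (4 * \<gamma> l)" if "l > 0" for l
      proof -
        have "q * (1 - \<alpha>) = q - 2" using q by (simp add: \<alpha>_def field_simps)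
        hence "R l powr (1 - \<alpha>) = c2 powr (1 - \<alpha>) * l powr (- (q - 2))"
          using c2 that by (simp add: R_def powr_mult powr_powr)
        moreover have "l powr (- (q - 2)) = l / l powr (q - 1)"
          using that powr_diff[of l 1 "q - 1"] by simp
        ultimately show ?thesis using H that by (simp add: \<gamma>_def H_def field_simps)
      qed
      define g1 where "g1 l s = (if g s \<le> ennreal (\<gamma> l) then 0 else g s)" for l s
      have [measurable]: "g1 l \<in> borel_measurable borel" for l unfolding g1_def by measurable
      define k where "k l t s = ennreal (\<bar>t - s\<bar> powr (- \<alpha>)) * indicator {s. \<bar>t - s\<bar> \<le> R l} s" for l t s :: real
      have km [measurable]: "(\<lambda>z. k l (fst z) (snd z)) \<in> borel_measurable (borel \<Otimes>\<^sub>M borel)" for l unfolding k_def by measurable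
      have [measurable]: "k l t \<in> borel_measurable borel" for l t unfolding k_def by measurable
      define h where "h l t = (\<integral>\<^sup>+s. k l t s * g1 l s \<partial>lborel)" for l t
      have hm [measurable]: "h l \<in> borel_measurable borel" for l unfolding h_def k_def by measurable
      have kint: "(\<integral>\<^sup>+s. k l t s \<partial>lborel) = ennreal (l / (4 * \<gamma> l))" if "l > 0" for l t
        unfolding k_def using nn_integral_abs_powr_ball[OF \<alpha> R[OF that]] \<kappa>[OF that] by (simp add: c1_def)
      have split: "riesz \<alpha> g t \<le> h l t + ennreal (3 * l / 4)" if l: "l > 0" for l t
      proof -
        define w where "w s = ennreal (\<bar>t - s\<bar> powr (- \<alpha>)) * indicator {s. \<bar>t - s\<bar> \<ge> R l} s" for s
        have [measurable]: "w \<in> borel_measurable borel" unfolding w_def by measurable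
        have "riesz \<alpha> g t \<le> (\<integral>\<^sup>+s. (k l t s * g1 l s + k l t s * ennreal (\<gamma> l)) + w s * g s \<partial>lborel)"
          unfolding riesz_def
        proof (intro nn_integral_mono)
          fix s
          show "ennreal (\<bar>t - s\<bar> powr (- \<alpha>)) * g s \<le> (k l t s * g1 l s + k l t s * ennreal (\<gamma> l)) + w s * g s"
            by (cases "\<bar>t - s\<bar> \<le> R l"; cases "g s \<le> ennreal (\<gamma> l)")
              (auto simp: k_def w_def g1_def indicator_def intro!: add_increasing2 mult_left_mono)
        qed
        also have "\<dots> = (h l t + ennreal (l / (4 * \<gamma> l)) * ennreal (\<gamma> l)) + (\<integral>\<^sup>+s. w s * g s \<partial>lborel)"
          by (simp add: nn_integral_add nn_integral_multc kint[OF l] h_def)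
        also have "ennreal (l / (4 * \<gamma> l)) * ennreal (\<gamma> l) = ennreal (l / 4)"
          using \<gamma>[OF l] l by (simp add: ennreal_mult[symmetric])
        also have "(\<integral>\<^sup>+s. w s * g s \<partial>lborel) \<le> enn_powr (\<integral>\<^sup>+s. enn_powr (w s) q \<partial>lborel) (1/q) * enn_powr I (1/p)"
          unfolding I_def using p q by (intro nn_Hoelder) auto
        also have "(\<integral>\<^sup>+s. enn_powr (w s) q \<partial>lborel) = ennreal (2 / R l)"
        proof -
          have "(\<integral>\<^sup>+s. enn_powr (w s) q \<partial>lborel) = (\<integral>\<^sup>+s. ennreal (\<bar>t - s\<bar> powr (- 2)) * indicator {s. \<bar>t - s\<bar> \<ge> R l} s \<partial>lborel)"
            using q by (intro nn_integral_cong) (auto simp: w_def indicator_def powr_powr \<alpha>_def)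
          thus ?thesis using nn_integral_inverse_square_tail[OF R[OF l]] by simp
        qed
        also have "enn_powr (ennreal (2 / R l)) (1/q) * enn_powr I (1/p) = ennreal (l / 2)"
        proof -
          have "2 / R l = (2 powr (- q)) * n powr (- (q - 1)) * l powr q"
            using 3 l powr_minus_divide[of n "q - 1"] by (simp add: R_def c2_def powr_minus powr_add field_simps)
          hence "(2 / R l) powr (1/q) = 2 powr (- 1) * n powr (- (q - 1) / q) * l"
            using q l 3 by (simp add: powr_mult powr_powr)
          also have "- (q - 1) / q = - (1/p)" using q by (simp add: p_def field_simps)
          finally have "(2 / R l) powr (1/q) * n powr (1/p) = l / 2"
            using 3 by (simp add: powr_minus field_simps)
          moreover have "enn_powr (ennreal (2 / R l)) (1/q) * enn_powr I (1/p) = ennreal ((2 / R l) powr (1/q) * n powr (1/p))"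
            using 3 R[OF l] by (simp add: ennreal_mult[symmetric])
          ultimately show ?thesis by (simp only:)
        qed
        also have "h l t + ennreal (l / 4) + ennreal (l / 2) = h l t + ennreal (3 * l / 4)"
          using l by (simp add: add.assoc ennreal_plus[symmetric] del: ennreal_plus)
        finally show ?thesis by (simp add: add_left_mono add_right_mono)
      qed
      \<comment> \<open>Tail and small part use up 3 l / 4, so \<open>h\<close> must reach l / 4.
        The resulting factor 4 / l meets the kernel mass l / (4 \<gamma> l), and only 1 / \<gamma> l
        survives.\<close>
      have lev: "emeasure lborel {t\<in>space lborel. ennreal l \<le> riesz \<alpha> g t} \<le> ennreal (1 / \<gamma> l) * (\<integral>\<^sup>+s. g1 l s \<partial>lborel)"
        if l: "l > 0" for l
      proof -
        have "emeasure lborel {t\<in>space lborel. ennreal l \<le> riesz \<alpha> g t} = (\<integral>\<^sup>+t. indicator {t\<in>space lborel. ennreal l \<le> riesz \<alpha> g t} t \<partial>lborel)"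
          by (subst nn_integral_indicator) auto
        also have "\<dots> \<le> (\<integral>\<^sup>+t. ennreal (4 / l) * h l t \<partial>lborel)"
        proof (intro nn_integral_mono)
          fix t
          show "indicator {t\<in>space lborel. ennreal l \<le> riesz \<alpha> g t} t \<le> ennreal (4 / l) * h l t"
          proof (cases "ennreal l \<le> riesz \<alpha> g t")
            case True
            have "ennreal l \<le> h l t + ennreal (3 * l / 4)" using True split[OF l, of t] by (rule order_trans)
            hence "1 \<le> ennreal (4 / l) * h l t" using l
              by (cases "h l t") (auto simp: ennreal_mult[symmetric] ennreal_plus[symmetric] ennreal_mult_top field_simps simp del: ennreal_plus)
            thus ?thesis by (simp add: indicator_def)
          qed auto
        qed
        also have "\<dots> = ennreal (4 / l) * (\<integral>\<^sup>+t. h l t \<partial>lborel)" by (subst nn_integral_cmult) auto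
        also have "(\<integral>\<^sup>+t. h l t \<partial>lborel) = (\<integral>\<^sup>+s. (\<integral>\<^sup>+t. k l t s * g1 l s \<partial>lborel) \<partial>lborel)"
          unfolding h_def by (rule lborel_pair.Fubini') (unfold k_def, measurable)
        also have "\<dots> = (\<integral>\<^sup>+s. (\<integral>\<^sup>+t. k l s t * g1 l s \<partial>lborel) \<partial>lborel)"
          by (intro nn_integral_cong) (auto simp: k_def indicator_def abs_minus_commute)
        also have "\<dots> = ennreal (l / (4 * \<gamma> l)) * (\<integral>\<^sup>+s. g1 l s \<partial>lborel)"
          by (simp add: nn_integral_multc nn_integral_cmult kint[OF l])
        finally show ?thesis using l \<gamma>[OF l] by (simp add: mult.assoc[symmetric] ennreal_mult[symmetric])
      qed
      have [measurable]: "riesz \<alpha> g \<in> borel_measurable borel" by (rule riesz_measurable[OF gm])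
      have "(\<integral>\<^sup>+t. enn_powr (riesz \<alpha> g t) q \<partial>lborel) =
        (\<integral>\<^sup>+l. ennreal (q * l powr (q - 1)) * indicator {0<..} l * emeasure lborel {t\<in>space lborel. ennreal l \<le> riesz \<alpha> g t} \<partial>lborel)"
        using q by (intro layer_cake lborel.sigma_finite_measure_axioms) auto
      also have "\<dots> \<le> (\<integral>\<^sup>+l. (\<integral>\<^sup>+s. ennreal (q * H) * (indicator {0<..} l * g1 l s) \<partial>lborel) \<partial>lborel)"
      proof (rule nn_integral_mono)
        fix l :: real
        show "ennreal (q * l powr (q - 1)) * indicator {0<..} l * emeasure lborel {t\<in>space lborel. ennreal l \<le> riesz \<alpha> g t} \<le> (\<integral>\<^sup>+s. ennreal (q * H) * (indicator {0<..} l * g1 l s) \<partial>lborel)"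
        proof (cases "l > 0")
          case True
          have "ennreal (q * l powr (q - 1)) * emeasure lborel {t\<in>space lborel. ennreal l \<le> riesz \<alpha> g t} \<le> ennreal (q * l powr (q - 1)) * (ennreal (1 / \<gamma> l) * (\<integral>\<^sup>+s. g1 l s \<partial>lborel))"
            by (intro mult_left_mono lev True) auto
          also have "\<dots> = ennreal (q * H) * (\<integral>\<^sup>+s. g1 l s \<partial>lborel)"
            using True q H by (simp add: mult.assoc[symmetric] ennreal_mult[symmetric] \<gamma>_def)
          finally show ?thesis using True by (simp add: nn_integral_cmult)
        qed auto
      qed
      also have "\<dots> = (\<integral>\<^sup>+s. (\<integral>\<^sup>+l. ennreal (q * H) * (indicator {0<..} l * g1 l s) \<partial>lborel) \<partial>lborel)"
        by (rule lborel_pair.Fubini') (unfold g1_def, measurable)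
      also have "\<dots> \<le> (\<integral>\<^sup>+s. ennreal (q * H powr p) * enn_powr (g s) p \<partial>lborel)"
      proof (rule nn_integral_mono)
        fix s
        show "(\<integral>\<^sup>+l. ennreal (q * H) * (indicator {0<..} l * g1 l s) \<partial>lborel) \<le> ennreal (q * H powr p) * enn_powr (g s) p"
        proof (cases "g s")
          case top
          thus ?thesis using q H by (auto simp: ennreal_mult_top)
        next
          case (real y)
          \<comment> \<open>The level at which \<gamma> l = y; \<open>g1 l s\<close> vanishes for
            all higher levels.\<close>
          define \<Lambda> where "\<Lambda> = (H * y) powr (1 / (q - 1))"
          have "(\<integral>\<^sup>+l. ennreal (q * H) * (indicator {0<..} l * g1 l s) \<partial>lborel) \<le> (\<integral>\<^sup>+l. ennreal (q * H * y) * indicator {0..\<Lambda>} l \<partial>lborel)"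
          proof (intro nn_integral_mono)
            fix l
            have "l \<le> \<Lambda>" if "l > 0" "\<not> y \<le> \<gamma> l"
            proof -
              have "l powr (q - 1) \<le> H * y" using that H by (simp add: \<gamma>_def field_simps)
              hence "(l powr (q - 1)) powr (1 / (q - 1)) \<le> \<Lambda>" unfolding \<Lambda>_def using q by (intro powr_mono2) auto
              thus ?thesis using that q by (simp add: powr_powr)
            qed
            thus "ennreal (q * H) * (indicator {0<..} l * g1 l s) \<le> ennreal (q * H * y) * indicator {0..\<Lambda>} l"
              using real q H \<gamma>[of l] by (auto simp: indicator_def g1_def ennreal_mult)
          qed
          also have "\<dots> = ennreal (q * H * y) * ennreal \<Lambda>"
            by (subst nn_integral_cmult_indicator) (auto simp: \<Lambda>_def)
          also have "\<dots> = ennreal (q * H powr p) * enn_powr (g s) p"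
          proof -
            have "p = 1 + 1 / (q - 1)" using q by (simp add: p_def field_simps)
            hence "q * H * y * \<Lambda> = q * H powr p * y powr p"
              using real H by (cases "y = 0") (auto simp: \<Lambda>_def powr_mult powr_add)
            thus ?thesis using real q H by (simp add: ennreal_mult[symmetric] \<Lambda>_def)
          qed
          finally show ?thesis .
        qed
      qed
      also have "\<dots> = ennreal (q * H powr p) * I" by (subst nn_integral_cmult) (auto simp: I_def)
      also have "\<dots> = ennreal C * enn_powr I (q - 1)"
      proof -
        \<comment> \<open>By this identity H powr p contributes the power n^(q-2), and the remaining
          factor I = n completes it to n^(q-1).\<close>
        have e: "(q - 1) * (1 - \<alpha>) * p = q - 2" using q by (simp add: p_def \<alpha>_def field_simps)
        have "c2 powr (1 - \<alpha>) = (2 powr (q + 1)) powr (1 - \<alpha>) * n powr ((q - 1) * (1 - \<alpha>))"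
          using 3 by (simp add: c2_def powr_mult powr_powr)
        hence "H powr p = (4 * c1 * (2 powr (q + 1)) powr (1 - \<alpha>)) powr p * n powr (q - 2)"
          using c1 3 e by (simp add: H_def powr_mult powr_powr)
        moreover have "n powr (q - 2) * n = n powr (q - 1)" using 3 powr_add[of n "q - 2" 1] by simp
        ultimately have "q * H powr p * n = C * n powr (q - 1)" by (simp add: C_def)
        thus ?thesis using 3 q C by (simp add: ennreal_mult[symmetric])
      qed
      finally show ?thesis by (simp add: I_def)
    qed
  qed
  have "hls_const q C" unfolding hls_const_def using C main by (auto simp: \<alpha>_def p_def)
  thus ?thesis by (rule that)
qed


text \<open>Hoelder yields J <= J^(1/q) B for the r-th power integral J, and J^(1/q) can be divided
  out only if J is finite. Hence the truncation \<open>V\<close> in height and to sets of finite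
  measure, removed afterwards by monotone convergence.\<close>

lemma nn_Minkowski:
  fixes f :: "'a \<Rightarrow> real \<Rightarrow> ennreal"
  assumes "sigma_finite_measure M" and fm [measurable]: "case_prod f \<in> borel_measurable (M \<Otimes>\<^sub>M lborel)" and r: "r > 1"
  shows "enn_powr (\<integral>\<^sup>+x. enn_powr (\<integral>\<^sup>+s. f x s \<partial>lborel) r \<partial>M) (1/r) \<le> (\<integral>\<^sup>+s. enn_powr (\<integral>\<^sup>+x. enn_powr (f x s) r \<partial>M) (1/r) \<partial>lborel)"
proof -
  interpret M: sigma_finite_measure M by fact
  interpret P: pair_sigma_finite M lborel ..
  define q where "q = r / (r - 1)"
  have q: "1 / r + 1 / q = 1" "q > 1" "(r - 1) * q = r" using r by (auto simp: q_def field_simps)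
  define U where "U x = (\<integral>\<^sup>+s. f x s \<partial>lborel)" for x
  have Um [measurable]: "U \<in> borel_measurable M" unfolding U_def by measurable
  define B where "B = (\<integral>\<^sup>+s. enn_powr (\<integral>\<^sup>+x. enn_powr (f x s) r \<partial>M) (1/r) \<partial>lborel)"
  obtain A :: "nat \<Rightarrow> 'a set" where A: "range A \<subseteq> sets M" "(\<Union>i. A i) = space M" "\<And>i. emeasure M (A i) \<noteq> \<infinity>" "incseq A"
    using M.sigma_finite_incseq by metis
  define V where "V n x = min (U x) (ennreal (real n)) * indicator (A n) x" for n x
  have [measurable]: "A n \<in> sets M" for n using A by auto
  have Vm [measurable]: "V n \<in> borel_measurable M" for n unfolding V_def by measurable
  have VU: "V n x \<le> U x" for n x by (auto simp: V_def indicator_def)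
  have Vb: "enn_powr (\<integral>\<^sup>+x. enn_powr (V n x) r \<partial>M) (1/r) \<le> B" for n
  proof -
    define J where "J = (\<integral>\<^sup>+x. enn_powr (V n x) r \<partial>M)"
    have "J \<le> (\<integral>\<^sup>+x. ennreal (real n powr r) * indicator (A n) x \<partial>M)" unfolding J_def
    proof (intro nn_integral_mono)
      fix x
      have "enn_powr (min (U x) (ennreal (real n))) r \<le> enn_powr (ennreal (real n)) r"
        using r by (intro enn_powr_mono) auto
      thus "enn_powr (V n x) r \<le> ennreal (real n powr r) * indicator (A n) x"
        by (auto simp: V_def indicator_def)
    qed
    also have "\<dots> < top" using A(3)[of n] by (subst nn_integral_cmult_indicator) (auto simp: ennreal_mult_less_top less_top)
    finally have Jfin: "J < top" .
    have "J \<le> (\<integral>\<^sup>+x. (\<integral>\<^sup>+s. enn_powr (V n x) (r - 1) * f x s \<partial>lborel) \<partial>M)"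
      unfolding J_def
    proof (intro nn_integral_mono)
      fix x assume x: "x \<in> space M"
      \<comment> \<open>Only one of the r factors is enlarged to U. The other r - 1 stay truncated
        and reproduce J on the right.\<close>
      have "enn_powr (V n x) r = enn_powr (V n x) (r - 1) * enn_powr (V n x) 1"
        using r by (subst enn_powr_add) auto
      also have "\<dots> \<le> enn_powr (V n x) (r - 1) * U x" by (intro mult_left_mono) (auto simp: VU)
      also have "\<dots> = (\<integral>\<^sup>+s. enn_powr (V n x) (r - 1) * f x s \<partial>lborel)"
        unfolding U_def using x by (subst nn_integral_cmult) auto
      finally show "enn_powr (V n x) r \<le> (\<integral>\<^sup>+s. enn_powr (V n x) (r - 1) * f x s \<partial>lborel)" .
    qed
    also have "\<dots> = (\<integral>\<^sup>+s. (\<integral>\<^sup>+x. enn_powr (V n x) (r - 1) * f x s \<partial>M) \<partial>lborel)"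
      by (rule P.Fubini'[symmetric]) measurable
    also have "\<dots> \<le> (\<integral>\<^sup>+s. enn_powr J (1/q) * enn_powr (\<integral>\<^sup>+x. enn_powr (f x s) r \<partial>M) (1/r) \<partial>lborel)"
    proof (intro nn_integral_mono)
      fix s :: real
      have [measurable]: "(\<lambda>x. f x s) \<in> borel_measurable M" using measurable_Pair1[OF fm, of s] by simp
      have "(\<integral>\<^sup>+x. enn_powr (V n x) (r - 1) * f x s \<partial>M) \<le> enn_powr (\<integral>\<^sup>+x. enn_powr (enn_powr (V n x) (r - 1)) q \<partial>M) (1/q) * enn_powr (\<integral>\<^sup>+x. enn_powr (f x s) r \<partial>M) (1/r)"
        using q by (intro nn_Hoelder) auto
      also have "(\<integral>\<^sup>+x. enn_powr (enn_powr (V n x) (r - 1)) q \<partial>M) = J"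
        by (simp add: enn_powr_powr q J_def)
      finally show "(\<integral>\<^sup>+x. enn_powr (V n x) (r - 1) * f x s \<partial>M) \<le> enn_powr J (1/q) * enn_powr (\<integral>\<^sup>+x. enn_powr (f x s) r \<partial>M) (1/r)" .
    qed
    also have "\<dots> = enn_powr J (1/q) * B" unfolding B_def by (subst nn_integral_cmult) auto
    finally have le: "J \<le> enn_powr J (1/q) * B" .
    obtain j where j: "J = ennreal j" "j \<ge> 0" using Jfin by (cases J) auto
    show ?thesis
    proof (cases "j = 0 \<or> B = top")
      case True
      thus ?thesis using j by (auto simp: J_def[symmetric])
    next
      case False
      then obtain b where b: "B = ennreal b" "b \<ge> 0" "j > 0" using j by (cases B) auto
      have "j \<le> j powr (1/q) * b" using le j b by (simp add: ennreal_mult[symmetric])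
      hence "j powr (1/r) * j powr (1/q) \<le> b * j powr (1/q)" using b q(1) powr_add[of j "1/r" "1/q"] by (simp add: mult.commute)
      hence "j powr (1/r) \<le> b" using b by simp
      thus ?thesis using j b by (simp add: J_def[symmetric])
    qed
  qed
  have "(\<integral>\<^sup>+x. enn_powr (U x) r \<partial>M) = (\<integral>\<^sup>+x. (SUP n. enn_powr (V n x) r) \<partial>M)"
  proof (intro nn_integral_cong)
    fix x assume x: "x \<in> space M"
    then obtain m where m: "x \<in> A m" using A(2) by blast
    have mem: "x \<in> A n" if "n \<ge> m" for n using m A(4) that by (auto simp: incseq_def)
    show "enn_powr (U x) r = (SUP n. enn_powr (V n x) r)"
    proof (rule antisym)
      show "(SUP n. enn_powr (V n x) r) \<le> enn_powr (U x) r"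
        using r by (intro SUP_least enn_powr_mono VU) auto
      show "enn_powr (U x) r \<le> (SUP n. enn_powr (V n x) r)"
      proof (cases "U x")
        case (real u)
        obtain n :: nat where n: "real n \<ge> u" "n \<ge> m"
          by (metis max.cobounded1 max.cobounded2 of_nat_le_iff order_trans real_arch_simple)
        hence "V n x = U x" using real mem[OF n(2)] by (auto simp: V_def min_def)
        thus ?thesis by (metis SUP_upper UNIV_I)
      next
        case top
        have "ennreal (real k) \<le> (SUP n. enn_powr (V n x) r)" for k :: nat
        proof -
          \<comment> \<open>The bound n >= 1 gives n <= n powr r, and n >= m places x in
            \<open>A n\<close>.\<close>
          define n where "n = max 1 (max m k)"
          have "V n x = ennreal (real n)" using top mem[of n] by (auto simp: V_def n_def)
          hence "enn_powr (V n x) r = ennreal (real n powr r)" by simp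
          moreover have "real n powr 1 \<le> real n powr r" using r by (intro powr_mono) (auto simp: n_def)
          moreover have "real k \<le> real n" by (auto simp: n_def)
          ultimately have "ennreal (real k) \<le> enn_powr (V n x) r" by (auto intro!: ennreal_leI simp: n_def)
          thus ?thesis by (rule order_trans) (auto intro: SUP_upper)
        qed
        hence "(SUP n. enn_powr (V n x) r) = top" by (intro ennreal_top_unique_nat)
        thus ?thesis by (metis top_greatest)
      qed
    qed
  qed
  also have "\<dots> = (SUP n. (\<integral>\<^sup>+x. enn_powr (V n x) r \<partial>M))"
  proof (rule nn_integral_monotone_convergence_SUP)
    show "incseq (\<lambda>n x. enn_powr (V n x) r)"
    proof (intro incseq_SucI le_funI enn_powr_mono)
      fix n x
      have "A n \<subseteq> A (Suc n)" using A(4) by (auto simp: incseq_Suc_iff)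
      moreover have "min (U x) (ennreal (real n)) \<le> min (U x) (ennreal (real (Suc n)))" by (intro min.mono) (auto intro!: ennreal_leI)
      ultimately show "V n x \<le> V (Suc n) x" by (auto simp: V_def indicator_def simp del: of_nat_Suc)
    qed (use r in auto)
  qed auto
  also have "\<dots> \<le> enn_powr B r"
  proof (rule SUP_least)
    fix n
    have "enn_powr (enn_powr (\<integral>\<^sup>+x. enn_powr (V n x) r \<partial>M) (1/r)) r \<le> enn_powr B r"
      using r by (intro enn_powr_mono Vb) auto
    thus "(\<integral>\<^sup>+x. enn_powr (V n x) r \<partial>M) \<le> enn_powr B r" using r by (simp add: enn_powr_powr)
  qed
  finally have "enn_powr (\<integral>\<^sup>+x. enn_powr (U x) r \<partial>M) (1/r) \<le> enn_powr (enn_powr B r) (1/r)"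
    using r by (intro enn_powr_mono) auto
  thus ?thesis using r by (simp add: enn_powr_powr U_def B_def)
qed


section \<open>Bessel--Clifford functions and Weber's integral\<close>

text \<open>Up to the factor \<open>Gamma m\<close> this is the hypergeometric series 0F1 with
  parameter m, entire for m > 0. The type is generic because the same series occurs as a real kernel
  and, at complex arguments, as the value of Weber's integral.\<close>

definition clif :: "real \<Rightarrow> 'a::{real_normed_field,banach} \<Rightarrow> 'a" where
  "clif m w = (\<Sum>k. (1 / (fact k * Gamma (real k + m))) *\<^sub>R w ^ k)"

lemma Gamma_Suc_shift: "m > 0 \<Longrightarrow> Gamma (real (Suc k) + m) = (real k + m) * Gamma (real k + m)"
  using Gamma_plus1[of "real k + m"] nonpos_Ints_nonpos[of "real k + m"]
  by (force simp: algebra_simps)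

lemma clif_summable:
  fixes w :: "'a::{real_normed_field,banach}"
  assumes m: "m > 0"
  shows "summable (\<lambda>k. norm ((1 / (fact k * Gamma (real k + m))) *\<^sub>R w ^ k))"
proof -
  obtain N :: nat where N: "real N \<ge> 2 * norm w / m" using real_arch_simple by blast
  show ?thesis
  proof (rule summable_ratio_test[of "1/2" N])
    fix k assume k: "k \<ge> N"
    have G: "Gamma (real k + m) > 0" using m by (intro Gamma_real_pos) auto
    have "2 * norm w \<le> real N * m" using N m by (simp add: field_simps)
    also have "\<dots> \<le> real (Suc k) * (real k + m)" using k m by (intro mult_mono) auto
    finally have *: "norm w \<le> real (Suc k) * (real k + m) / 2" by simp
    have "norm ((1 / (fact (Suc k) * Gamma (real (Suc k) + m))) *\<^sub>R w ^ Suc k)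
      = norm w * norm w ^ k / (fact k * Gamma (real k + m)) / (real (Suc k) * (real k + m))"
      using G m by (simp only: Gamma_Suc_shift[OF m] fact_Suc) (simp add: norm_power norm_mult abs_mult field_simps)
    also have "\<dots> \<le> (real (Suc k) * (real k + m) / 2) * norm w ^ k / (fact k * Gamma (real k + m)) / (real (Suc k) * (real k + m))"
      using * G m by (intro divide_right_mono mult_right_mono) auto
    also have "\<dots> = 1/2 * norm ((1 / (fact k * Gamma (real k + m))) *\<^sub>R w ^ k)"
    proof -
      have "real (Suc k) * (real k + m) \<noteq> 0" using m by (simp add: add_nonneg_eq_0_iff)
      moreover have "norm ((1 / (fact k * Gamma (real k + m))) *\<^sub>R w ^ k) = norm w ^ k / (fact k * Gamma (real k + m))"
        using G by (simp add: norm_power)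
      moreover have "(E / 2) * c / g / E = 1/2 * (c / g)" if "E \<noteq> 0" for E c g :: real using that by simp
      ultimately show ?thesis by (simp only:)
    qed
    finally show "norm (norm ((1 / (fact (Suc k) * Gamma (real (Suc k) + m))) *\<^sub>R w ^ Suc k)) \<le> 1/2 * norm (norm ((1 / (fact k * Gamma (real k + m))) *\<^sub>R w ^ k))"
      by (simp only: real_norm_def abs_norm_cancel)
  qed simp
qed

lemma clif_sums: "m > 0 \<Longrightarrow> (\<lambda>k. (1 / (fact k * Gamma (real k + m))) *\<^sub>R w ^ k) sums clif m w"
  unfolding clif_def by (intro summable_sums summable_norm_cancel[OF clif_summable])

lemma clif_of_real: "m > 0 \<Longrightarrow> clif m (of_real x) = of_real (clif m x)"
proof -
  assume m: "m > 0"
  have "(\<lambda>k. (1 / (fact k * Gamma (real k + m))) *\<^sub>R (of_real x :: 'a) ^ k) = (\<lambda>k. of_real ((1 / (fact k * Gamma (real k + m))) *\<^sub>R x ^ k))"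
    by (simp add: scaleR_conv_of_real)
  hence "(\<lambda>k. (1 / (fact k * Gamma (real k + m))) *\<^sub>R (of_real x :: 'a) ^ k) sums of_real (clif m x)"
    using sums_of_real[OF clif_sums[OF m, of x]] by (simp only:)
  thus ?thesis by (rule sums_unique2[OF clif_sums[OF m]])
qed

lemma clif_0: "m > 0 \<Longrightarrow> clif m 0 = of_real (1 / Gamma m)"
  unfolding clif_def by (subst suminf_finite[of "{0}"]) (auto simp: scaleR_conv_of_real)

lemma clif_nonneg: "m > 0 \<Longrightarrow> x \<ge> 0 \<Longrightarrow> clif m (x::real) \<ge> 0"
  unfolding clif_def
  by (intro suminf_nonneg summable_norm_cancel[OF clif_summable]) (auto intro!: mult_nonneg_nonneg divide_nonneg_nonneg Gamma_real_nonneg)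

lemma clif_measurable [measurable]: "(clif m :: real \<Rightarrow> real) \<in> borel_measurable borel"
  unfolding clif_def by measurable

lemma cosh_even_sums:
  fixes z :: complex
  shows "(\<lambda>k. z ^ (2 * k) /\<^sub>R fact (2 * k)) sums cosh z"
proof -
  have "(\<lambda>k. (if even (2 * k) then z ^ (2 * k) /\<^sub>R fact (2 * k) else 0)) sums cosh z"
    by (subst sums_mono_reindex[of "\<lambda>k. 2 * k" "\<lambda>n. if even n then z ^ n /\<^sub>R fact n else 0"])
      (auto simp: strict_mono_def cosh_converges elim!: evenE)
  thus ?thesis by simp
qed

lemma norm_cosh_le: "norm (cosh z :: complex) \<le> exp \<bar>Re z\<bar>"
proof -
  have "norm (cosh z) = norm (exp z + exp (- z)) / 2" by (simp add: cosh_def norm_divide)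
  also have "\<dots> \<le> (exp (Re z) + exp (- Re z)) / 2"
    using norm_triangle_ineq[of "exp z" "exp (- z)"] by simp
  also have "\<dots> \<le> (exp \<bar>Re z\<bar> + exp \<bar>Re z\<bar>) / 2" by (intro divide_right_mono add_mono) auto
  finally show ?thesis by simp
qed

text \<open>The duplication identity (2k)! = 4^k k! (1/2)_k, together with Gamma(k + 1/2) = sqrt(pi)
  (1/2)_k, matches the two series term by term. In the application m = 1/2 is the unweighted case a
  = 0.\<close>

lemma clif_half: "clif (1/2) (u\<^sup>2 / 4 :: complex) = cosh u / of_real (sqrt pi)"
proof -
  have "(\<lambda>k. (u ^ (2 * k) /\<^sub>R fact (2 * k)) / of_real (sqrt pi)) sums (cosh u / of_real (sqrt pi))"
    by (intro sums_divide cosh_even_sums)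
  also have "(\<lambda>k. (u ^ (2 * k) /\<^sub>R fact (2 * k)) / of_real (sqrt pi)) = (\<lambda>k. (1 / (fact k * Gamma (real k + 1/2))) *\<^sub>R (u\<^sup>2 / 4) ^ k)"
  proof
    fix k
    have "pochhammer (1/2) k = Gamma (1/2 + real k) / sqrt pi"
      using pochhammer_Gamma[of "1/2::real" k] nonpos_Ints_nonpos[of "1/2::real"] by (force simp: Gamma_one_half_real)
    hence G: "Gamma (real k + 1/2) = sqrt pi * pochhammer (1/2) k" by (simp add: add.commute)
    have p: "pochhammer (1/2::real) k > 0" by (simp add: pochhammer_pos)
    have "(u\<^sup>2 / 4) ^ k = u ^ (2 * k) / 4 ^ k" by (simp add: power_divide power_mult)
    moreover have "(2::real) ^ (2 * k) = 4 ^ k" by (simp add: power_mult)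
    ultimately show "(u ^ (2 * k) /\<^sub>R fact (2 * k)) / of_real (sqrt pi) = (1 / (fact k * Gamma (real k + 1/2))) *\<^sub>R (u\<^sup>2 / 4) ^ k"
      using p unfolding fact_double G by (simp add: scaleR_conv_of_real field_simps)
  qed
  finally show ?thesis using clif_sums[of "1/2" "u\<^sup>2/4"] sums_unique2 by fastforce
qed

text \<open>
  Poisson's integral writes \<open>clif m (u\<^sup>2 / 4)\<close> as an average of \<open>cosh (u * sqrt s)\<close> over \<open>0 \<le> s \<le> 1\<close>; for
  \<open>m = 1/2\<close> the averaging measure degenerates to a point mass at \<open>s = 1\<close>.
\<close>

lemma norm_clif_le:
  fixes u :: complex
  assumes m: "m \<ge> 1/2"
  shows "norm (clif m (u\<^sup>2 / 4)) \<le> exp \<bar>Re u\<bar> / Gamma m"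
proof (cases "m = 1/2")
  case True
  thus ?thesis using norm_cosh_le[of u] by (simp only: clif_half) (simp add: Gamma_one_half_real norm_divide divide_right_mono)
next
  case False
  hence m2: "m > 1/2" using m by simp
  \<comment> \<open>The density (1 - v^2)^(m - 3/2) of Poisson's integral in the variable s = v^2.
    Its moments are Beta values; integrability at s = 1 is exactly m > 1/2.\<close>
  define wt where "wt s = indicator {0..1} s * (s powr (-1/2) * (1 - s) powr (m - 3/2))" for s :: real
  have wt0: "wt s \<ge> 0" for s by (auto simp: wt_def)
  have wtm [measurable]: "wt \<in> borel_measurable borel" unfolding wt_def by measurable
  define b where "b k = Beta (real k + 1/2) (m - 1/2)" for k :: nat
  have wtk: "has_bochner_integral lborel (\<lambda>s. wt s * s ^ k) (b k)" for k
  proof -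
    have i: "set_integrable lborel {0..1} (\<lambda>s. s powr (real k + 1/2 - 1) * (1 - s) powr (m - 1/2 - 1))"
      using m2 by (intro integrable_Beta) auto
    have e: "indicator {0..1} s *\<^sub>R (s powr (real k + 1/2 - 1) * (1 - s) powr (m - 1/2 - 1)) = wt s * s ^ k" if "s \<noteq> 0" for s :: real
      using that powr_add[of s "-1/2" "real k"] by (auto simp: wt_def indicator_def powr_realpow diff_diff_eq)
    have ae: "AE s in lborel. indicator {0..1} s *\<^sub>R (s powr (real k + 1/2 - 1) * (1 - s) powr (m - 1/2 - 1)) = wt s * s ^ k"
      using AE_lborel_singleton[of 0] by eventually_elim (rule e)
    have "integral {0..1} (\<lambda>s. s powr (real k + 1/2 - 1) * (1 - s) powr (m - 1/2 - 1)) = b k"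
      unfolding b_def using m2 by (intro integral_unique has_integral_Beta_real) auto
    hence "(LINT s:{0..1}|lborel. s powr (real k + 1/2 - 1) * (1 - s) powr (m - 1/2 - 1)) = b k"
      using set_borel_integral_eq_integral(2)[OF i] by simp
    hence "has_bochner_integral lborel (\<lambda>s. indicator {0..1} s *\<^sub>R (s powr (real k + 1/2 - 1) * (1 - s) powr (m - 1/2 - 1))) (b k)"
      using i by (simp add: has_bochner_integral_iff set_integrable_def set_lebesgue_integral_def)
    thus ?thesis by (subst has_bochner_integral_cong_AE[OF _ _ ae, symmetric]) auto
  qed
  define \<kappa> where "\<kappa> = sqrt pi * Gamma (m - 1/2)"
  have Gp: "Gamma m > 0" "Gamma (m - 1/2) > 0" using m2 by (auto intro: Gamma_real_pos)
  hence \<kappa>: "\<kappa> > 0" by (simp add: \<kappa>_def)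
  \<comment> \<open>The same duplication identity as for m = 1/2, now with Beta(k + 1/2, m - 1/2)
    supplying the quotient of Gamma values.\<close>
  have coef: "1 / (fact k * Gamma (real k + m)) = 4 ^ k * b k / (fact (2 * k) * \<kappa>)" for k
  proof -
    have "pochhammer (1/2) k = Gamma (1/2 + real k) / sqrt pi"
      using pochhammer_Gamma[of "1/2::real" k] nonpos_Ints_nonpos[of "1/2::real"] by (force simp: Gamma_one_half_real)
    hence G: "Gamma (real k + 1/2) = sqrt pi * pochhammer (1/2) k" by (simp add: add.commute)
    have p: "pochhammer (1/2::real) k > 0" by (simp add: pochhammer_pos)
    have "b k = Gamma (real k + 1/2) * Gamma (m - 1/2) / Gamma (real k + m)"
      by (simp add: b_def Beta_def)
    moreover have "Gamma (real k + m) > 0" using m2 by (intro Gamma_real_pos) auto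
    moreover have "(2::real) ^ (2 * k) = 4 ^ k" by (simp add: power_mult)
    ultimately show ?thesis using p Gp unfolding fact_double G \<kappa>_def by (simp add: field_simps)
  qed
  \<comment> \<open>The normalised weight has total mass \<open>1 / Gamma m\<close>, which becomes
    the constant of the estimate.\<close>
  have b0: "b 0 / \<kappa> = 1 / Gamma m" using coef[of 0] by simp
  define f where "f k s = (wt s * s ^ k) *\<^sub>R (u ^ (2 * k) /\<^sub>R fact (2 * k))" for k s
  have fi: "has_bochner_integral lborel (f k) (b k *\<^sub>R (u ^ (2 * k) /\<^sub>R fact (2 * k)))" for k
    unfolding f_def by (intro has_bochner_integral_scaleR_left wtk)
  have fn: "has_bochner_integral lborel (\<lambda>s. norm (f k s)) (b k * norm (u ^ (2 * k) /\<^sub>R fact (2 * k)))" for k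
  proof -
    have "(\<lambda>s. norm (f k s)) = (\<lambda>s. (wt s * s ^ k) * norm (u ^ (2 * k) /\<^sub>R fact (2 * k)))"
      using wt0 by (auto simp: f_def fun_eq_iff abs_mult wt_def indicator_def)
    thus ?thesis using has_bochner_integral_mult_left[OF wtk[of k]] by simp
  qed
  have trm: "(1 / (fact k * Gamma (real k + m))) *\<^sub>R (v\<^sup>2 / 4) ^ k = (b k *\<^sub>R (v ^ (2 * k) /\<^sub>R fact (2 * k))) /\<^sub>R \<kappa>" for k and v :: complex
  proof -
    have "(v\<^sup>2 / 4) ^ k = v ^ (2 * k) / 4 ^ k" by (simp add: power_divide power_mult)
    thus ?thesis unfolding coef by (simp add: scaleR_conv_of_real field_simps)
  qed
  have "summable (\<lambda>k. norm ((1 / (fact k * Gamma (real k + m))) *\<^sub>R (u\<^sup>2 / 4) ^ k))"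
    using m by (intro clif_summable) auto
  moreover have bnn: "b k \<ge> 0" for k unfolding b_def Beta_def using m2
    by (intro divide_nonneg_nonneg mult_nonneg_nonneg Gamma_real_nonneg) auto
  have "norm ((b k *\<^sub>R X) /\<^sub>R \<kappa>) = inverse \<kappa> * (b k * norm X)" for k and X :: complex
    using \<kappa> bnn[of k] by (simp only: norm_scaleR abs_inverse abs_of_pos abs_of_nonneg)
  ultimately have "summable (\<lambda>k. inverse \<kappa> * (b k * norm (u ^ (2 * k) /\<^sub>R fact (2 * k))))"
    unfolding trm by (simp only:)
  hence sm: "summable (\<lambda>k. b k * norm (u ^ (2 * k) /\<^sub>R fact (2 * k)))"
    using \<kappa> by (subst (asm) summable_cmult_iff) auto
  have fs: "(\<lambda>k. f k s) sums (wt s *\<^sub>R cosh (u * of_real (sqrt s)))" for s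
  proof (cases "s \<ge> 0")
    case True
    have "(of_real (sqrt s) :: complex) ^ (2 * k) = of_real (s ^ k)" for k
      using True by (simp add: power_mult flip: of_real_power)
    hence "(\<lambda>k. wt s *\<^sub>R ((u * of_real (sqrt s)) ^ (2 * k) /\<^sub>R fact (2 * k))) = (\<lambda>k. f k s)"
      by (auto simp: f_def fun_eq_iff power_mult_distrib scaleR_conv_of_real)
    thus ?thesis using sums_scaleR_right[OF cosh_even_sums[of "u * of_real (sqrt s)"], of "wt s"] by simp
  qed (auto simp: f_def wt_def)
  have ab: "summable (\<lambda>k. norm (f k s))" for s
  proof -
    have "summable (\<lambda>k. norm ((1 / (fact k * Gamma (real k + 1/2))) *\<^sub>R (u\<^sup>2 * of_real s / 4) ^ k))"
      by (intro clif_summable) auto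
    moreover have "summable (\<lambda>k. norm ((u\<^sup>2 * of_real s) ^ k /\<^sub>R fact (2 * k)))"
      if "summable (\<lambda>k. norm ((1 / (fact k * Gamma (real k + 1/2))) *\<^sub>R (u\<^sup>2 * of_real s / 4) ^ k))"
    proof -
      have e: "norm ((u\<^sup>2 * of_real s) ^ k /\<^sub>R fact (2 * k)) \<le> norm (u\<^sup>2 * of_real s) ^ k / fact k" for k
      proof -
        have "(fact k :: real) \<le> fact (2 * k)" by (intro fact_mono) auto
        thus ?thesis by (simp add: norm_power divide_inverse mult.commute mult_right_mono le_imp_inverse_le)
      qed
      have "summable (\<lambda>k. norm (u\<^sup>2 * of_real s) ^ k / fact k)"
        using summable_exp[of "norm (u\<^sup>2 * of_real s)"] by (simp only: divide_inverse mult.commute)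
      thus ?thesis by (rule summable_comparison_test'[where N = 0]) (simp only: real_norm_def abs_norm_cancel e)
    qed
    ultimately have "summable (\<lambda>k. \<bar>wt s\<bar> * norm ((u\<^sup>2 * of_real s) ^ k /\<^sub>R fact (2 * k)))" by (intro summable_mult) auto
    moreover have "f k s = wt s *\<^sub>R ((u\<^sup>2 * of_real s) ^ k /\<^sub>R fact (2 * k))" for k
      unfolding f_def power_mult by (simp add: power_mult_distrib scaleR_conv_of_real)
    ultimately show ?thesis by (simp only: norm_scaleR)
  qed
  have "(\<lambda>k. integral\<^sup>L lborel (f k)) sums (\<integral>s. (\<Sum>k. f k s) \<partial>lborel)"
  proof (rule sums_integral)
    show "summable (\<lambda>k. \<integral>s. norm (f k s) \<partial>lborel)" using sm fn by (simp add: has_bochner_integral_iff)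
  qed (use fi ab in \<open>auto simp: has_bochner_integral_iff\<close>)
  moreover have "(\<Sum>k. f k s) = wt s *\<^sub>R cosh (u * of_real (sqrt s))" for s using fs[of s] by (simp add: sums_iff)
  ultimately have S1: "(\<lambda>k. b k *\<^sub>R (u ^ (2 * k) /\<^sub>R fact (2 * k))) sums (\<integral>s. wt s *\<^sub>R cosh (u * of_real (sqrt s)) \<partial>lborel)"
    using fi by (simp add: has_bochner_integral_iff)
  have "clif m (u\<^sup>2 / 4) = (\<integral>s. wt s *\<^sub>R cosh (u * of_real (sqrt s)) \<partial>lborel) /\<^sub>R \<kappa>"
    using sums_scaleR_right[OF S1, of "inverse \<kappa>"] clif_sums[of m "u\<^sup>2/4"] m sums_unique2 unfolding trm by fastforce
  moreover have "norm (\<integral>s. wt s *\<^sub>R cosh (u * of_real (sqrt s)) \<partial>lborel) \<le> (\<integral>s. wt s * exp \<bar>Re u\<bar> \<partial>lborel)"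
  proof -
    have w: "integrable lborel wt" using wtk[of 0] by (simp add: has_bochner_integral_iff)
    have i1: "integrable lborel (\<lambda>s. wt s * exp \<bar>Re u\<bar>)" using w by simp
    have le: "norm (wt s *\<^sub>R cosh (u * of_real (sqrt s))) \<le> wt s * exp \<bar>Re u\<bar>" for s
    proof (cases "0 \<le> s \<and> s \<le> 1")
      case True
      have "norm (cosh (u * of_real (sqrt s))) \<le> exp \<bar>Re (u * of_real (sqrt s))\<bar>" by (rule norm_cosh_le)
      also have "\<bar>Re (u * of_real (sqrt s))\<bar> \<le> \<bar>Re u\<bar>"
        using True by (simp add: abs_mult mult_left_le)
      finally show ?thesis using wt0[of s] by (simp add: mult_left_mono)
    qed (auto simp: wt_def)
    have m: "(\<lambda>s. wt s *\<^sub>R cosh (u * of_real (sqrt s))) \<in> borel_measurable lborel"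
      unfolding cosh_def by measurable
    have i2: "integrable lborel (\<lambda>s. wt s *\<^sub>R cosh (u * of_real (sqrt s)))"
    proof (rule Bochner_Integration.integrable_bound[OF i1 m])
      show "AE s in lborel. norm (wt s *\<^sub>R cosh (u * of_real (sqrt s))) \<le> norm (wt s * exp \<bar>Re u\<bar>)"
        using le order_trans[OF le abs_ge_self] by simp
    qed
    have "norm (\<integral>s. wt s *\<^sub>R cosh (u * of_real (sqrt s)) \<partial>lborel) \<le> (\<integral>s. norm (wt s *\<^sub>R cosh (u * of_real (sqrt s))) \<partial>lborel)"
      by (rule integral_norm_bound)
    also have "\<dots> \<le> (\<integral>s. wt s * exp \<bar>Re u\<bar> \<partial>lborel)"
      by (intro integral_mono i1 integrable_norm i2 le)
    finally show ?thesis .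
  qed
  moreover have "(\<integral>s. wt s * exp \<bar>Re u\<bar> \<partial>lborel) = b 0 * exp \<bar>Re u\<bar>"
    using wtk[of 0] by (simp add: has_bochner_integral_iff)
  ultimately have "norm (clif m (u\<^sup>2 / 4)) \<le> inverse \<kappa> * (b 0 * exp \<bar>Re u\<bar>)"
    using \<kappa> by (simp only: norm_scaleR abs_inverse abs_of_pos) (auto intro: mult_left_mono)
  also have "\<dots> = (b 0 / \<kappa>) * exp \<bar>Re u\<bar>" by (simp add: divide_inverse)
  finally show ?thesis unfolding b0 by simp
qed


section \<open>The weighted measure and its Gaussian moments\<close>

definition wt_meas :: "real \<Rightarrow> real measure" where
  "wt_meas a = density lborel (\<lambda>x. ennreal (indicator {0<..} x * x powr a))"

lemma sets_wt_meas [simp, measurable_cong]: "sets (wt_meas a) = sets borel"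
  by (simp add: wt_meas_def)

lemma space_wt_meas [simp]: "space (wt_meas a) = UNIV"
  by (simp add: wt_meas_def)

lemma sigma_finite_wt_meas: "sigma_finite_measure (wt_meas a)"
  unfolding wt_meas_def by (subst sigma_finite_measure.sigma_finite_iff_density_finite) (auto intro: lborel.sigma_finite_measure_axioms)

lemma nn_integral_wt_meas:
  assumes [measurable]: "f \<in> borel_measurable borel"
  shows "(\<integral>\<^sup>+x. f x \<partial>wt_meas a) = (\<integral>\<^sup>+x. ennreal (indicator {0<..} x * x powr a) * f x \<partial>lborel)"
  unfolding wt_meas_def by (subst nn_integral_density) auto

lemma integral_wt_meas:
  fixes f :: "real \<Rightarrow> 'a::{banach, second_countable_topology}"
  assumes [measurable]: "f \<in> borel_measurable borel"
  shows "(\<integral>x. f x \<partial>wt_meas a) = (\<integral>x. (indicator {0<..} x * x powr a) *\<^sub>R f x \<partial>lborel)"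
  unfolding wt_meas_def by (subst integral_density) auto

text \<open>Euler's integral for Gamma(n + m) under the substitution t = \<rho> y^2: the integrand
  acquires the power y^(2 (n + m) - 1), which is y^(a + 2n).\<close>

lemma gauss_moment_nn:
  assumes \<rho>: "\<rho> > 0" and a: "a > -1" and m: "m = (a + 1) / 2"
  shows "(\<integral>\<^sup>+y. ennreal (exp (- \<rho> * y\<^sup>2) * y ^ (2 * n)) \<partial>wt_meas a) = ennreal (Gamma (real n + m) / (2 * \<rho> powr (real n + m)))"
proof -
  define s where "s = real n + m"
  have s: "s > 0" using a m by (simp add: s_def)
  define f where "f t = t powr (s - 1) / exp t" for t :: real
  have fI: "(f has_integral Gamma s) {0<..}"
  proof -
    have "(f has_integral Gamma s) {0..}" unfolding f_def by (rule Gamma_integral_real[OF s])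
    thus ?thesis 
      by (subst has_integral_spike_set_eq[of _ "{0..}"]) (auto intro: negligible_subset[of "{0}"])
  qed
  have fabs: "f absolutely_integrable_on {0<..}"
    using fI by (intro nonnegative_absolutely_integrable_1) (auto simp: f_def)
  have img: "(\<lambda>y. \<rho> * y\<^sup>2) ` {0<..} = {0<..}"
  proof safe
    fix t :: real assume "0 < t"
    thus "t \<in> (\<lambda>y. \<rho> * y\<^sup>2) ` {0<..}" using \<rho> by (intro image_eqI[of _ _ "sqrt (t / \<rho>)"]) auto
  qed (use \<rho> in auto)
  have "(\<lambda>y. \<bar>2 * \<rho> * y\<bar> * f (\<rho> * y\<^sup>2)) absolutely_integrable_on {0<..} \<and> integral {0<..} (\<lambda>y. \<bar>2 * \<rho> * y\<bar> * f (\<rho> * y\<^sup>2)) = Gamma s"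
    using fabs integral_unique[OF fI]
    by (subst has_absolute_integral_change_of_variables_1'[of "{0<..}" "\<lambda>y. \<rho> * y\<^sup>2" "\<lambda>y. 2 * \<rho> * y"])
      (use \<rho> in \<open>auto simp: img inj_on_def intro!: derivative_eq_intros\<close>)
  hence "((\<lambda>y. \<bar>2 * \<rho> * y\<bar> * f (\<rho> * y\<^sup>2)) has_integral Gamma s) {0<..}"
    using has_integral_integrable_integral set_lebesgue_integral_eq_integral(1) by blast
  hence "(\<integral>\<^sup>+y. ennreal (indicator {0<..} y * (\<bar>2 * \<rho> * y\<bar> * f (\<rho> * y\<^sup>2))) \<partial>lborel) = ennreal (Gamma s)"
    by (intro nn_integral_has_integral_lebesgue) (auto simp: f_def)
  moreover have "(\<integral>\<^sup>+y. ennreal (indicator {0<..} y * (\<bar>2 * \<rho> * y\<bar> * f (\<rho> * y\<^sup>2))) \<partial>lborel)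
    = (\<integral>\<^sup>+y. ennreal (2 * \<rho> powr s) * (ennreal (indicator {0<..} y * y powr a) * ennreal (exp (- \<rho> * y\<^sup>2) * y ^ (2 * n))) \<partial>lborel)"
  proof (intro nn_integral_cong)
    fix y :: real
    show "ennreal (indicator {0<..} y * (\<bar>2 * \<rho> * y\<bar> * f (\<rho> * y\<^sup>2))) = ennreal (2 * \<rho> powr s) * (ennreal (indicator {0<..} y * y powr a) * ennreal (exp (- \<rho> * y\<^sup>2) * y ^ (2 * n)))"
    proof (cases "y > 0")
      case True
      have y2: "y\<^sup>2 = y powr 2" using True by simp
      have "\<bar>2 * \<rho> * y\<bar> * f (\<rho> * y\<^sup>2) = 2 * \<rho> * y * ((\<rho> * y\<^sup>2) powr (s - 1) * exp (- \<rho> * y\<^sup>2))"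
        using True \<rho> by (simp add: f_def abs_mult exp_minus divide_inverse)
      also have "(\<rho> * y\<^sup>2) powr (s - 1) = \<rho> powr (s - 1) * y powr (2 * (s - 1))"
        using True \<rho> unfolding y2 by (simp only: powr_mult powr_powr)
      also have "2 * \<rho> * y * (\<rho> powr (s - 1) * y powr (2 * (s - 1)) * exp (- \<rho> * y\<^sup>2)) =
         2 * (\<rho> powr 1 * \<rho> powr (s - 1)) * (y powr 1 * y powr (2 * (s - 1))) * exp (- \<rho> * y\<^sup>2)"
        using True \<rho> by simp
      also have "\<rho> powr 1 * \<rho> powr (s - 1) = \<rho> powr s" by (simp only: powr_add[symmetric]) simp
      also have "y powr 1 * y powr (2 * (s - 1)) = y powr (a + real (2 * n))"
      proof -
        have "1 + 2 * (s - 1) = a + real (2 * n)" by (simp add: s_def m field_simps)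
        thus ?thesis by (simp only: powr_add[symmetric])
      qed
      also have "y powr (a + real (2 * n)) = y powr a * y ^ (2 * n)"
        using True by (simp add: powr_add powr_realpow[of y "2*n", simplified])
      finally show ?thesis using True by (simp add: ennreal_mult[symmetric] mult_ac)
    qed auto
  qed
  moreover have "\<dots> = ennreal (2 * \<rho> powr s) * (\<integral>\<^sup>+y. ennreal (exp (- \<rho> * y\<^sup>2) * y ^ (2 * n)) \<partial>wt_meas a)"
    by (subst nn_integral_cmult) (auto simp: nn_integral_wt_meas)
  ultimately have e: "ennreal (2 * \<rho> powr s) * (\<integral>\<^sup>+y. ennreal (exp (- \<rho> * y\<^sup>2) * y ^ (2 * n)) \<partial>wt_meas a) = ennreal (Gamma s)"
    by simp
  have "(\<integral>\<^sup>+y. ennreal (exp (- \<rho> * y\<^sup>2) * y ^ (2 * n)) \<partial>wt_meas a) = ennreal (1 / (2 * \<rho> powr s)) * (ennreal (2 * \<rho> powr s) * (\<integral>\<^sup>+y. ennreal (exp (- \<rho> * y\<^sup>2) * y ^ (2 * n)) \<partial>wt_meas a))"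
    using \<rho> by (simp add: mult.assoc[symmetric] ennreal_mult[symmetric])
  thus ?thesis unfolding e using \<rho> by (simp add: ennreal_mult'[symmetric] s_def)
qed

lemma gauss_moment_real:
  assumes \<rho>: "\<rho> > 0" and a: "a > -1" and m: "m = (a + 1) / 2"
  shows "has_bochner_integral (wt_meas a) (\<lambda>y. exp (- \<rho> * y\<^sup>2) * y ^ (2 * n)) (Gamma (real n + m) / (2 * \<rho> powr (real n + m)))"
  using assms gauss_moment_nn[OF assms, of n]
  by (intro has_bochner_integral_nn_integral) (auto intro!: divide_nonneg_nonneg Gamma_real_nonneg)

lemma gauss_moment_integrable:
  assumes \<beta>: "Re \<beta> > 0" and a: "a > -1"
  shows "integrable (wt_meas a) (\<lambda>y. exp (- \<beta> * of_real (y\<^sup>2)) * of_real (y ^ (2 * n)))"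
proof (rule Bochner_Integration.integrable_bound)
  show "integrable (wt_meas a) (\<lambda>y. exp (- Re \<beta> * y\<^sup>2) * y ^ (2 * n))"
    using gauss_moment_real[OF \<beta> a refl] by (simp add: has_bochner_integral_iff)
  show "AE y in wt_meas a. norm (exp (- \<beta> * of_real (y\<^sup>2)) * of_real (y ^ (2 * n))) \<le> norm (exp (- Re \<beta> * y\<^sup>2) * y ^ (2 * n))"
    by (simp add: norm_mult abs_mult norm_power power_abs)
qed measurable

text \<open>Differentiation under the integral with an explicit error. For |h| < \<rho> / 2 the
  second-order Taylor remainder of exp(-h y^2) is at most |h|^2 y^4 exp(\<rho> y^2 / 2), and the
  Gaussian of rate \<rho> absorbs it. What remains is the moment \<open>K\<close>, of order n + 2
  and with half the rate.\<close>

lemma gauss_moment_holomorphic: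
  assumes \<beta>: "Re \<beta> > 0" and a: "a > -1"
  defines "F \<equiv> \<lambda>n \<beta>. (\<integral>y. exp (- \<beta> * complex_of_real (y\<^sup>2)) * of_real (y ^ (2 * n)) \<partial>wt_meas a)"
  shows "(F n has_field_derivative - F (Suc n) \<beta>) (at \<beta>)"
proof -
  define \<rho> where "\<rho> = Re \<beta>"
  have \<rho>: "\<rho> > 0" using \<beta> by (simp add: \<rho>_def)
  define G where "G n \<beta> y = exp (- \<beta> * complex_of_real (y\<^sup>2)) * of_real (y ^ (2 * n))" for n \<beta> and y :: real
  have Gi: "integrable (wt_meas a) (G n \<beta>)" if "Re \<beta> > 0" for n \<beta>
    unfolding G_def by (rule gauss_moment_integrable[OF that a])
  have FG: "F n \<beta> = (\<integral>y. G n \<beta> y \<partial>wt_meas a)" for n \<beta> by (simp add: F_def G_def)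
  define K where "K = (\<integral>y. exp (- (\<rho> / 2) * y\<^sup>2) * y ^ (2 * (n + 2)) \<partial>wt_meas a)"
  have Ki: "integrable (wt_meas a) (\<lambda>y. exp (- (\<rho> / 2) * y\<^sup>2) * y ^ (2 * (n + 2)))"
  proof -
    have "\<rho> / 2 > 0" using \<rho> by simp
    from gauss_moment_real[OF this a refl, of "n + 2"] show ?thesis by (rule integrable.intros)
  qed
  have bound: "norm ((F n (\<beta> + h) - F n \<beta>) / h - (- F (Suc n) \<beta>)) \<le> K * norm h" if h: "h \<noteq> 0" "norm h < \<rho> / 2" for h
  proof -
    have rh: "Re (\<beta> + h) > 0" using h \<rho> abs_Re_le_cmod[of h] by (simp add: \<rho>_def)
    have eq: "F n (\<beta> + h) - F n \<beta> + h * F (Suc n) \<beta> = (\<integral>y. G n (\<beta> + h) y - G n \<beta> y + h * G (Suc n) \<beta> y \<partial>wt_meas a)"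
      unfolding FG using Gi[OF rh] Gi[OF \<beta>] by simp
    have pw: "norm (G n (\<beta> + h) y - G n \<beta> y + h * G (Suc n) \<beta> y) \<le> (norm h)\<^sup>2 * (exp (- (\<rho> / 2) * y\<^sup>2) * y ^ (2 * (n + 2)))" for y
    proof -
      define z where "z = - h * complex_of_real (y\<^sup>2)"
      have "G n (\<beta> + h) y - G n \<beta> y + h * G (Suc n) \<beta> y = G n \<beta> y * (exp z - (\<Sum>k\<le>1. z ^ k / fact k))"
        by (simp add: G_def z_def exp_add[symmetric] algebra_simps exp_diff exp_minus power2_eq_square) (simp add: field_simps exp_minus exp_add exp_diff)
      hence "norm (G n (\<beta> + h) y - G n \<beta> y + h * G (Suc n) \<beta> y) = norm (G n \<beta> y) * norm (exp z - (\<Sum>k\<le>1. z ^ k / fact k))"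
        by (simp add: norm_mult)
      also have "\<dots> \<le> norm (G n \<beta> y) * (exp \<bar>Re z\<bar> * norm z ^ Suc 1 / fact 1)"
        by (intro mult_left_mono Taylor_exp) auto
      also have "\<dots> \<le> (exp (- \<rho> * y\<^sup>2) * y ^ (2 * n)) * (exp (\<rho> / 2 * y\<^sup>2) * ((norm h)\<^sup>2 * y ^ 4))"
      proof (rule mult_mono)
        show "norm (G n \<beta> y) \<le> exp (- \<rho> * y\<^sup>2) * y ^ (2 * n)"
          by (simp add: G_def norm_mult norm_power \<rho>_def power_abs[symmetric])
        have "\<bar>Re z\<bar> \<le> \<rho> / 2 * y\<^sup>2"
          using h abs_Re_le_cmod[of h] mult_right_mono[of "\<bar>Re h\<bar>" "\<rho> / 2" "y\<^sup>2"] by (simp add: z_def abs_mult)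
        hence "exp \<bar>Re z\<bar> \<le> exp (\<rho> / 2 * y\<^sup>2)" by simp
        moreover have "norm z ^ Suc 1 / fact 1 = (norm h)\<^sup>2 * y ^ 4"
          by (simp add: z_def norm_mult norm_power power2_eq_square power4_eq_xxxx mult_ac)
        ultimately show "exp \<bar>Re z\<bar> * norm z ^ Suc 1 / fact 1 \<le> exp (\<rho> / 2 * y\<^sup>2) * ((norm h)\<^sup>2 * y ^ 4)"
          by (metis mult_right_mono times_divide_eq_right zero_le_power2 zero_le_mult_iff zero_le_even_power even_numeral)
      qed auto
      also have "\<dots> = (norm h)\<^sup>2 * (exp (- (\<rho> / 2) * y\<^sup>2) * y ^ (2 * (n + 2)))"
      proof -
        have E1: "exp (- \<rho> * y\<^sup>2) * exp (\<rho> / 2 * y\<^sup>2) = exp (- (\<rho> / 2) * y\<^sup>2)" by (simp add: exp_add[symmetric] field_simps)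
        have E2: "y ^ (2 * (n + 2)) = y ^ (2 * n) * y ^ 4"
          by (simp only: distrib_left power_add) simp
        show ?thesis unfolding E1[symmetric] E2 by (simp only: mult_ac)
      qed
      finally show ?thesis .
    qed
    have "norm (F n (\<beta> + h) - F n \<beta> + h * F (Suc n) \<beta>) \<le> (\<integral>y. norm (G n (\<beta> + h) y - G n \<beta> y + h * G (Suc n) \<beta> y) \<partial>wt_meas a)"
      unfolding eq by (rule integral_norm_bound)
    also have "\<dots> \<le> (\<integral>y. (norm h)\<^sup>2 * (exp (- (\<rho> / 2) * y\<^sup>2) * y ^ (2 * (n + 2))) \<partial>wt_meas a)"
      by (intro integral_mono integrable_norm integrable_mult_right Ki pw Bochner_Integration.integrable_add Bochner_Integration.integrable_diff Gi rh \<beta>)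
    also have "\<dots> = (norm h)\<^sup>2 * K" by (simp add: K_def)
    finally have *: "norm (F n (\<beta> + h) - F n \<beta> + h * F (Suc n) \<beta>) \<le> (norm h)\<^sup>2 * K" .
    have "(F n (\<beta> + h) - F n \<beta>) / h - (- F (Suc n) \<beta>) = (F n (\<beta> + h) - F n \<beta> + h * F (Suc n) \<beta>) / h"
      using h by (simp add: field_simps)
    hence "norm ((F n (\<beta> + h) - F n \<beta>) / h - (- F (Suc n) \<beta>)) = norm (F n (\<beta> + h) - F n \<beta> + h * F (Suc n) \<beta>) / norm h"
      by (simp add: norm_divide)
    also have "\<dots> \<le> (norm h)\<^sup>2 * K / norm h" using * by (intro divide_right_mono) auto
    also have "\<dots> = K * norm h" using h by (simp add: power2_eq_square)
    finally show ?thesis .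
  qed
  have "((\<lambda>h. (F n (\<beta> + h) - F n \<beta>) / h - (- F (Suc n) \<beta>)) \<longlongrightarrow> 0) (at 0)"
  proof (rule Lim_null_comparison)
    show "\<forall>\<^sub>F h in at 0. norm ((F n (\<beta> + h) - F n \<beta>) / h - (- F (Suc n) \<beta>)) \<le> K * norm h"
      unfolding eventually_at using bound \<rho> by (intro exI[of _ "\<rho> / 2"]) auto
    show "((\<lambda>h. K * norm h) \<longlongrightarrow> 0) (at 0)" by (auto intro!: tendsto_eq_intros)
  qed
  thus ?thesis unfolding DERIV_def by (rule LIM_zero_cancel)
qed

text \<open>Both sides are holomorphic in \<open>\<beta>\<close>, so it suffices to compare them on the positive real axis.\<close>

lemma gauss_moment_complex:
  assumes \<beta>: "Re \<beta> > 0" and a: "a > -1" and m: "m = (a + 1) / 2"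
  shows "(\<integral>y. exp (- \<beta> * complex_of_real (y\<^sup>2)) * of_real (y ^ (2 * n)) \<partial>wt_meas a) = of_real (Gamma (real n + m) / 2) * \<beta> powr (- of_real (real n + m))"
proof -
  define F where "F \<beta> = (\<integral>y. exp (- \<beta> * complex_of_real (y\<^sup>2)) * of_real (y ^ (2 * n)) \<partial>wt_meas a)" for \<beta>
  define S where "S = {z. Re z > 0}"
  define U where "U = complex_of_real ` {0<..}"
  define D where "D \<beta> = F \<beta> - of_real (Gamma (real n + m) / 2) * \<beta> powr (- of_real (real n + m))" for \<beta>
  have "D \<beta> = 0"
  proof (rule analytic_continuation[where f = D and w = \<beta> and S = S and U = U and \<xi> = 1])
    have oS: "open S" unfolding S_def by (rule open_halfspace_Re_gt)
    show "open S" by fact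
    show "connected S" unfolding S_def by (intro convex_connected convex_halfspace_Re_gt)
    have h1: "F holomorphic_on S"
      unfolding holomorphic_on_open[OF oS] F_def
      by (intro ballI exI, rule gauss_moment_holomorphic[OF _ a]) (simp add: S_def)
    have h2: "(\<lambda>z. z powr (- of_real (real n + m))) holomorphic_on S"
      by (intro holomorphic_intros) (auto simp: S_def complex_nonpos_Reals_iff)
    show "D holomorphic_on S" unfolding D_def[abs_def]
      by (rule holomorphic_on_diff[OF h1 holomorphic_on_mult[OF holomorphic_on_const h2]])
    show "U \<subseteq> S" "1 \<in> S" "\<beta> \<in> S" using \<beta> by (auto simp: U_def S_def)
    show "1 islimpt U" unfolding islimpt_approachable
    proof (intro allI impI)
      fix e :: real assume e: "e > 0"
      show "\<exists>x'\<in>U. x' \<noteq> 1 \<and> dist x' 1 < e"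
      proof (intro bexI[of _ "complex_of_real (1 + e/2)"] conjI)
        show "complex_of_real (1 + e/2) \<in> U" using e by (simp only: U_def) (intro imageI, simp)
        show "complex_of_real (1 + e/2) \<noteq> 1" "dist (complex_of_real (1 + e/2)) 1 < e"
          using e by (simp_all add: dist_norm norm_divide)
      qed
    qed
    fix z assume "z \<in> U"
    then obtain \<rho> where z: "z = of_real \<rho>" "\<rho> > 0" by (auto simp: U_def)
    have "F z = (\<integral>y. complex_of_real (exp (- \<rho> * y\<^sup>2) * y ^ (2 * n)) \<partial>wt_meas a)"
      unfolding F_def z by (intro Bochner_Integration.integral_cong) (auto simp: exp_of_real[symmetric])
    also have "\<dots> = of_real (Gamma (real n + m) / (2 * \<rho> powr (real n + m)))"
      by (subst integral_complex_of_real) (simp only: has_bochner_integral_integral_eq[OF gauss_moment_real[OF z(2) a m, of n]])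
    also have "\<dots> = of_real (Gamma (real n + m) / 2) * of_real (\<rho> powr (- (real n + m)))"
      by (simp only: powr_minus divide_inverse inverse_mult_distrib of_real_mult mult.assoc)
    also have "complex_of_real (\<rho> powr (- (real n + m))) = z powr (- of_real (real n + m))"
      using z powr_of_real[of \<rho> "- (real n + m)"] by simp
    finally show "D z = 0" by (simp add: D_def)
  qed
  thus ?thesis by (simp add: D_def F_def)
qed


text \<open>\<open>weber_coeff m X Y n\<close> is the coefficient of \<open>s ^ n\<close> in \<open>clif m (X * s) * clif m (Y * s)\<close>.\<close>

definition weber_coeff :: "real \<Rightarrow> real \<Rightarrow> real \<Rightarrow> nat \<Rightarrow> real" where
  "weber_coeff m X Y n = (\<Sum>i\<le>n. X ^ i * Y ^ (n - i) / (fact i * fact (n - i) * Gamma (real i + m) * Gamma (real (n - i) + m)))"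

section \<open>Weber's integral by power series\<close>

lemma Gamma_vandermonde:
  assumes m: "m > 0"
  shows "Gamma (real (i + j) + m) / (fact i * fact j * Gamma (real i + m) * Gamma (real j + m))
    = (\<Sum>k\<le>min i j. 1 / (fact k * Gamma (real k + m) * fact (i - k) * fact (j - k)))"
proof -
  have np: "real k + m \<notin> \<int>\<^sub>\<le>\<^sub>0" for k using m nonpos_Ints_nonpos[of "real k + m"] by force
  have Gp: "Gamma (real k + m) > 0" for k using m by (intro Gamma_real_pos) auto
  have gb: "(real (k + l) + m - 1) gchoose l = Gamma (real (k + l) + m) / (fact l * Gamma (real k + m))" for k l
  proof -
    have "real (k + l) + m - 1 - real l + 1 = real k + m" by simp
    moreover have "pochhammer (real k + m) l = Gamma (real (k + l) + m) / Gamma (real k + m)"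
      using pochhammer_Gamma[OF np, of k l] by (simp add: algebra_simps)
    ultimately show ?thesis unfolding gbinomial_pochhammer' by simp
  qed
  \<comment> \<open>Chu-Vandermonde for the upper argument split as i + (j + m - 1). The first
    binomial vanishes for k > i, which cuts the sum at \<open>min i j\<close>.\<close>
  have "(real (i + j) + m - 1) gchoose j = (\<Sum>k=0..j. (real i gchoose k) * ((real j + m - 1) gchoose (j - k)))"
    by (subst gbinomial_Vandermonde) (simp add: algebra_simps)
  also have "\<dots> = (\<Sum>k\<le>min i j. (real i gchoose k) * ((real j + m - 1) gchoose (j - k)))"
    by (rule sum.mono_neutral_right) (auto simp flip: binomial_gbinomial)
  also have "\<dots> = (\<Sum>k\<le>min i j. fact i * (Gamma (real j + m) * (1 / (fact k * Gamma (real k + m) * fact (i - k) * fact (j - k)))))"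
  proof (rule sum.cong[OF refl])
    fix k assume k: "k \<in> {..min i j}"
    have "(real j + m - 1) gchoose (j - k) = Gamma (real j + m) / (fact (j - k) * Gamma (real k + m))"
      using gb[of k "j - k"] k by simp
    moreover have "real i gchoose k = fact i / (fact k * fact (i - k))"
      using k by (simp add: binomial_fact flip: binomial_gbinomial)
    ultimately show "(real i gchoose k) * ((real j + m - 1) gchoose (j - k)) = fact i * (Gamma (real j + m) * (1 / (fact k * Gamma (real k + m) * fact (i - k) * fact (j - k))))"
      by simp
  qed
  also have "\<dots> = fact i * Gamma (real j + m) * (\<Sum>k\<le>min i j. 1 / (fact k * Gamma (real k + m) * fact (i - k) * fact (j - k)))"
    by (simp add: sum_distrib_left mult.assoc)
  finally have "Gamma (real (i + j) + m) / (fact j * Gamma (real i + m)) = fact i * Gamma (real j + m) * (\<Sum>k\<le>min i j. 1 / (fact k * Gamma (real k + m) * fact (i - k) * fact (j - k)))"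
    using gb[of i j] by simp
  thus ?thesis using Gp[of j] Gp[of i] by (simp add: field_simps)
qed

text \<open>\<open>Gamma_vandermonde\<close> spreads each term over an index k. With p = i - k as
  the new variable the inner sum is the binomial expansion of (X + Y)^(n - 2k). The factor Gamma(n +
  m) is the one supplied by the Gaussian moment of order n.\<close>

lemma weber_coeff_eq:
  assumes m: "m > 0"
  shows "Gamma (real n + m) * weber_coeff m X Y n =
    (\<Sum>k\<le>n div 2. (X * Y) ^ k / (fact k * Gamma (real k + m)) * ((X + Y) ^ (n - 2 * k) / fact (n - 2 * k)))"
proof -
  have "Gamma (real n + m) * weber_coeff m X Y n = (\<Sum>i\<le>n. X ^ i * Y ^ (n - i) * (\<Sum>k\<le>min i (n - i). 1 / (fact k * Gamma (real k + m) * fact (i - k) * fact (n - i - k))))"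
    unfolding weber_coeff_def
  proof (subst sum_distrib_left, rule sum.cong[OF refl])
    fix i assume "i \<in> {..n}"
    hence e: "Gamma (real n + m) / (fact i * fact (n - i) * Gamma (real i + m) * Gamma (real (n - i) + m)) = (\<Sum>k\<le>min i (n - i). 1 / (fact k * Gamma (real k + m) * fact (i - k) * fact (n - i - k)))"
      using Gamma_vandermonde[OF m, of i "n - i"] by simp
    thus "Gamma (real n + m) * (X ^ i * Y ^ (n - i) / (fact i * fact (n - i) * Gamma (real i + m) * Gamma (real (n - i) + m))) = X ^ i * Y ^ (n - i) * (\<Sum>k\<le>min i (n - i). 1 / (fact k * Gamma (real k + m) * fact (i - k) * fact (n - i - k)))"
      unfolding e[symmetric] by simp
  qed
  also have "\<dots> = (\<Sum>(i,k)\<in>(SIGMA i:{..n}. {..min i (n - i)}). X ^ i * Y ^ (n - i) * (1 / (fact k * Gamma (real k + m) * fact (i - k) * fact (n - i - k))))"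
    by (simp only: sum_distrib_left) (simp add: sum.Sigma)
  also have "\<dots> = (\<Sum>(k,p)\<in>(SIGMA k:{..n div 2}. {..n - 2 * k}). (X * Y) ^ k / (fact k * Gamma (real k + m)) * (X ^ p * Y ^ (n - 2 * k - p) / (fact p * fact (n - 2 * k - p))))"
  proof (rule sum.reindex_bij_witness[where i = "\<lambda>(k,p). (k + p, k)" and j = "\<lambda>(i,k). (k, i - k)"])
    fix z assume z: "z \<in> (SIGMA i:{..n}. {..min i (n - i)})"
    obtain i k where ik: "z = (i, k)" by (cases z)
    with z have le: "i \<le> n" "k \<le> i" "k \<le> n - i" by auto
    have e: "n - 2 * k - (i - k) = n - i - k" "n - i = k + (n - i - k)" "i = k + (i - k)" using le by auto
    have XY: "X ^ i * Y ^ (n - i) = (X * Y) ^ k * (X ^ (i - k) * Y ^ (n - i - k))"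
      by (subst (1) e(3), subst (1) e(2)) (simp only: power_add power_mult_distrib mult_ac)
    show "(case (case z of (i, k) \<Rightarrow> (k, i - k)) of (k, p) \<Rightarrow> (X * Y) ^ k / (fact k * Gamma (real k + m)) * (X ^ p * Y ^ (n - 2 * k - p) / (fact p * fact (n - 2 * k - p)))) = (case z of (i, k) \<Rightarrow> X ^ i * Y ^ (n - i) * (1 / (fact k * Gamma (real k + m) * fact (i - k) * fact (n - i - k))))"
      by (simp only: ik prod.case e(1) XY) simp
  qed auto
  also have "\<dots> = (\<Sum>k\<le>n div 2. \<Sum>p\<le>n - 2 * k. (X * Y) ^ k / (fact k * Gamma (real k + m)) * (X ^ p * Y ^ (n - 2 * k - p) / (fact p * fact (n - 2 * k - p))))"
    by (simp add: sum.Sigma)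
  also have "\<dots> = (\<Sum>k\<le>n div 2. (X * Y) ^ k / (fact k * Gamma (real k + m)) * ((X + Y) ^ (n - 2 * k) / fact (n - 2 * k)))"
  proof (rule sum.cong[OF refl])
    fix k
    define l where "l = n - 2 * k"
    have "(X + Y) ^ l / fact l = (\<Sum>p\<le>l. X ^ p * Y ^ (l - p) / (fact p * fact (l - p)))"
      unfolding binomial_ring sum_divide_distrib by (intro sum.cong) (auto simp: binomial_fact field_simps)
    thus "(\<Sum>p\<le>n - 2 * k. (X * Y) ^ k / (fact k * Gamma (real k + m)) * (X ^ p * Y ^ (n - 2 * k - p) / (fact p * fact (n - 2 * k - p)))) = (X * Y) ^ k / (fact k * Gamma (real k + m)) * ((X + Y) ^ (n - 2 * k) / fact (n - 2 * k))"
      by (simp add: sum_distrib_left l_def)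
  qed
  finally show ?thesis .
qed

text \<open>The generating function behind Weber's formula: at w = 1 / \<beta> its terms are, up to
  the common factor \<beta>^(-m) / 2, the integrals of the expanded product, and its sum is the
  closed form. \<open>weber_coeff_eq\<close> exhibits it as a Cauchy product.\<close>

lemma weber_series:
  fixes w :: "'a::{real_normed_field,banach}"
  assumes m: "m > 0"
  shows "(\<lambda>n. (Gamma (real n + m) * weber_coeff m X Y n) *\<^sub>R w ^ n) sums
    (exp (of_real (X + Y) * w) * clif m (of_real (X * Y) * w\<^sup>2))"
proof -
  define A where "A n = (of_real (X + Y) * w) ^ n /\<^sub>R fact n" for n
  define B0 where "B0 k = (1 / (fact k * Gamma (real k + m))) *\<^sub>R (of_real (X * Y) * w\<^sup>2) ^ k" for k
  \<comment> \<open>A series in w^2 written as a series in w, with zeros at odd indices, so that its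
    Cauchy product with the exponential series is indexed by powers of w.\<close>
  define B where "B n = (if even n then B0 (n div 2) else 0)" for n
  have sA: "summable (\<lambda>n. norm (A n))" unfolding A_def by (rule summable_norm_exp)
  have A: "(\<Sum>n. A n) = exp (of_real (X + Y) * w)" by (simp add: A_def exp_def)
  have BB: "(\<lambda>n. B (2 * n)) = B0" by (auto simp: B_def)
  have B: "B sums clif m (of_real (X * Y) * w\<^sup>2)"
  proof (rule iffD1[OF sums_mono_reindex[of "\<lambda>k. 2 * k"]])
    show "(\<lambda>k. B (2 * k)) sums clif m (of_real (X * Y) * w\<^sup>2)"
      unfolding BB B0_def by (rule clif_sums[OF m])
  qed (auto simp: strict_mono_def B_def elim!: evenE)
  have sB: "summable (\<lambda>n. norm (B n))"
  proof (rule iffD1[OF summable_mono_reindex[of "\<lambda>k. 2 * k"]])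
    show "summable (\<lambda>k. norm (B (2 * k)))"
      unfolding fun_cong[OF BB] B0_def by (rule clif_summable[OF m])
  qed (auto simp: strict_mono_def B_def elim!: evenE)
  have "(\<lambda>n. \<Sum>i\<le>n. B i * A (n - i)) sums ((\<Sum>n. B n) * (\<Sum>n. A n))"
    by (rule Cauchy_product_sums[OF sB sA])
  moreover have "(\<Sum>i\<le>n. B i * A (n - i)) = (Gamma (real n + m) * weber_coeff m X Y n) *\<^sub>R w ^ n" for n
  proof -
    have "(\<Sum>i\<le>n. B i * A (n - i)) = (\<Sum>i\<in>(\<lambda>k. 2 * k) ` {..n div 2}. B i * A (n - i))"
      by (rule sum.mono_neutral_right) (auto simp: B_def elim!: evenE)
    also have "\<dots> = (\<Sum>k\<le>n div 2. B0 k * A (n - 2 * k))"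
      by (subst sum.reindex) (auto simp: inj_on_def B_def)
    also have "\<dots> = (\<Sum>k\<le>n div 2. ((X * Y) ^ k / (fact k * Gamma (real k + m)) * ((X + Y) ^ (n - 2 * k) / fact (n - 2 * k))) *\<^sub>R w ^ n)"
    proof (rule sum.cong[OF refl])
      fix k assume "k \<in> {..n div 2}"
      hence "n = 2 * k + (n - 2 * k)" by auto
      hence w: "w ^ n = (w\<^sup>2) ^ k * w ^ (n - 2 * k)" by (metis power_add power_mult)
      have "B0 k * A (n - 2 * k) = of_real ((X * Y) ^ k / (fact k * Gamma (real k + m)) * ((X + Y) ^ (n - 2 * k) / fact (n - 2 * k))) * ((w\<^sup>2) ^ k * w ^ (n - 2 * k))"
        unfolding B0_def A_def power_mult_distrib of_real_power[symmetric]
        by (simp only: scaleR_conv_of_real of_real_mult of_real_divide of_real_power power_mult_distrib of_real_inverse of_real_1 divide_inverse mult_ac mult_1 inverse_mult_distrib)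
      thus "B0 k * A (n - 2 * k) = ((X * Y) ^ k / (fact k * Gamma (real k + m)) * ((X + Y) ^ (n - 2 * k) / fact (n - 2 * k))) *\<^sub>R w ^ n"
        by (simp only: w scaleR_conv_of_real)
    qed
    also have "\<dots> = (Gamma (real n + m) * weber_coeff m X Y n) *\<^sub>R w ^ n"
      by (simp only: weber_coeff_eq[OF m] scaleR_sum_left)
    finally show ?thesis .
  qed
  ultimately show ?thesis using A B by (simp add: sums_iff mult.commute)
qed

lemma weber_coeff_abs:
  assumes m: "m > 0"
  shows "\<bar>weber_coeff m X Y n\<bar> \<le> weber_coeff m \<bar>X\<bar> \<bar>Y\<bar> n"
  unfolding weber_coeff_def
proof (rule order_trans[OF sum_abs], rule sum_mono)
  fix i
  have "Gamma (real i + m) > 0" "Gamma (real (n - i) + m) > 0" using m by (auto intro!: Gamma_real_pos)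
  thus "\<bar>X ^ i * Y ^ (n - i) / (fact i * fact (n - i) * Gamma (real i + m) * Gamma (real (n - i) + m))\<bar> \<le> \<bar>X\<bar> ^ i * \<bar>Y\<bar> ^ (n - i) / (fact i * fact (n - i) * Gamma (real i + m) * Gamma (real (n - i) + m))"
    by (simp add: abs_mult power_abs)
qed

lemma clif_mult_sums:
  fixes s :: real
  assumes m: "m > 0"
  shows "(\<lambda>n. weber_coeff m X Y n * s ^ n) sums (clif m (X * s) * clif m (Y * s))"
    and "summable (\<lambda>n. norm (weber_coeff m X Y n * s ^ n))"
proof -
  have e: "(\<Sum>i\<le>n. ((1 / (fact i * Gamma (real i + m))) *\<^sub>R (x * s) ^ i) * ((1 / (fact (n - i) * Gamma (real (n - i) + m))) *\<^sub>R (y * s) ^ (n - i))) = weber_coeff m x y n * s ^ n" for n x y s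
    unfolding weber_coeff_def sum_distrib_right
  proof (rule sum.cong[OF refl])
    fix i assume "i \<in> {..n}"
    hence "s ^ n = s ^ i * s ^ (n - i)" by (simp flip: power_add)
    thus "((1 / (fact i * Gamma (real i + m))) *\<^sub>R (x * s) ^ i) * ((1 / (fact (n - i) * Gamma (real (n - i) + m))) *\<^sub>R (y * s) ^ (n - i)) = x ^ i * y ^ (n - i) / (fact i * fact (n - i) * Gamma (real i + m) * Gamma (real (n - i) + m)) * s ^ n"
      by (simp add: power_mult_distrib field_simps)
  qed
  have S: "(\<lambda>n. weber_coeff m x y n * s ^ n) sums (clif m (x * s) * clif m (y * s))" for x y s
    using Cauchy_product_sums[OF clif_summable[OF m, of "x * s"] clif_summable[OF m, of "y * s"]]
    unfolding e clif_def .
  show "(\<lambda>n. weber_coeff m X Y n * s ^ n) sums (clif m (X * s) * clif m (Y * s))" by (rule S)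
  have le: "norm (weber_coeff m X Y n * s ^ n) \<le> weber_coeff m \<bar>X\<bar> \<bar>Y\<bar> n * \<bar>s\<bar> ^ n" for n
    using mult_right_mono[OF weber_coeff_abs[OF m], of "\<bar>s\<bar> ^ n"] by (simp add: abs_mult power_abs)
  show "summable (\<lambda>n. norm (weber_coeff m X Y n * s ^ n))"
    by (rule summable_comparison_test'[OF sums_summable[OF S[of "\<bar>X\<bar>" "\<bar>Y\<bar>" "\<bar>s\<bar>"]], of 0]) (simp only: real_norm_def abs_norm_cancel abs_idempotent le[unfolded real_norm_def])
qed

text \<open>The product of the two series is expanded in powers of y^2 and integrated term by term;
  \<open>weber_series\<close> sums the result.\<close>

lemma weber:
  assumes \<beta>: "Re \<beta> > 0" and a: "a > -1" and m: "m = (a + 1) / 2"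
  shows "has_bochner_integral (wt_meas a) (\<lambda>y. exp (- \<beta> * of_real (y\<^sup>2)) * of_real (clif m (X * y\<^sup>2) * clif m (Y * y\<^sup>2)))
    (\<beta> powr (- of_real m) / 2 * (exp (of_real (X + Y) / \<beta>) * clif m (of_real (X * Y) / \<beta>\<^sup>2)))"
proof -
  have m0: "m > 0" using a m by simp
  define \<rho> where "\<rho> = Re \<beta>"
  have \<rho>: "\<rho> > 0" using \<beta> by (simp add: \<rho>_def)
  define f where "f n y = of_real (weber_coeff m X Y n) * (exp (- \<beta> * of_real (y\<^sup>2)) * of_real (y ^ (2 * n)))" for n and y :: real
  have fe: "f n y = exp (- \<beta> * of_real (y\<^sup>2)) * of_real (weber_coeff m X Y n * (y\<^sup>2) ^ n)" for n y
    by (simp add: f_def power_mult)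
  have fi: "integrable (wt_meas a) (f n)" for n
    unfolding f_def by (intro integrable_mult_right gauss_moment_integrable \<beta> a)
  have "(\<lambda>n. f n y) sums (exp (- \<beta> * of_real (y\<^sup>2)) * of_real (clif m (X * y\<^sup>2) * clif m (Y * y\<^sup>2)))" for y
    unfolding fe by (intro sums_mult sums_of_real clif_mult_sums m0)
  hence fs: "(\<Sum>n. f n y) = exp (- \<beta> * of_real (y\<^sup>2)) * of_real (clif m (X * y\<^sup>2) * clif m (Y * y\<^sup>2))" for y
    by (simp add: sums_iff)
  have fab: "summable (\<lambda>n. norm (f n y))" for y
    unfolding fe norm_mult norm_of_real using clif_mult_sums(2)[OF m0, of X Y "y\<^sup>2"] by (intro summable_mult) (simp add: abs_mult)
  have fn: "(\<integral>y. norm (f n y) \<partial>wt_meas a) = \<bar>weber_coeff m X Y n\<bar> * (Gamma (real n + m) / (2 * \<rho> powr (real n + m)))" for n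
  proof -
    have "norm (f n y) = \<bar>weber_coeff m X Y n\<bar> * (exp (- \<rho> * y\<^sup>2) * y ^ (2 * n))" for y
      by (simp add: f_def norm_mult \<rho>_def norm_power power_abs[symmetric])
    thus ?thesis using gauss_moment_real[OF \<rho> a m, of n] by (simp add: has_bochner_integral_iff)
  qed
  \<comment> \<open>The majorant comes from the formula itself: with X, Y, \<beta> replaced by |X|,
    |Y| and Re \<beta>, the series \<open>weber_series\<close> converges and dominates the integrals
    of the norms.\<close>
  have fsn: "summable (\<lambda>n. \<integral>y. norm (f n y) \<partial>wt_meas a)"
  proof -
    have "summable (\<lambda>n. \<rho> powr (- m) / 2 * ((Gamma (real n + m) * weber_coeff m \<bar>X\<bar> \<bar>Y\<bar> n) *\<^sub>R (1/\<rho>) ^ n))"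
      by (intro summable_mult sums_summable[OF weber_series[OF m0]])
    moreover have "norm (\<integral>y. norm (f n y) \<partial>wt_meas a) \<le> \<rho> powr (- m) / 2 * ((Gamma (real n + m) * weber_coeff m \<bar>X\<bar> \<bar>Y\<bar> n) *\<^sub>R (1/\<rho>) ^ n)" for n
    proof -
      have G: "Gamma (real n + m) > 0" using m0 by (intro Gamma_real_pos) auto
      have "1 / (\<rho> powr (real n + m)) = \<rho> powr (- m) * (1/\<rho>) ^ n"
        using \<rho> by (simp add: powr_add powr_minus powr_realpow power_divide field_simps)
      hence "\<rho> powr (- m) / 2 * (1/\<rho>) ^ n = (1 / \<rho> powr (real n + m)) / 2" by (simp only: times_divide_eq_left)
      hence "(\<integral>y. norm (f n y) \<partial>wt_meas a) = \<bar>weber_coeff m X Y n\<bar> * (Gamma (real n + m) * (\<rho> powr (- m) / 2 * (1/\<rho>) ^ n))"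
        unfolding fn by (simp only: divide_inverse inverse_mult_distrib mult_1 mult_ac)
      also have "\<dots> \<le> weber_coeff m \<bar>X\<bar> \<bar>Y\<bar> n * (Gamma (real n + m) * (\<rho> powr (- m) / 2 * (1/\<rho>) ^ n))"
        using G \<rho> by (intro mult_right_mono weber_coeff_abs m0) auto
      finally show ?thesis by (simp add: mult_ac)
    qed
    ultimately show ?thesis by (rule summable_comparison_test'[where N = 0])
  qed
  have int: "integral\<^sup>L (wt_meas a) (f n) = \<beta> powr (- of_real m) / 2 * ((Gamma (real n + m) * weber_coeff m X Y n) *\<^sub>R (1/\<beta>) ^ n)" for n
  proof -
    have b0: "\<beta> \<noteq> 0" using \<beta> by auto
    have "integral\<^sup>L (wt_meas a) (f n) = of_real (weber_coeff m X Y n) * (of_real (Gamma (real n + m) / 2) * \<beta> powr (- of_real (real n + m)))"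
      unfolding f_def using gauss_moment_complex[OF \<beta> a m, of n] by simp
    also have "\<beta> powr (- of_real (real n + m)) = \<beta> powr (- of_real m) * (1/\<beta>) ^ n"
    proof -
      have "- complex_of_real (real n + m) = - of_real m - of_nat n" by (simp add: algebra_simps)
      hence "\<beta> powr (- of_real (real n + m)) = \<beta> powr (- of_real m - of_nat n)" by (simp only:)
      also have "\<dots> = \<beta> powr (- of_real m) / \<beta> powr (of_nat n)" by (rule powr_diff)
      finally show ?thesis using b0 by (simp add: powr_nat' power_divide)
    qed
    finally show ?thesis by (simp add: scaleR_conv_of_real mult_ac)
  qed
  have "(\<lambda>n. integral\<^sup>L (wt_meas a) (f n)) sums (\<integral>y. (\<Sum>n. f n y) \<partial>wt_meas a)"
    by (rule sums_integral) (use fi fab fsn in auto)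
  moreover have "(\<lambda>n. integral\<^sup>L (wt_meas a) (f n)) sums (\<beta> powr (- of_real m) / 2 * (exp (of_real (X + Y) * (1/\<beta>)) * clif m (of_real (X * Y) * (1/\<beta>)\<^sup>2)))"
    unfolding int by (intro sums_mult weber_series m0)
  ultimately have "(\<integral>y. (\<Sum>n. f n y) \<partial>wt_meas a) = \<beta> powr (- of_real m) / 2 * (exp (of_real (X + Y) / \<beta>) * clif m (of_real (X * Y) / \<beta>\<^sup>2))"
    using sums_unique2 by (fastforce simp: power_divide)
  moreover have "integrable (wt_meas a) (\<lambda>y. \<Sum>n. f n y)"
    by (rule integrable_suminf) (use fi fab fsn in auto)
  ultimately show ?thesis unfolding fs by (simp add: has_bochner_integral_iff)
qed


abbreviation wnorm :: "real \<Rightarrow> real \<Rightarrow> (real \<Rightarrow> complex) \<Rightarrow> ennreal" where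
  "wnorm a p f \<equiv> enn_powr (\<integral>\<^sup>+x. ennreal (norm (f x) powr p) \<partial>wt_meas a) (1/p)"

abbreviation wsq :: "real \<Rightarrow> (real \<Rightarrow> complex) \<Rightarrow> ennreal" where
  "wsq a f \<equiv> \<integral>\<^sup>+x. ennreal ((norm (f x))\<^sup>2) \<partial>wt_meas a"

lemma weber_real:
  assumes \<rho>: "\<rho> > 0" and a: "a > -1" and m: "m = (a + 1) / 2"
  shows "has_bochner_integral (wt_meas a) (\<lambda>y. exp (- \<rho> * y\<^sup>2) * (clif m (X * y\<^sup>2) * clif m (Y * y\<^sup>2)))
    (\<rho> powr (- m) / 2 * (exp ((X + Y) / \<rho>) * clif m (X * Y / \<rho>\<^sup>2)))"
proof -
  have m0: "m > 0" using a m by simp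
  have "has_bochner_integral (wt_meas a) (\<lambda>y. Re (exp (- of_real \<rho> * of_real (y\<^sup>2)) * of_real (clif m (X * y\<^sup>2) * clif m (Y * y\<^sup>2))))
    (Re (of_real \<rho> powr (- of_real m) / 2 * (exp (of_real (X + Y) / of_real \<rho>) * clif m (of_real (X * Y) / (of_real \<rho>)\<^sup>2))))"
    by (rule has_bochner_integral_bounded_linear[OF bounded_linear_Re weber]) (use assms in auto)
  moreover have "of_real \<rho> powr (- of_real m) = complex_of_real (\<rho> powr (- m))"
    using \<rho> powr_of_real[of \<rho> "- m"] by simp
  moreover have "exp (of_real (X + Y) / of_real \<rho>) = complex_of_real (exp ((X + Y) / \<rho>))"
    by (simp only: of_real_divide[symmetric] exp_of_real)
  moreover have "clif m (of_real (X * Y) / (of_real \<rho>)\<^sup>2) = complex_of_real (clif m (X * Y / \<rho>\<^sup>2))"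
    by (simp only: of_real_divide[symmetric] of_real_power[symmetric] clif_of_real[OF m0])
  moreover have "exp (- of_real \<rho> * of_real (y\<^sup>2)) = complex_of_real (exp (- \<rho> * y\<^sup>2))" for y
    by (simp only: of_real_minus[symmetric] of_real_mult[symmetric] exp_of_real)
  ultimately show ?thesis by (simp del: of_real_add)
qed

section \<open>The Schroedinger propagator\<close>

text \<open>For z > 0 this is (z/2)^(1-m) J_{m-1}(z). It is even and entire in z, so neither a
  branch of the power nor the behaviour at 0 has to be discussed.\<close>

definition jb :: "real \<Rightarrow> real \<Rightarrow> real" where
  "jb m z = clif m (- (z\<^sup>2) / 4)"

lemma jb_measurable [measurable (raw)]:
  assumes [measurable]: "f \<in> borel_measurable M"
  shows "(\<lambda>x. jb m (f x)) \<in> borel_measurable M"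
  unfolding jb_def by measurable

text \<open>The argument of \<open>clif\<close> is u^2 / 4 with u = iz purely imaginary, so Re u = 0
  and the exponential in \<open>norm_clif_le\<close> is 1.\<close>

lemma jb_bound:
  assumes "m \<ge> 1/2"
  shows "\<bar>jb m z\<bar> \<le> 1 / Gamma m"
proof -
  have "of_real (jb m z) = clif m ((\<i> * of_real z)\<^sup>2 / 4)"
    using clif_of_real[of m "- (z\<^sup>2) / 4", where ?'a = complex] assms
    by (simp add: jb_def power_mult_distrib)
  thus ?thesis using norm_clif_le[OF assms, of "\<i> * of_real z"] by (metis norm_of_real Re_i_times Im_complex_of_real abs_0 exp_zero minus_zero)
qed

lemma cnj_measurable [measurable (raw)]:
  assumes [measurable]: "f \<in> borel_measurable M"
  shows "(\<lambda>x. cnj (f x)) \<in> borel_measurable M"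
proof -
  have "cnj \<in> borel_measurable borel" by (intro borel_measurable_continuous_onI continuous_intros)
  thus ?thesis by measurable
qed

section \<open>Exchange of integrals, expansion of squares, removal of the damping\<close>

lemma integral_swap:
  fixes f :: "'a \<Rightarrow> 'b \<Rightarrow> complex"
  assumes "sigma_finite_measure M" "sigma_finite_measure N"
    and f [measurable]: "case_prod f \<in> borel_measurable (M \<Otimes>\<^sub>M N)"
    and fin: "(\<integral>\<^sup>+x. (\<integral>\<^sup>+y. ennreal (norm (f x y)) \<partial>N) \<partial>M) < top"
  shows "(\<integral>x. (\<integral>y. f x y \<partial>N) \<partial>M) = (\<integral>y. (\<integral>x. f x y \<partial>M) \<partial>N)"
proof -
  interpret M: sigma_finite_measure M by fact
  interpret N: sigma_finite_measure N by fact
  interpret MN: pair_sigma_finite M N ..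
  have i: "integrable (M \<Otimes>\<^sub>M N) (case_prod f)"
  proof (rule integrableI_bounded)
    have "(\<integral>\<^sup>+z. ennreal (norm (case_prod f z)) \<partial>(M \<Otimes>\<^sub>M N)) = (\<integral>\<^sup>+x. (\<integral>\<^sup>+y. ennreal (norm (f x y)) \<partial>N) \<partial>M)"
      by (subst N.nn_integral_fst[symmetric]) auto
    thus "(\<integral>\<^sup>+z. ennreal (norm (case_prod f z)) \<partial>(M \<Otimes>\<^sub>M N)) < \<infinity>" using fin by simp
  qed fact
  show "(\<integral>x. (\<integral>y. f x y \<partial>N) \<partial>M) = (\<integral>y. (\<integral>x. f x y \<partial>M) \<partial>N)"
    using MN.integral_fst[OF i] MN.integral_snd[OF i] by simp
qed

text \<open>A non-integrable function has Bochner integral 0, so the bound is unconditional.\<close>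

lemma norm_integral_le_nn_integral:
  fixes f :: "'a \<Rightarrow> complex"
  shows "ennreal (norm (integral\<^sup>L M f)) \<le> (\<integral>\<^sup>+x. ennreal (norm (f x)) \<partial>M)"
  by (cases "integrable M f") (auto simp: integral_norm_bound_ennreal not_integrable_integral_eq)

text \<open>The common core of both TT* steps: |V|^2 is V times its conjugate, and the integral over
  \<Omega> is moved inside. Finiteness of \<Omega> and a majorant \<open>g\<close> independent of y
  make every exchange absolutely convergent. The Schur test uses it with P in space, the dual
  Strichartz estimate with P in time.\<close>

lemma nn_integral_square_le_double:
  fixes \<kappa> :: "'a \<Rightarrow> 'b \<Rightarrow> complex"
  assumes O: "finite_measure \<Omega>" and P: "sigma_finite_measure P"
    and \<kappa> [measurable]: "case_prod \<kappa> \<in> borel_measurable (\<Omega> \<Otimes>\<^sub>M P)"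
    and g: "integrable P g" and le: "\<And>y p. y \<in> space \<Omega> \<Longrightarrow> p \<in> space P \<Longrightarrow> norm (\<kappa> y p) \<le> g p"
  shows "(\<integral>\<^sup>+y. ennreal ((norm (\<integral>p. \<kappa> y p \<partial>P))\<^sup>2) \<partial>\<Omega>) \<le>
    (\<integral>\<^sup>+p. (\<integral>\<^sup>+p'. ennreal (norm (\<integral>y. \<kappa> y p * cnj (\<kappa> y p') \<partial>\<Omega>)) \<partial>P) \<partial>P)"
proof -
  interpret O: finite_measure \<Omega> by fact
  interpret P: sigma_finite_measure P by fact
  have so: "sigma_finite_measure \<Omega>" ..
  have Ofin: "emeasure \<Omega> (space \<Omega>) < top" 
    using O.emeasure_finite[of "space \<Omega>"] by (simp only: infinity_ennreal_def less_top not_False_eq_True)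
  have gm [measurable]: "g \<in> borel_measurable P" using g by auto
  define G where "G = (\<integral>\<^sup>+p. ennreal (g p) \<partial>P)"
  have G: "G < top"
  proof -
    have "G \<le> (\<integral>\<^sup>+p. ennreal (norm (g p)) \<partial>P)" unfolding G_def by (intro nn_integral_mono ennreal_leI) auto
    also have "\<dots> < top" using g unfolding integrable_iff_bounded by simp
    finally show ?thesis .
  qed
  define V where "V y = (\<integral>p. \<kappa> y p \<partial>P)" for y
  have Vm [measurable]: "V \<in> borel_measurable \<Omega>" unfolding V_def by measurable
  have \<kappa>i: "(\<integral>\<^sup>+p. ennreal (norm (\<kappa> y p)) \<partial>P) \<le> G" if "y \<in> space \<Omega>" for y
    unfolding G_def using le[OF that] by (intro nn_integral_mono ennreal_leI) auto
  have \<kappa>int: "integrable P (\<kappa> y)" if y: "y \<in> space \<Omega>" for y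
    unfolding integrable_iff_bounded using \<kappa>i[OF y] G y by (auto simp: le_less_trans)
  have Vb: "ennreal (norm (V y)) \<le> G" if "y \<in> space \<Omega>" for y
    unfolding V_def using integral_norm_bound_ennreal[OF \<kappa>int[OF that]] \<kappa>i[OF that] by simp
  have sq: "complex_of_real ((norm (V y))\<^sup>2) = (\<integral>p. \<kappa> y p * cnj (V y) \<partial>P)" if y: "y \<in> space \<Omega>" for y
  proof -
    have "(\<integral>p. \<kappa> y p * cnj (V y) \<partial>P) = V y * cnj (V y)" using \<kappa>int[OF y] by (simp add: V_def)
    thus ?thesis by (simp only: complex_norm_square)
  qed
  have KV: "(\<integral>y. \<kappa> y p * cnj (V y) \<partial>\<Omega>) = (\<integral>p'. (\<integral>y. \<kappa> y p * cnj (\<kappa> y p') \<partial>\<Omega>) \<partial>P)" if p: "p \<in> space P" for p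
  proof -
    have "(\<integral>y. \<kappa> y p * cnj (V y) \<partial>\<Omega>) = (\<integral>y. (\<integral>p'. \<kappa> y p * cnj (\<kappa> y p') \<partial>P) \<partial>\<Omega>)"
      using \<kappa>int by (intro Bochner_Integration.integral_cong) (auto simp: V_def)
    also have "\<dots> = (\<integral>p'. (\<integral>y. \<kappa> y p * cnj (\<kappa> y p') \<partial>\<Omega>) \<partial>P)"
    proof (rule integral_swap[OF so P])
      have "(\<lambda>y. \<kappa> y p) \<in> borel_measurable \<Omega>" using measurable_Pair1[OF \<kappa> p] by simp
      thus "(\<lambda>(y, p'). \<kappa> y p * cnj (\<kappa> y p')) \<in> borel_measurable (\<Omega> \<Otimes>\<^sub>M P)" by measurable
      have "(\<integral>\<^sup>+y. (\<integral>\<^sup>+p'. ennreal (norm (\<kappa> y p * cnj (\<kappa> y p'))) \<partial>P) \<partial>\<Omega>) \<le> (\<integral>\<^sup>+y. ennreal (g p) * G \<partial>\<Omega>)"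
      proof (rule nn_integral_mono)
        fix y assume y: "y \<in> space \<Omega>"
        have gp: "g p \<ge> 0" using le[OF y p] norm_ge_zero order_trans by blast
        have "(\<integral>\<^sup>+p'. ennreal (norm (\<kappa> y p * cnj (\<kappa> y p'))) \<partial>P) \<le> (\<integral>\<^sup>+p'. ennreal (g p) * ennreal (g p') \<partial>P)"
          using le[OF y p] le[OF y] gp by (intro nn_integral_mono) (auto simp: norm_mult ennreal_mult'[symmetric] intro!: ennreal_leI mult_mono)
        also have "\<dots> = ennreal (g p) * G" by (subst nn_integral_cmult) (auto simp: G_def)
        finally show "(\<integral>\<^sup>+p'. ennreal (norm (\<kappa> y p * cnj (\<kappa> y p'))) \<partial>P) \<le> ennreal (g p) * G" .
      qed
      also have "\<dots> < top" using G Ofin by (simp add: ennreal_mult_less_top)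
      finally show "(\<integral>\<^sup>+y. (\<integral>\<^sup>+p'. ennreal (norm (\<kappa> y p * cnj (\<kappa> y p'))) \<partial>P) \<partial>\<Omega>) < top" .
    qed
    finally show ?thesis .
  qed
  have bnd: "(\<integral>\<^sup>+y. (\<integral>\<^sup>+p. ennreal (norm (\<kappa> y p * cnj (V y))) \<partial>P) \<partial>\<Omega>) < top"
  proof -
    have "(\<integral>\<^sup>+y. (\<integral>\<^sup>+p. ennreal (norm (\<kappa> y p * cnj (V y))) \<partial>P) \<partial>\<Omega>) \<le> (\<integral>\<^sup>+y. G * G \<partial>\<Omega>)"
    proof (rule nn_integral_mono)
      fix y assume y: "y \<in> space \<Omega>"
      have "(\<integral>\<^sup>+p. ennreal (norm (\<kappa> y p * cnj (V y))) \<partial>P) = (\<integral>\<^sup>+p. ennreal (norm (\<kappa> y p)) \<partial>P) * ennreal (norm (V y))"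
        using y by (simp add: norm_mult ennreal_mult nn_integral_multc)
      also have "\<dots> \<le> G * G" using \<kappa>i[OF y] Vb[OF y] by (intro mult_mono) auto
      finally show "(\<integral>\<^sup>+p. ennreal (norm (\<kappa> y p * cnj (V y))) \<partial>P) \<le> G * G" .
    qed
    also have "\<dots> < top" using G Ofin by (simp add: ennreal_mult_less_top)
    finally show ?thesis .
  qed
  have Vi: "integrable \<Omega> (\<lambda>y. (norm (V y))\<^sup>2)"
  proof (rule integrableI_bounded)
    have "(\<integral>\<^sup>+y. ennreal (norm ((norm (V y))\<^sup>2)) \<partial>\<Omega>) \<le> (\<integral>\<^sup>+y. G * G \<partial>\<Omega>)"
    proof (rule nn_integral_mono)
      fix y assume y: "y \<in> space \<Omega>"
      show "ennreal (norm ((norm (V y))\<^sup>2)) \<le> G * G"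
        using mult_mono[OF Vb[OF y] Vb[OF y]] by (simp add: power2_eq_square ennreal_mult)
    qed
    also have "\<dots> < top" using G Ofin by (simp add: ennreal_mult_less_top)
    finally show "(\<integral>\<^sup>+y. ennreal (norm ((norm (V y))\<^sup>2)) \<partial>\<Omega>) < \<infinity>" by simp
  qed measurable
  have "(\<integral>\<^sup>+y. ennreal ((norm (V y))\<^sup>2) \<partial>\<Omega>) = ennreal (\<integral>y. (norm (V y))\<^sup>2 \<partial>\<Omega>)"
    by (rule nn_integral_eq_integral[OF Vi]) auto
  also have "(\<integral>y. (norm (V y))\<^sup>2 \<partial>\<Omega>) = norm (\<integral>y. complex_of_real ((norm (V y))\<^sup>2) \<partial>\<Omega>)"
    by (simp only: integral_complex_of_real norm_of_real) simp
  also have "(\<integral>y. complex_of_real ((norm (V y))\<^sup>2) \<partial>\<Omega>) = (\<integral>y. (\<integral>p. \<kappa> y p * cnj (V y) \<partial>P) \<partial>\<Omega>)"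
    by (intro Bochner_Integration.integral_cong sq refl)
  also have "\<dots> = (\<integral>p. (\<integral>y. \<kappa> y p * cnj (V y) \<partial>\<Omega>) \<partial>P)"
    by (rule integral_swap[OF so P _ bnd]) measurable
  also have "ennreal (norm \<dots>) \<le> (\<integral>\<^sup>+p. ennreal (norm (\<integral>y. \<kappa> y p * cnj (V y) \<partial>\<Omega>)) \<partial>P)"
    by (rule norm_integral_le_nn_integral)
  also have "\<dots> \<le> (\<integral>\<^sup>+p. (\<integral>\<^sup>+p'. ennreal (norm (\<integral>y. \<kappa> y p * cnj (\<kappa> y p') \<partial>\<Omega>)) \<partial>P) \<partial>P)"
    by (rule nn_integral_mono) (simp add: KV norm_integral_le_nn_integral)
  finally show ?thesis by (simp add: V_def)
qed

text \<open>Monotone convergence along \<delta> = 1 / (n + 1), where the damping factors increase to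
  1.\<close>

lemma nn_integral_gauss_limit:
  fixes h :: "real \<Rightarrow> ennreal"
  assumes hm: "h \<in> borel_measurable M" and sM: "sets M = sets borel"
    and B: "\<And>\<delta>. \<delta> > 0 \<Longrightarrow> (\<integral>\<^sup>+x. ennreal (exp (- \<delta> * x\<^sup>2)) * h x \<partial>M) \<le> B"
  shows "(\<integral>\<^sup>+x. h x \<partial>M) \<le> B"
proof -
  have inc: "ennreal (exp (- (1 / real (Suc n)) * x\<^sup>2)) \<le> ennreal (exp (- (1 / real (Suc (Suc n))) * x\<^sup>2))" for n and x :: real
  proof -
    have "1 / real (Suc (Suc n)) * x\<^sup>2 \<le> 1 / real (Suc n) * x\<^sup>2" by (intro mult_right_mono divide_left_mono) auto
    thus ?thesis by (intro ennreal_leI) (simp del: of_nat_Suc)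
  qed
  have S: "(SUP n. ennreal (exp (- (1 / real (Suc n)) * x\<^sup>2))) = 1" for x
  proof -
    have "incseq (\<lambda>n. ennreal (exp (- (1 / real (Suc n)) * x\<^sup>2)))"
      by (intro incseq_SucI inc)
    hence "(\<lambda>n. ennreal (exp (- (1 / real (Suc n)) * x\<^sup>2))) \<longlonglongrightarrow> (SUP n. ennreal (exp (- (1 / real (Suc n)) * x\<^sup>2)))"
      by (rule LIMSEQ_SUP)
    moreover have "(\<lambda>n. exp (- (1 / real (Suc n)) * x\<^sup>2)) \<longlonglongrightarrow> exp (- 0 * x\<^sup>2)"
      by (intro tendsto_intros LIMSEQ_Suc lim_1_over_n)
    hence "(\<lambda>n. ennreal (exp (- (1 / real (Suc n)) * x\<^sup>2))) \<longlonglongrightarrow> ennreal 1"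
      by (intro tendsto_ennrealI) simp
    ultimately show ?thesis using LIMSEQ_unique by fastforce
  qed
  have "(\<integral>\<^sup>+x. h x \<partial>M) = (\<integral>\<^sup>+x. (SUP n. ennreal (exp (- (1 / real (Suc n)) * x\<^sup>2)) * h x) \<partial>M)"
    by (simp only: SUP_mult_right_ennreal[symmetric] S mult_1)
  also have "\<dots> = (SUP n. (\<integral>\<^sup>+x. ennreal (exp (- (1 / real (Suc n)) * x\<^sup>2)) * h x \<partial>M))"
  proof (rule nn_integral_monotone_convergence_SUP)
    show "incseq (\<lambda>n x. ennreal (exp (- (1 / real (Suc n)) * x\<^sup>2)) * h x)"
      by (intro incseq_SucI le_funI mult_right_mono inc zero_le)
    show "(\<lambda>x. ennreal (exp (- (1 / real (Suc n)) * x\<^sup>2)) * h x) \<in> borel_measurable M" for n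
    proof -
      have "(\<lambda>x. ennreal (exp (- (1 / real (Suc n)) * x\<^sup>2))) \<in> borel_measurable borel" by measurable
      hence "(\<lambda>x. ennreal (exp (- (1 / real (Suc n)) * x\<^sup>2))) \<in> borel_measurable M"
        by (simp only: measurable_cong_sets[OF sM refl])
      thus ?thesis by (intro borel_measurable_times_ennreal hm)
    qed
  qed
  also have "\<dots> \<le> B" by (intro SUP_least B) auto
  finally show ?thesis .
qed

text \<open>
  Schur test: after Gaussian damping, the kernel \<open>k\<close> of the operator composed with its adjoint is nonnegative,
  and its row integrals do not depend on the damping.
\<close>

lemma hankel_L2:
  assumes a: "a \<ge> 0" and m: "m = (a + 1) / 2" and \<theta>: "\<theta> > 0" and f: "integrable (wt_meas a) f"
  shows "(\<integral>\<^sup>+x. ennreal ((norm (\<integral>y. complex_of_real (jb m (\<theta> * x * y)) * f y \<partial>wt_meas a))\<^sup>2) \<partial>wt_meas a)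
    \<le> ennreal (4 powr (m - 1) * \<theta> powr (- (2 * m))) * (\<integral>\<^sup>+y. ennreal ((norm (f y))\<^sup>2) \<partial>wt_meas a)"
proof (rule nn_integral_gauss_limit)
  have fm [measurable]: "f \<in> borel_measurable borel"
    using borel_measurable_integrable[OF f] by (simp add: measurable_cong_sets[OF sets_wt_meas refl])
  interpret W: sigma_finite_measure "wt_meas a" by (rule sigma_finite_wt_meas)
  interpret WW: pair_sigma_finite "wt_meas a" "wt_meas a" ..
  have m0: "m \<ge> 1/2" "m > 0" using a m by auto
  have am: "a > -1" using a by simp
  have "Gamma m > 0" using m0 by (intro Gamma_real_pos) auto
  hence Gp: "Gamma m \<noteq> 0" by linarith
  show "(\<lambda>x. ennreal ((norm (\<integral>y. complex_of_real (jb m (\<theta> * x * y)) * f y \<partial>wt_meas a))\<^sup>2)) \<in> borel_measurable (wt_meas a)"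
    by measurable
  show "sets (wt_meas a) = sets borel" by simp
  fix \<delta> :: real assume \<delta>: "\<delta> > 0"
  \<comment> \<open>Weber's value at X = -(\<theta> y)^2 / 4 and Y = -(\<theta> z)^2 / 4. Both are
    nonpositive, so X Y >= 0 and \<open>clif\<close> is evaluated where all its terms are
    nonnegative.\<close>
  define k where "k y z = \<delta> powr (- m) / 2 * (exp (- (\<theta>\<^sup>2 * (y\<^sup>2 + z\<^sup>2) / (4 * \<delta>))) * clif m (\<theta> ^ 4 * y\<^sup>2 * z\<^sup>2 / (16 * \<delta>\<^sup>2)))" for y z
  have km [measurable]: "(\<lambda>z. k (fst z) (snd z)) \<in> borel_measurable (borel \<Otimes>\<^sub>M borel)" unfolding k_def by measurable
  have k0: "k y z \<ge> 0" for y z unfolding k_def using m0 \<delta> \<theta> by (intro mult_nonneg_nonneg clif_nonneg) auto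
  have kw: "has_bochner_integral (wt_meas a) (\<lambda>x. exp (- \<delta> * x\<^sup>2) * (jb m (\<theta> * x * y) * jb m (\<theta> * x * z))) (k y z)" for y z
  proof -
    define X where "X = - (\<theta>\<^sup>2 * y\<^sup>2 / 4)"
    define Y where "Y = - (\<theta>\<^sup>2 * z\<^sup>2 / 4)"
    have e: "jb m (\<theta> * x * y) = clif m (X * x\<^sup>2)" "jb m (\<theta> * x * z) = clif m (Y * x\<^sup>2)" for x
      by (simp_all add: jb_def X_def Y_def power_mult_distrib mult_ac)
    have 1: "(X + Y) / \<delta> = - (\<theta>\<^sup>2 * (y\<^sup>2 + z\<^sup>2) / (4 * \<delta>))" using \<delta> by (simp add: X_def Y_def field_simps)
    have 2: "X * Y / \<delta>\<^sup>2 = \<theta> ^ 4 * y\<^sup>2 * z\<^sup>2 / (16 * \<delta>\<^sup>2)" using \<delta> by (simp add: X_def Y_def field_simps power4_eq_xxxx power2_eq_square)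
    show ?thesis unfolding e k_def using weber_real[OF \<delta> am m, of X Y] unfolding 1 2 .
  qed
  have kint: "(\<integral>\<^sup>+z. ennreal (k y z) \<partial>wt_meas a) = ennreal (4 powr (m - 1) * \<theta> powr (- (2 * m)))" for y
  proof -
    define p where "p = \<theta>\<^sup>2 / (4 * \<delta>)"
    have p: "p > 0" using \<theta> \<delta> by (simp add: p_def)
    \<comment> \<open>The row integral is again Weber's, with the constant
      \<open>clif m 0 = 1 / Gamma m\<close> as second factor. The resulting exp(X / p) = exp(p y^2)
      cancels the Gaussian in y, and \<delta>^(-m) p^(-m) = (\<theta>^2 / 4)^(-m), so \<delta> drops
      out.\<close>
    define X where "X = \<theta> ^ 4 * y\<^sup>2 / (16 * \<delta>\<^sup>2)"
    define c where "c = \<delta> powr (- m) / 2 * exp (- (p * y\<^sup>2)) * Gamma m"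
    have "has_bochner_integral (wt_meas a) (\<lambda>z. c * (exp (- p * z\<^sup>2) * (clif m (X * z\<^sup>2) * clif m (0 * z\<^sup>2))))
      (c * (p powr (- m) / 2 * (exp ((X + 0) / p) * clif m (X * 0 / p\<^sup>2))))"
      by (intro has_bochner_integral_mult_right weber_real p am m)
    also have "(\<lambda>z. c * (exp (- p * z\<^sup>2) * (clif m (X * z\<^sup>2) * clif m (0 * z\<^sup>2)))) = k y"
    proof
      fix z
      have "exp (- (\<theta>\<^sup>2 * (y\<^sup>2 + z\<^sup>2) / (4 * \<delta>))) = exp (- (p * y\<^sup>2)) * exp (- p * z\<^sup>2)"
        using \<delta> by (simp add: p_def exp_add[symmetric] field_simps)
      moreover have "\<theta> ^ 4 * y\<^sup>2 * z\<^sup>2 / (16 * \<delta>\<^sup>2) = X * z\<^sup>2" by (simp add: X_def)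
      ultimately show "c * (exp (- p * z\<^sup>2) * (clif m (X * z\<^sup>2) * clif m (0 * z\<^sup>2))) = k y z"
        using Gp m0 by (simp add: k_def c_def clif_0)
    qed
    also have "c * (p powr (- m) / 2 * (exp ((X + 0) / p) * clif m (X * 0 / p\<^sup>2))) = 4 powr (m - 1) * \<theta> powr (- (2 * m))"
    proof -
      have "X / p = p * y\<^sup>2" using \<theta> \<delta> by (simp add: X_def p_def field_simps power4_eq_xxxx power2_eq_square)
      hence "c * (p powr (- m) / 2 * (exp ((X + 0) / p) * clif m (X * 0 / p\<^sup>2))) = \<delta> powr (- m) * p powr (- m) / 4 * (exp (- (p * y\<^sup>2)) * exp (p * y\<^sup>2))"
        using Gp m0 by (simp add: c_def clif_0)
      also have "exp (- (p * y\<^sup>2)) * exp (p * y\<^sup>2) = 1" by (simp flip: exp_add)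
      also have "\<delta> powr (- m) * p powr (- m) = (\<theta>\<^sup>2 / 4) powr (- m)"
        using \<delta> p by (simp only: powr_mult[symmetric]) (simp add: p_def)
      also have "\<dots> = (\<theta> powr 2) powr (- m) / 4 powr (- m)" using \<theta> by (simp add: powr_divide)
      also have "\<dots> / 4 * 1 = 4 powr (m - 1) * \<theta> powr (- (2 * m))"
      proof -
        have "(\<theta> powr 2) powr (- m) = \<theta> powr (- (2 * m))" by (simp add: powr_powr)
        moreover have "4 powr (m - 1) = 4 powr m / (4::real)" by (simp add: powr_diff)
        moreover have "4 powr (- m) = 1 / (4::real) powr m" by (rule powr_minus_divide)
        ultimately show ?thesis by (simp only:) (simp add: field_simps)
      qed
      finally show ?thesis .
    qed
    finally have hb: "has_bochner_integral (wt_meas a) (k y) (4 powr (m - 1) * \<theta> powr (- (2 * m)))" .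
    have "(\<integral>\<^sup>+z. ennreal (k y z) \<partial>wt_meas a) = ennreal (\<integral>z. k y z \<partial>wt_meas a)"
      by (rule nn_integral_eq_integral[OF integrable.intros[OF hb]]) (simp add: k0)
    thus ?thesis by (simp only: has_bochner_integral_integral_eq[OF hb])
  qed
  \<comment> \<open>The damping is absorbed into the measure, which becomes finite as
    \<open>nn_integral_square_le_double\<close> requires.\<close>
  define \<Omega> where "\<Omega> = density (wt_meas a) (\<lambda>x. ennreal (exp (- \<delta> * x\<^sup>2)))"
  have sO [measurable_cong]: "sets \<Omega> = sets borel" by (simp add: \<Omega>_def)
  have fO: "finite_measure \<Omega>"
  proof (rule finite_measureI)
    have "emeasure \<Omega> (space \<Omega>) = (\<integral>\<^sup>+x. ennreal (exp (- \<delta> * x\<^sup>2)) \<partial>wt_meas a)"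
      unfolding \<Omega>_def by (subst emeasure_density) auto
    also have "\<dots> < top" using gauss_moment_nn[OF \<delta> am m, of 0] by simp
    finally show "emeasure \<Omega> (space \<Omega>) \<noteq> \<infinity>" by simp
  qed
  define \<kappa> where "\<kappa> x y = complex_of_real (jb m (\<theta> * x * y)) * f y" for x y
  have \<kappa>m [measurable]: "(\<lambda>z. \<kappa> (fst z) (snd z)) \<in> borel_measurable (borel \<Otimes>\<^sub>M borel)" unfolding \<kappa>_def by measurable
  have [measurable]: "k y \<in> borel_measurable borel" "(\<lambda>z. k z y) \<in> borel_measurable borel" for y unfolding k_def by measurable
  have [measurable]: "(\<lambda>x. \<kappa> x y) \<in> borel_measurable borel" for y unfolding \<kappa>_def by measurable
  have inner: "(\<integral>x. \<kappa> x y * cnj (\<kappa> x z) \<partial>\<Omega>) = complex_of_real (k y z) * (f y * cnj (f z))" for y z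
  proof -
    have "(\<integral>x. \<kappa> x y * cnj (\<kappa> x z) \<partial>\<Omega>) = (\<integral>x. exp (- \<delta> * x\<^sup>2) *\<^sub>R (\<kappa> x y * cnj (\<kappa> x z)) \<partial>wt_meas a)"
      unfolding \<Omega>_def by (subst integral_density) auto
    also have "\<dots> = (\<integral>x. complex_of_real (exp (- \<delta> * x\<^sup>2) * (jb m (\<theta> * x * y) * jb m (\<theta> * x * z))) * (f y * cnj (f z)) \<partial>wt_meas a)"
      by (intro Bochner_Integration.integral_cong) (auto simp: \<kappa>_def scaleR_conv_of_real mult_ac)
    also have "\<dots> = complex_of_real (k y z) * (f y * cnj (f z))"
      using has_bochner_integral_of_real[OF kw[of y z], where ?'a = complex] by (simp add: has_bochner_integral_iff del: of_real_mult)
    finally show ?thesis .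
  qed
  have "(\<integral>\<^sup>+x. ennreal (exp (- \<delta> * x\<^sup>2)) * ennreal ((norm (\<integral>y. \<kappa> x y \<partial>wt_meas a))\<^sup>2) \<partial>wt_meas a) = (\<integral>\<^sup>+x. ennreal ((norm (\<integral>y. \<kappa> x y \<partial>wt_meas a))\<^sup>2) \<partial>\<Omega>)"
    unfolding \<Omega>_def \<kappa>_def by (subst nn_integral_density) auto
  also have "\<dots> \<le> (\<integral>\<^sup>+y. (\<integral>\<^sup>+z. ennreal (norm (\<integral>x. \<kappa> x y * cnj (\<kappa> x z) \<partial>\<Omega>)) \<partial>wt_meas a) \<partial>wt_meas a)"
  proof (rule nn_integral_square_le_double[OF fO sigma_finite_wt_meas])
    show "case_prod \<kappa> \<in> borel_measurable (\<Omega> \<Otimes>\<^sub>M wt_meas a)"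
      using \<kappa>m by (simp add: case_prod_beta' cong: measurable_cong_sets sets_pair_measure_cong)
    show "integrable (wt_meas a) (\<lambda>y. (1 / Gamma m) * norm (f y))" using f by auto
    show "norm (\<kappa> y p) \<le> (1 / Gamma m) * norm (f p)" for y p
      using jb_bound[OF m0(1)] by (simp add: \<kappa>_def norm_mult mult_right_mono del: times_divide_eq_left)
  qed
  also have "\<dots> = (\<integral>\<^sup>+y. (\<integral>\<^sup>+z. ennreal (k y z * (norm (f y) * norm (f z))) \<partial>wt_meas a) \<partial>wt_meas a)"
    unfolding inner using k0 by (simp add: norm_mult)
  \<comment> \<open>Symmetric form of Schur's test: 2 |f y| |f z| <= |f y|^2 + |f z|^2. By symmetry
    of \<open>k\<close> the two halves have equal integrals, and the row integral factors
    out.\<close>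
  also have "\<dots> \<le> (\<integral>\<^sup>+y. (\<integral>\<^sup>+z. ennreal (1/2) * (ennreal (k y z) * ennreal ((norm (f y))\<^sup>2)) + ennreal (1/2) * (ennreal (k z y) * ennreal ((norm (f z))\<^sup>2)) \<partial>wt_meas a) \<partial>wt_meas a)"
  proof (intro nn_integral_mono)
    fix y z
    have ksym: "k z y = k y z" by (simp add: k_def add.commute mult_ac)
    have "2 * (norm (f y) * norm (f z)) \<le> (norm (f y))\<^sup>2 + (norm (f z))\<^sup>2"
      using sum_squares_bound[of "norm (f y)" "norm (f z)"] by simp
    hence "k y z * (norm (f y) * norm (f z)) \<le> k y z * (((norm (f y))\<^sup>2 + (norm (f z))\<^sup>2) / 2)"
      using k0 by (intro mult_left_mono) auto
    also have "\<dots> = 1/2 * (k y z * (norm (f y))\<^sup>2) + 1/2 * (k z y * (norm (f z))\<^sup>2)"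
      by (simp add: ksym field_simps)
    finally have "ennreal (k y z * (norm (f y) * norm (f z))) \<le> ennreal (1/2 * (k y z * (norm (f y))\<^sup>2) + 1/2 * (k z y * (norm (f z))\<^sup>2))"
      by (rule ennreal_leI)
    also have "\<dots> = ennreal (1/2) * (ennreal (k y z) * ennreal ((norm (f y))\<^sup>2)) + ennreal (1/2) * (ennreal (k z y) * ennreal ((norm (f z))\<^sup>2))"
    proof -
      have e: "ennreal (1/2 * (u * v)) = ennreal (1/2) * (ennreal u * ennreal v)" if "u \<ge> 0" "v \<ge> 0" for u v
      proof -
        have "ennreal (1/2 * (u * v)) = ennreal (1/2) * ennreal (u * v)" by (rule ennreal_mult) (use that in auto)
        also have "ennreal (u * v) = ennreal u * ennreal v" by (rule ennreal_mult) (use that in auto)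
        finally show ?thesis .
      qed
      show ?thesis by (subst ennreal_plus) (use k0 in \<open>auto simp only: e zero_le_power2 intro!: mult_nonneg_nonneg\<close>)
    qed
    finally show "ennreal (k y z * (norm (f y) * norm (f z))) \<le> ennreal (1/2) * (ennreal (k y z) * ennreal ((norm (f y))\<^sup>2)) + ennreal (1/2) * (ennreal (k z y) * ennreal ((norm (f z))\<^sup>2))" .
  qed
  also have "\<dots> = (\<integral>\<^sup>+y. ennreal (1/2) * (\<integral>\<^sup>+z. ennreal (k y z) * ennreal ((norm (f y))\<^sup>2) \<partial>wt_meas a) + ennreal (1/2) * (\<integral>\<^sup>+z. ennreal (k z y) * ennreal ((norm (f z))\<^sup>2) \<partial>wt_meas a) \<partial>wt_meas a)"
    by (subst nn_integral_add, measurable, subst (1 2) nn_integral_cmult, measurable)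
  also have "\<dots> = ennreal (1/2) * (\<integral>\<^sup>+y. (\<integral>\<^sup>+z. ennreal (k y z) * ennreal ((norm (f y))\<^sup>2) \<partial>wt_meas a) \<partial>wt_meas a) + ennreal (1/2) * (\<integral>\<^sup>+y. (\<integral>\<^sup>+z. ennreal (k z y) * ennreal ((norm (f z))\<^sup>2) \<partial>wt_meas a) \<partial>wt_meas a)"
    by (subst nn_integral_add, unfold k_def, measurable, subst (1 2) nn_integral_cmult, measurable)
  also have "(\<integral>\<^sup>+y. (\<integral>\<^sup>+z. ennreal (k z y) * ennreal ((norm (f z))\<^sup>2) \<partial>wt_meas a) \<partial>wt_meas a) = (\<integral>\<^sup>+y. (\<integral>\<^sup>+z. ennreal (k y z) * ennreal ((norm (f y))\<^sup>2) \<partial>wt_meas a) \<partial>wt_meas a)"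
    by (rule WW.Fubini') (unfold k_def, measurable)
  also have "(\<integral>\<^sup>+y. (\<integral>\<^sup>+z. ennreal (k y z) * ennreal ((norm (f y))\<^sup>2) \<partial>wt_meas a) \<partial>wt_meas a) = ennreal (4 powr (m - 1) * \<theta> powr (- (2 * m))) * (wsq a f)" (is "_ = ?B")
    by (simp add: nn_integral_multc kint nn_integral_cmult)
  also have "ennreal (1/2) * ?B + ennreal (1/2) * ?B = ?B"
  proof -
    have "ennreal (1/2) + ennreal (1/2) = 1" by (subst ennreal_plus[symmetric]) auto
    thus ?thesis by (simp only: distrib_right[symmetric] mult_1)
  qed
  finally show "(\<integral>\<^sup>+x. ennreal (exp (- \<delta> * x\<^sup>2)) * ennreal ((norm (\<integral>y. complex_of_real (jb m (\<theta> * x * y)) * f y \<partial>wt_meas a))\<^sup>2) \<partial>wt_meas a) \<le> ?B"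
    by (simp add: \<kappa>_def)
qed


section \<open>The Schroedinger kernel and its dispersive bound\<close>

lemma cis_measurable [measurable (raw)]:
  assumes [measurable]: "f \<in> borel_measurable M"
  shows "(\<lambda>x. cis (f x)) \<in> borel_measurable M"
proof -
  have "cis \<in> borel_measurable borel" by (intro borel_measurable_continuous_onI continuous_intros)
  thus ?thesis by measurable
qed

text \<open>
  Unlike \<open>Skernel\<close>, with which it agrees for \<open>x, y > 0\<close> and \<open>t \<noteq> 0\<close>, this kernel satisfies its bounds and
  symmetries for all real arguments; at \<open>t = 0\<close> it vanishes because \<open>0 powr b = 0\<close>.
\<close>

definition kern :: "real \<Rightarrow> real \<Rightarrow> real \<Rightarrow> real \<Rightarrow> complex" where
  "kern a t x y = cis (- sgn t * (a + 1) * pi / 4) * cis ((x\<^sup>2 + y\<^sup>2) / (4 * t)) *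
     of_real ((2 * \<bar>t\<bar>) powr (- ((a + 1) / 2)) * 2 powr (1 - (a + 1) / 2) * jb ((a + 1) / 2) (x * y / (2 * \<bar>t\<bar>)))"

lemma kern_measurable [measurable (raw)]:
  assumes [measurable]: "f \<in> borel_measurable M" "g \<in> borel_measurable M" "h \<in> borel_measurable M"
  shows "(\<lambda>z. kern a (f z) (g z) (h z)) \<in> borel_measurable M"
  unfolding kern_def sgn_if by measurable

lemma besselJ_eq_jb:
  assumes "m > 0" "z > 0"
  shows "besselJ (m - 1) z = (z / 2) powr (m - 1) * jb m z"
proof -
  have "(\<lambda>k. (z / 2) powr (m - 1) * ((1 / (fact k * Gamma (real k + m))) *\<^sub>R (- (z\<^sup>2) / 4) ^ k)) sums ((z / 2) powr (m - 1) * jb m z)"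
    unfolding jb_def by (intro sums_mult clif_sums assms)
  moreover have "(z / 2) powr (m - 1) * ((1 / (fact k * Gamma (real k + m))) *\<^sub>R (- (z\<^sup>2) / 4) ^ k) =
    (-1) ^ k / (fact k * Gamma (real k + (m - 1) + 1)) * (z / 2) powr (2 * real k + (m - 1))" for k
  proof -
    have "(z / 2) powr (2 * real k) = (z / 2) ^ (2 * k)"
      using assms powr_realpow[of "z / 2" "2 * k"] by simp
    also have "\<dots> = (z\<^sup>2 / 4) ^ k" by (simp add: power_mult power_divide)
    finally have "(z / 2) powr (2 * real k + (m - 1)) = (z\<^sup>2 / 4) ^ k * (z / 2) powr (m - 1)"
      by (simp only: powr_add)
    moreover have "(- (z\<^sup>2) / 4) ^ k = (-1) ^ k * (z\<^sup>2 / 4) ^ k"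
      by (simp flip: power_mult_distrib)
    moreover have "real k + (m - 1) + 1 = real k + m" by simp
    ultimately show ?thesis by (simp only: real_scaleR_def) (simp add: mult_ac)
  qed
  ultimately have "(\<lambda>k. (-1) ^ k / (fact k * Gamma (real k + (m - 1) + 1)) * (z / 2) powr (2 * real k + (m - 1))) sums ((z / 2) powr (m - 1) * jb m z)"
    by (simp only:)
  thus ?thesis unfolding besselJ_def by (rule sums_unique[symmetric])
qed

lemma Skernel_eq_kern:
  assumes a: "a \<ge> 0" and "x > 0" "y > 0" "t \<noteq> 0"
  shows "Skernel a x y t = kern a t x y"
proof -
  define m where "m = (a + 1) / 2"
  define u where "u = x * y / (2 * \<bar>t\<bar>)"
  have m: "m > 0" using a by (simp add: m_def)
  have u: "u > 0" using assms by (simp add: u_def)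
  have e: "(1 - a) / 2 = - (m - 1)" "(a - 1) / 2 = m - 1" by (simp_all add: m_def field_simps)
  \<comment> \<open>The powers of u from the kernel and from the Bessel function cancel; what
    survives is the constant 2^(1-m) in \<open>kern\<close>.\<close>
  have "u powr (- (m - 1)) * (u / 2) powr (m - 1) = 2 powr (1 - m)"
    using u by (simp add: powr_divide powr_minus powr_diff field_simps)
  hence J: "u powr ((1 - a) / 2) * besselJ ((a - 1) / 2) u = 2 powr (1 - m) * jb m u"
    unfolding e besselJ_eq_jb[OF m u] by (metis mult.assoc)
  have p: "z / complex_of_real ((2 * \<bar>t\<bar>) powr m) = z * of_real ((2 * \<bar>t\<bar>) powr (- m))" for z
    by (simp add: powr_minus divide_inverse)
  show ?thesis
  proof (cases "t > 0")
    case True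
    have "Skernel a x y t = cis (- (a + 1) * pi / 4) * of_real ((2 * \<bar>t\<bar>) powr (- m)) * of_real (2 powr (1 - m) * jb m u) * cis ((x\<^sup>2 + y\<^sup>2) / (4 * \<bar>t\<bar>))"
      using True unfolding Skernel_def u_def[symmetric] J m_def[symmetric] p by simp
    thus ?thesis using True by (simp add: kern_def m_def u_def mult_ac)
  next
    case False
    have "Skernel a x y t = cis ((a + 1) * pi / 4) * of_real ((2 * \<bar>t\<bar>) powr (- m)) * of_real (2 powr (1 - m) * jb m u) * cis (- (x\<^sup>2 + y\<^sup>2) / (4 * \<bar>t\<bar>))"
      using False unfolding Skernel_def u_def[symmetric] J m_def[symmetric] p by simp
    moreover have "- (x\<^sup>2 + y\<^sup>2) / (4 * \<bar>t\<bar>) = (x\<^sup>2 + y\<^sup>2) / (4 * t)" "sgn t = -1" using False assms(4) by (auto simp: field_simps)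
    ultimately show ?thesis by (simp add: kern_def m_def u_def mult_ac)
  qed
qed

text \<open>With 2m = a + 1, the factor 2^(-m) from (2|t|)^(-m) and the factor 2^(1-m) of the kernel
  combine to 2^(-a); \<open>1 / Gamma m\<close> is the bound of \<open>jb\<close>.\<close>

definition disp_const :: "real \<Rightarrow> real" where
  "disp_const a = 2 powr (- a) / Gamma ((a + 1) / 2)"

lemma disp_const_pos: "a \<ge> 0 \<Longrightarrow> disp_const a > 0"
  unfolding disp_const_def by (intro divide_pos_pos Gamma_real_pos) auto

lemma norm_kern_le:
  assumes "a \<ge> 0"
  shows "norm (kern a t x y) \<le> disp_const a * \<bar>t\<bar> powr (- ((a + 1) / 2))"
proof -
  define m where "m = (a + 1) / 2"
  have "norm (kern a t x y) = (2 * \<bar>t\<bar>) powr (- m) * 2 powr (1 - m) * \<bar>jb m (x * y / (2 * \<bar>t\<bar>))\<bar>"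
    by (simp add: kern_def norm_mult m_def abs_mult)
  also have "\<dots> \<le> (2 * \<bar>t\<bar>) powr (- m) * 2 powr (1 - m) * (1 / Gamma m)"
    using assms by (intro mult_left_mono jb_bound) (auto simp: m_def)
  also have "(2 * \<bar>t\<bar>) powr (- m) * 2 powr (1 - m) = 2 powr (- m + (1 - m)) * \<bar>t\<bar> powr (- m)"
    by (simp only: powr_mult abs_ge_zero powr_add) (simp add: powr_mult mult_ac)
  also have "- m + (1 - m) = - a" by (simp add: m_def field_simps)
  finally show ?thesis by (simp add: disp_const_def m_def)
qed

lemma kern_commute: "kern a t x y = kern a t y x"
  by (simp add: kern_def add.commute mult.commute)

lemma cnj_kern: "cnj (kern a t x y) = kern a (- t) x y"
  by (simp add: kern_def cis_cnj sgn_minus)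

section \<open>The propagator on the weighted line\<close>

definition schr :: "real \<Rightarrow> real \<Rightarrow> (real \<Rightarrow> complex) \<Rightarrow> real \<Rightarrow> complex" where
  "schr a t f x = (\<integral>y. kern a t x y * f y \<partial>wt_meas a)"

lemma measurable_wt_meas: "borel_measurable (wt_meas a) = borel_measurable borel"
  by (rule measurable_cong_sets) auto

lemma schr_measurable [measurable]:
  assumes [measurable]: "f \<in> borel_measurable borel"
  shows "schr a t f \<in> borel_measurable borel"
proof -
  interpret W: sigma_finite_measure "wt_meas a" by (rule sigma_finite_wt_meas)
  show ?thesis unfolding schr_def by measurable
qed

lemma norm_schr_le:
  assumes a: "a \<ge> 0" and f: "integrable (wt_meas a) f"
  shows "ennreal (norm (schr a t f x)) \<le> ennreal (disp_const a * \<bar>t\<bar> powr (- ((a + 1) / 2))) * (\<integral>\<^sup>+y. ennreal (norm (f y)) \<partial>wt_meas a)"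
proof -
  have [measurable]: "f \<in> borel_measurable borel" using borel_measurable_integrable[OF f] by (simp add: measurable_wt_meas)
  have "ennreal (norm (schr a t f x)) \<le> (\<integral>\<^sup>+y. ennreal (norm (kern a t x y * f y)) \<partial>wt_meas a)"
    unfolding schr_def by (rule norm_integral_le_nn_integral)
  also have "\<dots> \<le> (\<integral>\<^sup>+y. ennreal (disp_const a * \<bar>t\<bar> powr (- ((a + 1) / 2))) * ennreal (norm (f y)) \<partial>wt_meas a)"
    using norm_kern_le[OF a] disp_const_pos[OF a]
    by (intro nn_integral_mono) (auto simp: norm_mult ennreal_mult'[symmetric] intro!: ennreal_leI mult_right_mono)
  also have "\<dots> = ennreal (disp_const a * \<bar>t\<bar> powr (- ((a + 1) / 2))) * (\<integral>\<^sup>+y. ennreal (norm (f y)) \<partial>wt_meas a)"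
    by (subst nn_integral_cmult) auto
  finally show ?thesis .
qed

text \<open>The chirp in y is moved onto f and the chirp in x has modulus one, which leaves a Hankel
  transform with \<theta> = 1 / (2|t|). Its constant and the prefactor \<open>c\<close> cancel
  exactly, so the propagator contracts.\<close>

lemma schr_L2:
  assumes a: "a \<ge> 0" and t: "t \<noteq> 0" and f: "integrable (wt_meas a) f"
  shows "(wsq a (schr a t f)) \<le> (wsq a f)"
proof -
  have fm [measurable]: "f \<in> borel_measurable borel" using borel_measurable_integrable[OF f] by (simp add: measurable_wt_meas)
  interpret W: sigma_finite_measure "wt_meas a" by (rule sigma_finite_wt_meas)
  define m where "m = (a + 1) / 2"
  define \<theta> where "\<theta> = 1 / (2 * \<bar>t\<bar>)"
  define c where "c = (2 * \<bar>t\<bar>) powr (- m) * 2 powr (1 - m)"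
  define g where "g y = cis (y\<^sup>2 / (4 * t)) * f y" for y
  have \<theta>: "\<theta> > 0" using t by (simp add: \<theta>_def)
  have gm [measurable]: "g \<in> borel_measurable borel" unfolding g_def by measurable
  have ng: "norm (g y) = norm (f y)" for y by (simp add: g_def norm_mult)
  have gi: "integrable (wt_meas a) g"
    by (rule Bochner_Integration.integrable_bound[OF f]) (auto simp: ng measurable_wt_meas)
  have e: "norm (schr a t f x) = c * norm (\<integral>y. complex_of_real (jb m (\<theta> * x * y)) * g y \<partial>wt_meas a)" for x
  proof -
    define z where "z = cis (- sgn t * (a + 1) * pi / 4) * cis (x\<^sup>2 / (4 * t)) * of_real c"
    have "kern a t x y * f y = z * (complex_of_real (jb m (\<theta> * x * y)) * g y)" for y
      by (simp add: kern_def z_def c_def m_def g_def \<theta>_def add_divide_distrib cis_mult[symmetric] mult_ac)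
    hence "schr a t f x = z * (\<integral>y. complex_of_real (jb m (\<theta> * x * y)) * g y \<partial>wt_meas a)"
      unfolding schr_def by simp
    moreover have "norm z = c" by (simp add: z_def norm_mult c_def)
    ultimately show ?thesis by (simp add: norm_mult)
  qed
  have "(wsq a (schr a t f)) = (\<integral>\<^sup>+x. ennreal (c\<^sup>2) * ennreal ((norm (\<integral>y. complex_of_real (jb m (\<theta> * x * y)) * g y \<partial>wt_meas a))\<^sup>2) \<partial>wt_meas a)"
    unfolding e by (simp add: power_mult_distrib ennreal_mult)
  also have "\<dots> = ennreal (c\<^sup>2) * (\<integral>\<^sup>+x. ennreal ((norm (\<integral>y. complex_of_real (jb m (\<theta> * x * y)) * g y \<partial>wt_meas a))\<^sup>2) \<partial>wt_meas a)"
    by (rule nn_integral_cmult) measurable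
  also have "\<dots> \<le> ennreal (c\<^sup>2) * (ennreal (4 powr (m - 1) * \<theta> powr (- (2 * m))) * (wsq a g))"
    by (intro mult_left_mono hankel_L2 a m_def \<theta> gi) auto
  also have "\<dots> = ennreal (c\<^sup>2 * (4 powr (m - 1) * \<theta> powr (- (2 * m)))) * (wsq a g)"
    by (simp add: ennreal_mult mult.assoc)
  also have "c\<^sup>2 * (4 powr (m - 1) * \<theta> powr (- (2 * m))) = 1"
  proof -
    define b where "b = 2 * \<bar>t\<bar>"
    have b: "b > 0" using t by (simp add: b_def)
    have "\<theta> powr (- (2 * m)) = b powr (2 * m)"
      using b by (simp add: \<theta>_def b_def[symmetric] powr_minus powr_divide)
    moreover have "c\<^sup>2 = b powr (- m + - m) * 2 powr ((1 - m) + (1 - m))"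
      unfolding c_def b_def[symmetric] powr_add by (simp add: power2_eq_square mult_ac)
    moreover have "(4::real) powr (m - 1) = 2 powr ((m - 1) + (m - 1))"
      unfolding powr_add by (simp flip: powr_mult)
    ultimately have "c\<^sup>2 * (4 powr (m - 1) * \<theta> powr (- (2 * m))) = (b powr (- m + - m) * b powr (2 * m)) * (2 powr ((1 - m) + (1 - m)) * 2 powr ((m - 1) + (m - 1)))"
      by simp
    also have "\<dots> = 1" using b by (simp only: powr_add[symmetric]) simp
    finally show ?thesis .
  qed
  finally show ?thesis by (simp add: ng)
qed

text \<open>The exponent bookkeeping shared by a single propagator and by the damped composition:
  the interpolation bound with A = 1 and D = C \<tau>^(-m), after its r-th root. Admissibility is
  what turns m (r - 2) / r into 2 / q.\<close>

lemma wnorm_decay_scaling: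
  fixes U :: "(real \<Rightarrow> complex) \<Rightarrow> real \<Rightarrow> complex"
  assumes a: "a \<ge> 0" and r: "r > 2" and p: "p = r / (r - 1)"
    and M: "\<And>f. integrable (wt_meas a) f \<Longrightarrow> (\<integral>\<^sup>+x. ennreal (norm (U f x) powr r) \<partial>wt_meas a)
      \<le> ennreal (4 * 1 * r / (r - 2) * (2 * (C * \<tau> powr (- ((a + 1) / 2)))) powr (r - 2)) * enn_powr (\<integral>\<^sup>+y. ennreal (norm (f y) powr p) \<partial>wt_meas a) (r - 1)"
    and C: "C > 0" and \<tau>: "\<tau> > 0" and q: "2 / q = (a + 1) * (1/2 - 1/r)" and f: "integrable (wt_meas a) f"
  shows "enn_powr (\<integral>\<^sup>+x. ennreal (norm (U f x) powr r) \<partial>wt_meas a) (1/r) \<le>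
    ennreal ((4 * r / (r - 2) * (2 * C) powr (r - 2)) powr (1/r) * \<tau> powr (- (2/q))) * enn_powr (\<integral>\<^sup>+y. ennreal (norm (f y) powr p) \<partial>wt_meas a) (1/p)"
proof -
  define B where "B = 4 * r / (r - 2) * (2 * C) powr (r - 2)"
  have B: "B > 0" using r C by (simp add: B_def)
  have "- ((a + 1) / 2) * (r - 2) = - (2/q) * r" using r by (simp add: q field_simps)
  hence e: "4 * 1 * r / (r - 2) * (2 * (C * \<tau> powr (- ((a + 1) / 2)))) powr (r - 2) = B * \<tau> powr (- (2/q) * r)"
    using C \<tau> by (simp add: B_def powr_mult powr_powr mult.assoc[symmetric])
  have rp: "(r - 1) * (1/r) = 1/p" using r by (simp add: p)
  have "wnorm a r (U f) \<le> enn_powr (ennreal (B * \<tau> powr (- (2/q) * r)) * enn_powr (\<integral>\<^sup>+y. ennreal (norm (f y) powr p) \<partial>wt_meas a) (r - 1)) (1/r)"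
    using M[OF f] r unfolding e by (intro enn_powr_mono) auto
  also have "\<dots> = ennreal ((B * \<tau> powr (- (2/q) * r)) powr (1/r)) * enn_powr (\<integral>\<^sup>+y. ennreal (norm (f y) powr p) \<partial>wt_meas a) (1/p)"
    using B by (simp only: enn_powr_mult enn_powr_powr rp) simp
  also have "(B * \<tau> powr (- (2/q) * r)) powr (1/r) = B powr (1/r) * \<tau> powr (- (2/q))"
    using B r by (simp add: powr_mult powr_powr)
  finally show ?thesis by (simp add: B_def)
qed

definition decay_const :: "real \<Rightarrow> real \<Rightarrow> real" where
  "decay_const a r = (4 * r / (r - 2) * (2 * disp_const a) powr (r - 2)) powr (1/r)"

lemma decay_const_pos: "a \<ge> 0 \<Longrightarrow> r > 2 \<Longrightarrow> decay_const a r > 0"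
  using disp_const_pos[of a] by (simp add: decay_const_def)

lemma schr_decay:
  assumes a: "a \<ge> 0" and r: "r > 2" and p: "p = r / (r - 1)" and q: "2 / q = (a + 1) * (1/2 - 1/r)"
    and t: "t \<noteq> 0" and f: "integrable (wt_meas a) f"
  shows "wnorm a r (schr a t f) \<le>
    ennreal (decay_const a r * \<bar>t\<bar> powr (- (2/q))) * wnorm a p f"
  unfolding decay_const_def
proof (rule wnorm_decay_scaling[OF a r p _ disp_const_pos[OF a] _ q f])
  show "\<bar>t\<bar> > 0" using t by simp
  fix g :: "real \<Rightarrow> complex" assume g: "integrable (wt_meas a) g"
  show "(\<integral>\<^sup>+x. ennreal (norm (schr a t g x) powr r) \<partial>wt_meas a)
      \<le> ennreal (4 * 1 * r / (r - 2) * (2 * (disp_const a * \<bar>t\<bar> powr (- ((a + 1) / 2)))) powr (r - 2)) * enn_powr (\<integral>\<^sup>+y. ennreal (norm (g y) powr p) \<partial>wt_meas a) (r - 1)"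
    unfolding schr_def
  proof (rule marcinkiewicz_1_inf_2_2[OF sigma_finite_wt_meas sigma_finite_wt_meas _ _ _ _ _ r p g])
    show "case_prod (kern a t) \<in> borel_measurable (wt_meas a \<Otimes>\<^sub>M wt_meas a)" by measurable
    show "norm (kern a t x y) \<le> disp_const a * \<bar>t\<bar> powr (- ((a + 1) / 2))" for x y by (rule norm_kern_le[OF a])
    show "disp_const a * \<bar>t\<bar> powr (- ((a + 1) / 2)) > 0" using disp_const_pos[OF a] t by simp
    show "(\<integral>\<^sup>+x. ennreal ((norm (\<integral>y. kern a t x y * h y \<partial>wt_meas a))\<^sup>2) \<partial>wt_meas a) \<le> ennreal 1 * (wsq a h)"
      if "integrable (wt_meas a) h" for h
      using schr_L2[OF a t that] by (simp add: schr_def)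
  qed simp
qed


section \<open>Damped composition of two propagators\<close>

lemma norm_weber_value_le:
  assumes \<beta>: "Re \<beta> > 0" and m: "m \<ge> 1/2" and XY: "X = - (b\<^sup>2 / 4)" "Y = - (c\<^sup>2 / 4)"
  shows "norm (exp (of_real (X + Y) / \<beta>) * clif m (of_real (X * Y) / \<beta>\<^sup>2)) \<le> 1 / Gamma m"
proof -
  \<comment> \<open>Chosen so that u^2 / 4 is the argument of \<open>clif\<close>; the absolute
    values make Re u nonnegative.\<close>
  define u where "u = complex_of_real (\<bar>b\<bar> * \<bar>c\<bar> / 2) * (1 / \<beta>)"
  define \<rho> where "\<rho> = Re (1 / \<beta>)"
  have b0: "\<beta> \<noteq> 0" using \<beta> by auto
  have \<rho>: "\<rho> > 0" using \<beta> b0 by (simp add: \<rho>_def Re_divide sum_power2_gt_zero_iff complex_neq_0)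
  have Gp: "Gamma m > 0" using m by (intro Gamma_real_pos) auto
  have "u\<^sup>2 = of_real ((\<bar>b\<bar> * \<bar>c\<bar> / 2)\<^sup>2) / \<beta>\<^sup>2" 
    unfolding u_def power_mult_distrib[of "complex_of_real _"] of_real_power power_divide[of 1] by simp
  also have "(\<bar>b\<bar> * \<bar>c\<bar> / 2)\<^sup>2 = 4 * (X * Y)" by (simp add: XY power_mult_distrib power_divide)
  finally have u: "u\<^sup>2 / 4 = of_real (X * Y) / \<beta>\<^sup>2" by (simp only: of_real_mult of_real_numeral) simp
  have "Re u = (\<bar>b\<bar> * \<bar>c\<bar> / 2) * \<rho>" 
    by (simp only: u_def \<rho>_def times_complex.sel Re_complex_of_real Im_complex_of_real mult_zero_left diff_zero)
  moreover have "(\<bar>b\<bar> * \<bar>c\<bar> / 2) * \<rho> \<ge> 0" using \<rho> by simp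
  ultimately have "\<bar>Re u\<bar> = (\<bar>b\<bar> * \<bar>c\<bar> / 2) * \<rho>" by (simp only: abs_of_nonneg)
  hence "norm (clif m (of_real (X * Y) / \<beta>\<^sup>2)) \<le> exp ((\<bar>b\<bar> * \<bar>c\<bar> / 2) * \<rho>) / Gamma m"
    using norm_clif_le[OF m, of u] unfolding u by (simp only:)
  moreover have "norm (exp (of_real (X + Y) / \<beta>)) = exp ((X + Y) * \<rho>)"
  proof -
    have "of_real (X + Y) / \<beta> = of_real (X + Y) * (1 / \<beta>)" by simp
    thus ?thesis 
      by (simp only: \<rho>_def norm_exp_eq_Re times_complex.sel Re_complex_of_real Im_complex_of_real mult_zero_left diff_zero)
  qed
  ultimately have "norm (exp (of_real (X + Y) / \<beta>) * clif m (of_real (X * Y) / \<beta>\<^sup>2)) \<le> exp ((X + Y) * \<rho>) * (exp ((\<bar>b\<bar> * \<bar>c\<bar> / 2) * \<rho>) / Gamma m)"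
    unfolding norm_mult by (intro mult_mono) auto
  also have "\<dots> = exp ((X + Y) * \<rho> + (\<bar>b\<bar> * \<bar>c\<bar> / 2) * \<rho>) / Gamma m" by (simp add: exp_add)
  \<comment> \<open>Completing the square: the growth exp(|b||c| \<rho> / 2) of \<open>clif\<close>
    is dominated by the Gaussian exp(-(b^2 + c^2) \<rho> / 4), uniformly in b, c and \<rho>.\<close>
  also have "(X + Y) * \<rho> + (\<bar>b\<bar> * \<bar>c\<bar> / 2) * \<rho> = - ((\<bar>b\<bar> - \<bar>c\<bar>)\<^sup>2 / 4 * \<rho>)"
    unfolding XY power2_diff by (simp add: field_simps)
  also have "exp \<dots> / Gamma m \<le> 1 / Gamma m" using \<rho> Gp by (intro divide_right_mono) auto
  finally show ?thesis .
qed

text \<open>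
  The chirps combine with the damping to \<open>exp (-\<beta> y\<^sup>2)\<close> where \<open>Im \<beta> = 1/(4t) - 1/(4s)\<close>, and
  \<open>\<bar>\<beta>\<bar> \<ge> \<bar>t - s\<bar> / (4 \<bar>t\<bar> \<bar>s\<bar>)\<close> turns the prefactors into \<open>\<bar>t - s\<bar> powr (-m)\<close>.
\<close>

lemma norm_damped_kern_le:
  assumes a: "a \<ge> 0" and t: "t \<noteq> 0" "s \<noteq> 0" "t \<noteq> s" and \<delta>: "\<delta> > 0"
  shows "norm (\<integral>y. kern a (- t) x y * (exp (- \<delta> * y\<^sup>2) * kern a s y z) \<partial>wt_meas a) \<le> disp_const a * \<bar>t - s\<bar> powr (- ((a + 1) / 2))"
proof -
  define m where "m = (a + 1) / 2"
  have m: "m \<ge> 1/2" using a by (simp add: m_def)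
  have Gp: "Gamma m > 0" using m by (intro Gamma_real_pos) auto
  define b where "b = x / (2 * \<bar>t\<bar>)"
  define c where "c = z / (2 * \<bar>s\<bar>)"
  define X where "X = - (b\<^sup>2 / 4)"
  define Y where "Y = - (c\<^sup>2 / 4)"
  define \<sigma> where "\<sigma> = 1 / (4 * t) - 1 / (4 * s)"
  define \<beta> where "\<beta> = Complex \<delta> \<sigma>"
  define \<omega> where "\<omega> = cis (- sgn (- t) * (a + 1) * pi / 4) * cis (- sgn s * (a + 1) * pi / 4) * cis (- (x\<^sup>2) / (4 * t)) * cis (z\<^sup>2 / (4 * s))"
  define K where "K = (2 * \<bar>t\<bar>) powr (- m) * 2 powr (1 - m) * ((2 * \<bar>s\<bar>) powr (- m) * 2 powr (1 - m))"
  have w: "norm \<omega> = 1" by (simp add: \<omega>_def norm_mult)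
  have Kp: "K \<ge> 0" by (simp add: K_def)
  have re: "Re \<beta> > 0" using \<delta> by (simp add: \<beta>_def)
  have ex: "exp (- \<beta> * of_real (y\<^sup>2)) = exp (- \<delta> * y\<^sup>2) * cis (- (y\<^sup>2) / (4 * t)) * cis (y\<^sup>2 / (4 * s))" for y
  proof -
    have "- \<beta> * of_real (y\<^sup>2) = of_real (- \<delta> * y\<^sup>2) + \<i> * of_real (- (y\<^sup>2) / (4 * t)) + \<i> * of_real (y\<^sup>2 / (4 * s))"
      by (rule complex_eqI) (simp_all add: \<beta>_def \<sigma>_def field_simps)
    thus ?thesis by (simp only: exp_add cis_conv_exp exp_of_real)
  qed
  have "kern a (- t) x y * (exp (- \<delta> * y\<^sup>2) * kern a s y z) =
    \<omega> * of_real K * (exp (- \<beta> * of_real (y\<^sup>2)) * of_real (clif m (X * y\<^sup>2) * clif m (Y * y\<^sup>2)))" for y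
  proof -
    have j: "jb m (x * y / (2 * \<bar>t\<bar>)) = clif m (X * y\<^sup>2)" "jb m (y * z / (2 * \<bar>s\<bar>)) = clif m (Y * y\<^sup>2)"
      by (simp_all add: jb_def X_def Y_def b_def c_def power_mult_distrib power_divide mult_ac)
    have c1: "cis ((x\<^sup>2 + y\<^sup>2) / (4 * (- t))) = cis (- (x\<^sup>2) / (4 * t)) * cis (- (y\<^sup>2) / (4 * t))"
      by (simp add: cis_mult add_divide_distrib)
    have c2: "cis ((y\<^sup>2 + z\<^sup>2) / (4 * s)) = cis (y\<^sup>2 / (4 * s)) * cis (z\<^sup>2 / (4 * s))"
      by (simp add: cis_mult add_divide_distrib)
    show ?thesis unfolding kern_def m_def[symmetric] abs_minus_cancel j c1 c2 ex \<omega>_def K_def of_real_mult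
      by (simp only: mult_ac)
  qed
  hence "(\<integral>y. kern a (- t) x y * (exp (- \<delta> * y\<^sup>2) * kern a s y z) \<partial>wt_meas a) =
    \<omega> * of_real K * (\<integral>y. exp (- \<beta> * of_real (y\<^sup>2)) * of_real (clif m (X * y\<^sup>2) * clif m (Y * y\<^sup>2)) \<partial>wt_meas a)"
    by (simp only: integral_mult_right_zero)
  also have "(\<integral>y. exp (- \<beta> * of_real (y\<^sup>2)) * of_real (clif m (X * y\<^sup>2) * clif m (Y * y\<^sup>2)) \<partial>wt_meas a) =
    \<beta> powr (- of_real m) / 2 * (exp (of_real (X + Y) / \<beta>) * clif m (of_real (X * Y) / \<beta>\<^sup>2))"
    by (rule has_bochner_integral_integral_eq[OF weber[OF re]]) (use a m_def in auto)
  finally have "norm (\<integral>y. kern a (- t) x y * (exp (- \<delta> * y\<^sup>2) * kern a s y z) \<partial>wt_meas a) =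
    K * (norm (\<beta> powr (- of_real m)) / 2 * norm (exp (of_real (X + Y) / \<beta>) * clif m (of_real (X * Y) / \<beta>\<^sup>2)))"
    using w Kp by (simp only: norm_mult norm_divide norm_of_real) (simp add: w)
  also have "\<dots> \<le> K * ((\<bar>t - s\<bar> / (4 * \<bar>t\<bar> * \<bar>s\<bar>)) powr (- m) / 2 * (1 / Gamma m))"
  proof (intro mult_left_mono mult_mono divide_right_mono Kp)
    have "\<beta> \<noteq> 0" using re by auto
    hence "norm (\<beta> powr (- of_real m)) = norm \<beta> powr (- m)"
      by (simp add: powr_def norm_exp_eq_Re)
    also have "\<dots> \<le> (\<bar>t - s\<bar> / (4 * \<bar>t\<bar> * \<bar>s\<bar>)) powr (- m)"
    proof (rule powr_mono2')
      have "\<bar>t - s\<bar> / (4 * \<bar>t\<bar> * \<bar>s\<bar>) = \<bar>\<sigma>\<bar>"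
      proof -
        have "\<sigma> = - ((t - s) / (4 * t * s))" using t by (simp add: \<sigma>_def field_simps)
        thus ?thesis by (simp add: abs_mult)
      qed
      also have "\<dots> \<le> norm \<beta>" using abs_Im_le_cmod[of \<beta>] by (simp add: \<beta>_def)
      finally show "\<bar>t - s\<bar> / (4 * \<bar>t\<bar> * \<bar>s\<bar>) \<le> norm \<beta>" .
    qed (use t m in auto)
    finally show "norm (\<beta> powr (- of_real m)) \<le> (\<bar>t - s\<bar> / (4 * \<bar>t\<bar> * \<bar>s\<bar>)) powr (- m)" .
    show "norm (exp (of_real (X + Y) / \<beta>) * clif m (of_real (X * Y) / \<beta>\<^sup>2)) \<le> 1 / Gamma m"
      by (rule norm_weber_value_le[OF re m X_def Y_def])
  qed auto
  also have "\<dots> = disp_const a * \<bar>t - s\<bar> powr (- m)"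
  proof -
    \<comment> \<open>The prefactor \<open>K\<close> contains v^(-m), which cancels the v in the
      lower bound |t - s| / v for |\<beta>|. A single power of |t - s| and the constant of one
      propagator remain.\<close>
    define v where "v = 4 * \<bar>t\<bar> * \<bar>s\<bar>"
    have v: "v > 0" using t by (simp add: v_def)
    have "K = ((2 * \<bar>t\<bar>) powr (- m) * (2 * \<bar>s\<bar>) powr (- m)) * (2 powr (1 - m) * 2 powr (1 - m))"
      by (simp only: K_def mult_ac)
    also have "(2 * \<bar>t\<bar>) powr (- m) * (2 * \<bar>s\<bar>) powr (- m) = v powr (- m)"
      by (simp add: v_def mult.assoc flip: powr_mult)
    also have "2 powr (1 - m) * 2 powr (1 - m) = 2 powr (- a) * (2::real)"
    proof -
      have "(1 - m) + (1 - m) = - a + 1" by (simp add: m_def field_simps)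
      hence "2 powr (1 - m) * 2 powr (1 - m) = (2::real) powr (- a + 1)" by (simp only: powr_add[symmetric])
      also have "\<dots> = 2 powr (- a) * 2" by (simp only: powr_add) simp
      finally show ?thesis .
    qed
    finally have "K = v powr (- m) * (2 powr (- a) * 2)" .
    moreover have "(\<bar>t - s\<bar> / v) powr (- m) = \<bar>t - s\<bar> powr (- m) / v powr (- m)"
      using v by (simp add: powr_divide)
    ultimately show ?thesis using v by (simp add: v_def[symmetric] disp_const_def m_def[symmetric])
  qed
  finally show ?thesis by (simp add: m_def)
qed

text \<open>Symmetry of the kernel in x and y makes the bilinear form, without conjugation,
  symmetric. Conjugation is treated apart, by \<open>cnj_schr\<close>, where it reverses
  time.\<close>

lemma schr_symmetric:
  assumes a: "a \<ge> 0" and f: "integrable (wt_meas a) f" and g: "integrable (wt_meas a) g"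
  shows "(\<integral>y. g y * schr a t f y \<partial>wt_meas a) = (\<integral>x. f x * schr a t g x \<partial>wt_meas a)"
proof -
  have [measurable]: "f \<in> borel_measurable borel" "g \<in> borel_measurable borel"
    using borel_measurable_integrable[OF f] borel_measurable_integrable[OF g] by (simp_all add: measurable_wt_meas)
  interpret W: sigma_finite_measure "wt_meas a" by (rule sigma_finite_wt_meas)
  define D where "D = disp_const a * \<bar>t\<bar> powr (- ((a + 1) / 2))"
  have D: "D \<ge> 0" using disp_const_pos[OF a] by (simp add: D_def)
  have "(\<integral>y. g y * schr a t f y \<partial>wt_meas a) = (\<integral>y. (\<integral>x. g y * (kern a t y x * f x) \<partial>wt_meas a) \<partial>wt_meas a)"
    unfolding schr_def by (simp only: integral_mult_right_zero)
  also have "\<dots> = (\<integral>x. (\<integral>y. g y * (kern a t y x * f x) \<partial>wt_meas a) \<partial>wt_meas a)"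
  proof (rule integral_swap[OF sigma_finite_wt_meas sigma_finite_wt_meas])
    show "(\<lambda>(y, x). g y * (kern a t y x * f x)) \<in> borel_measurable (wt_meas a \<Otimes>\<^sub>M wt_meas a)" by measurable
    have "(\<integral>\<^sup>+y. (\<integral>\<^sup>+x. ennreal (norm (g y * (kern a t y x * f x))) \<partial>wt_meas a) \<partial>wt_meas a)
      \<le> (\<integral>\<^sup>+y. (\<integral>\<^sup>+x. ennreal (norm (g y)) * (ennreal D * ennreal (norm (f x))) \<partial>wt_meas a) \<partial>wt_meas a)"
    proof (intro nn_integral_mono)
      fix y x
      have "norm (kern a t y x) * norm (f x) \<le> D * norm (f x)"
        unfolding D_def by (intro mult_right_mono norm_kern_le a) auto
      thus "ennreal (norm (g y * (kern a t y x * f x))) \<le> ennreal (norm (g y)) * (ennreal D * ennreal (norm (f x)))"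
        using D by (simp add: norm_mult ennreal_mult[symmetric] mult_left_mono ennreal_leI)
    qed
    also have "\<dots> = (\<integral>\<^sup>+y. ennreal (norm (g y)) \<partial>wt_meas a) * (ennreal D * (\<integral>\<^sup>+x. ennreal (norm (f x)) \<partial>wt_meas a))"
      by (simp add: nn_integral_cmult nn_integral_multc)
    also have "\<dots> < top" using f g by (simp add: integrable_iff_bounded ennreal_mult_less_top)
    finally show "(\<integral>\<^sup>+y. (\<integral>\<^sup>+x. ennreal (norm (g y * (kern a t y x * f x))) \<partial>wt_meas a) \<partial>wt_meas a) < top" .
  qed
  also have "\<dots> = (\<integral>x. (\<integral>y. f x * (kern a t x y * g y) \<partial>wt_meas a) \<partial>wt_meas a)"
    by (intro Bochner_Integration.integral_cong refl) (simp add: kern_commute[of a t] mult_ac)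
  also have "\<dots> = (\<integral>x. f x * schr a t g x \<partial>wt_meas a)"
    unfolding schr_def by (simp only: integral_mult_right_zero)
  finally show ?thesis .
qed

lemma cnj_schr: "cnj (schr a t f x) = schr a (- t) (\<lambda>y. cnj (f y)) x"
proof -
  have "cnj (schr a t f x) = (\<integral>y. cnj (kern a t x y * f y) \<partial>wt_meas a)" unfolding schr_def by (rule Bochner_Integration.integral_cnj[symmetric])
  thus ?thesis by (simp add: schr_def cnj_kern)
qed

lemma gauss_integrable:
  assumes "\<delta> > 0" "a \<ge> 0"
  shows "integrable (wt_meas a) (\<lambda>y. exp (- \<delta> * y\<^sup>2))"
  using integrable.intros[OF gauss_moment_real[OF assms(1) _ refl, of a 0]] assms by simp

text \<open>On integrable functions the dispersive estimate gives bounded images; the Gaussian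
  brings them back to integrable ones, so that a second propagator can be applied.\<close>

lemma integrable_gauss_schr:
  assumes a: "a \<ge> 0" and \<delta>: "\<delta> > 0" and f: "integrable (wt_meas a) f"
  shows "integrable (wt_meas a) (\<lambda>y. complex_of_real (exp (- \<delta> * y\<^sup>2)) * schr a t f y)"
proof -
  have [measurable]: "f \<in> borel_measurable borel" using borel_measurable_integrable[OF f] by (simp add: measurable_wt_meas)
  have fin: "ennreal (disp_const a * \<bar>t\<bar> powr (- ((a + 1) / 2))) * (\<integral>\<^sup>+y. ennreal (norm (f y)) \<partial>wt_meas a) < top"
    using f by (simp add: integrable_iff_bounded ennreal_mult_less_top)
  then obtain B where B: "ennreal (disp_const a * \<bar>t\<bar> powr (- ((a + 1) / 2))) * (\<integral>\<^sup>+y. ennreal (norm (f y)) \<partial>wt_meas a) = ennreal B" "B \<ge> 0"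
    by (cases "ennreal (disp_const a * \<bar>t\<bar> powr (- ((a + 1) / 2))) * (\<integral>\<^sup>+y. ennreal (norm (f y)) \<partial>wt_meas a)") auto
  have le: "norm (schr a t f y) \<le> B" for y
    using norm_schr_le[OF a f, of t y] B by simp
  show ?thesis
  proof (rule Bochner_Integration.integrable_bound)
    show "integrable (wt_meas a) (\<lambda>y. B * exp (- \<delta> * y\<^sup>2))" using gauss_integrable[OF \<delta> a] by simp
    show "(\<lambda>y. complex_of_real (exp (- \<delta> * y\<^sup>2)) * schr a t f y) \<in> borel_measurable (wt_meas a)" by measurable
    show "AE y in wt_meas a. norm (complex_of_real (exp (- \<delta> * y\<^sup>2)) * schr a t f y) \<le> norm (B * exp (- \<delta> * y\<^sup>2))"
      using le B by (simp add: norm_mult mult.commute)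
  qed
qed

text \<open>Symmetry moves the propagator at time -t off f, and the conjugate of the propagator at
  -s is the one at s. The pairing becomes f against \<open>Q\<close> applied to the conjugate of g,
  with \<open>Q\<close> the damped composition; decay of \<open>Q\<close> and Hoelder
  finish.\<close>

lemma schr_bilinear:
  assumes a: "a \<ge> 0" and r: "r > 2" and p: "p = r / (r - 1)" and q: "2 / q = (a + 1) * (1/2 - 1/r)"
    and t: "t \<noteq> 0" "s \<noteq> 0" "t \<noteq> s" and \<delta>: "\<delta> > 0"
    and f: "integrable (wt_meas a) f" and g: "integrable (wt_meas a) g"
  shows "ennreal (norm (\<integral>y. complex_of_real (exp (- \<delta> * y\<^sup>2)) * (schr a (- t) f y * cnj (schr a (- s) g y)) \<partial>wt_meas a)) \<le>
    ennreal (decay_const a r * \<bar>t - s\<bar> powr (- (2/q))) *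
      (wnorm a p f * wnorm a p g)"
proof -
  interpret W: sigma_finite_measure "wt_meas a" by (rule sigma_finite_wt_meas)
  define w where "w h y = complex_of_real (exp (- \<delta> * y\<^sup>2)) * schr a s h y" for h y
  define Q where "Q h x = schr a (- t) (w h) x" for h x
  have wi: "integrable (wt_meas a) (w h)" if "integrable (wt_meas a) h" for h
    unfolding w_def by (rule integrable_gauss_schr[OF a \<delta> that])
  define k where "k x z = (\<integral>y. kern a (- t) x y * (exp (- \<delta> * y\<^sup>2) * kern a s y z) \<partial>wt_meas a)" for x z
  \<comment> \<open>Fubini turns the composition into a single kernel operator, the form in which
    interpolation applies. The Gaussian makes the double integral absolutely convergent; the crude
    bound used for that is qualitative only.\<close>
  have Qk: "Q h x = (\<integral>z. k x z * h z \<partial>wt_meas a)" if h: "integrable (wt_meas a) h" for h x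
  proof -
    have [measurable]: "h \<in> borel_measurable borel" using borel_measurable_integrable[OF h] by (simp add: measurable_wt_meas)
    define D where "D t = disp_const a * \<bar>t\<bar> powr (- ((a + 1) / 2))" for t
    have D: "D t \<ge> 0" for t using disp_const_pos[OF a] by (simp add: D_def)
    have "Q h x = (\<integral>y. (\<integral>z. kern a (- t) x y * (complex_of_real (exp (- \<delta> * y\<^sup>2)) * (kern a s y z * h z)) \<partial>wt_meas a) \<partial>wt_meas a)"
      unfolding Q_def w_def schr_def by (simp only: integral_mult_right_zero)
    also have "\<dots> = (\<integral>z. (\<integral>y. kern a (- t) x y * (complex_of_real (exp (- \<delta> * y\<^sup>2)) * (kern a s y z * h z)) \<partial>wt_meas a) \<partial>wt_meas a)"
    proof (rule integral_swap[OF sigma_finite_wt_meas sigma_finite_wt_meas])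
      show "(\<lambda>(y, z). kern a (- t) x y * (complex_of_real (exp (- \<delta> * y\<^sup>2)) * (kern a s y z * h z))) \<in> borel_measurable (wt_meas a \<Otimes>\<^sub>M wt_meas a)"
        by measurable
      have "(\<integral>\<^sup>+y. (\<integral>\<^sup>+z. ennreal (norm (kern a (- t) x y * (complex_of_real (exp (- \<delta> * y\<^sup>2)) * (kern a s y z * h z)))) \<partial>wt_meas a) \<partial>wt_meas a)
        \<le> (\<integral>\<^sup>+y. (\<integral>\<^sup>+z. ennreal (D (- t) * D s) * (ennreal (exp (- \<delta> * y\<^sup>2)) * ennreal (norm (h z))) \<partial>wt_meas a) \<partial>wt_meas a)"
      proof (intro nn_integral_mono)
        fix y z
        have "norm (kern a (- t) x y) * norm (kern a s y z) \<le> D (- t) * D s"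
          unfolding D_def using disp_const_pos[OF a] by (intro mult_mono norm_kern_le a) auto
        hence "(norm (kern a (- t) x y) * norm (kern a s y z)) * (exp (- \<delta> * y\<^sup>2) * norm (h z)) \<le> (D (- t) * D s) * (exp (- \<delta> * y\<^sup>2) * norm (h z))"
          by (intro mult_right_mono) auto
        thus "ennreal (norm (kern a (- t) x y * (complex_of_real (exp (- \<delta> * y\<^sup>2)) * (kern a s y z * h z)))) \<le> ennreal (D (- t) * D s) * (ennreal (exp (- \<delta> * y\<^sup>2)) * ennreal (norm (h z)))"
          using D by (simp add: norm_mult ennreal_mult[symmetric] mult_ac ennreal_leI)
      qed
      also have "\<dots> = ennreal (D (- t) * D s) * ((\<integral>\<^sup>+y. ennreal (exp (- \<delta> * y\<^sup>2)) \<partial>wt_meas a) * (\<integral>\<^sup>+z. ennreal (norm (h z)) \<partial>wt_meas a))"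
        by (simp add: nn_integral_cmult nn_integral_multc)
      also have "\<dots> < top" using h gauss_integrable[OF \<delta> a] by (simp add: integrable_iff_bounded ennreal_mult_less_top)
      finally show "(\<integral>\<^sup>+y. (\<integral>\<^sup>+z. ennreal (norm (kern a (- t) x y * (complex_of_real (exp (- \<delta> * y\<^sup>2)) * (kern a s y z * h z)))) \<partial>wt_meas a) \<partial>wt_meas a) < top" .
    qed
    also have "\<dots> = (\<integral>z. k x z * h z \<partial>wt_meas a)"
      unfolding k_def by (simp only: mult.assoc[symmetric] integral_mult_left_zero)
    finally show ?thesis .
  qed
  have Qdec: "wnorm a r (Q h) \<le>
    ennreal (decay_const a r * \<bar>t - s\<bar> powr (- (2/q))) * wnorm a p h"
    if h: "integrable (wt_meas a) h" for h
    unfolding decay_const_def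
  proof (rule wnorm_decay_scaling[OF a r p _ disp_const_pos[OF a] _ q h])
    show "\<bar>t - s\<bar> > 0" using t by simp
    fix h :: "real \<Rightarrow> complex" assume h: "integrable (wt_meas a) h"
    show "(\<integral>\<^sup>+x. ennreal (norm (Q h x) powr r) \<partial>wt_meas a)
        \<le> ennreal (4 * 1 * r / (r - 2) * (2 * (disp_const a * \<bar>t - s\<bar> powr (- ((a + 1) / 2)))) powr (r - 2)) * enn_powr (\<integral>\<^sup>+y. ennreal (norm (h y) powr p) \<partial>wt_meas a) (r - 1)"
      unfolding Qk[OF h]
    proof (rule marcinkiewicz_1_inf_2_2[OF sigma_finite_wt_meas sigma_finite_wt_meas _ _ _ _ _ r p h])
      show "case_prod k \<in> borel_measurable (wt_meas a \<Otimes>\<^sub>M wt_meas a)" unfolding k_def by measurable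
      show "norm (k x y) \<le> disp_const a * \<bar>t - s\<bar> powr (- ((a + 1) / 2))" for x y
        unfolding k_def by (rule norm_damped_kern_le[OF a t \<delta>])
      show "disp_const a * \<bar>t - s\<bar> powr (- ((a + 1) / 2)) > 0" using disp_const_pos[OF a] t by simp
      fix h' :: "real \<Rightarrow> complex" assume h': "integrable (wt_meas a) h'"
      \<comment> \<open>The L^2 bound is read off from the factors, not from the kernel
        \<open>k\<close>: two contractions with multiplication by a Gaussian of modulus at most 1
        between them.\<close>
      have "(wsq a (Q h')) \<le> (wsq a (w h'))"
        unfolding Q_def using t by (intro schr_L2 a wi h') auto
      also have "\<dots> \<le> (wsq a (schr a s h'))"
        using \<delta> by (intro nn_integral_mono ennreal_leI power_mono) (auto simp: w_def norm_mult mult_left_le_one_le)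
      also have "\<dots> \<le> (wsq a h')"
        using t by (intro schr_L2 a h') auto
      finally show "(\<integral>\<^sup>+x. ennreal ((norm (\<integral>y. k x y * h' y \<partial>wt_meas a))\<^sup>2) \<partial>wt_meas a) \<le> ennreal 1 * (wsq a h')"
        by (simp add: Qk[OF h'])
    qed simp
  qed
  define g' where "g' y = cnj (g y)" for y
  have g': "integrable (wt_meas a) g'" unfolding g'_def using g by simp
  have [measurable]: "f \<in> borel_measurable borel" "g' \<in> borel_measurable borel"
    using borel_measurable_integrable[OF f] borel_measurable_integrable[OF g'] by (simp_all add: measurable_wt_meas)
  have [measurable]: "w g' \<in> borel_measurable borel" unfolding w_def by measurable
  have [measurable]: "Q g' \<in> borel_measurable borel" unfolding Q_def by measurable
  have "(\<integral>y. complex_of_real (exp (- \<delta> * y\<^sup>2)) * (schr a (- t) f y * cnj (schr a (- s) g y)) \<partial>wt_meas a) = (\<integral>y. w g' y * schr a (- t) f y \<partial>wt_meas a)"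
    by (intro Bochner_Integration.integral_cong) (auto simp: cnj_schr w_def g'_def[abs_def] mult_ac)
  also have "\<dots> = (\<integral>x. f x * Q g' x \<partial>wt_meas a)" unfolding Q_def by (rule schr_symmetric[OF a f wi[OF g']])
  also have "ennreal (norm \<dots>) \<le> (\<integral>\<^sup>+x. ennreal (norm (f x * Q g' x)) \<partial>wt_meas a)" by (rule norm_integral_le_nn_integral)
  also have "\<dots> = (\<integral>\<^sup>+x. ennreal (norm (f x)) * ennreal (norm (Q g' x)) \<partial>wt_meas a)" by (simp add: norm_mult ennreal_mult)
  also have "\<dots> \<le> enn_powr (\<integral>\<^sup>+x. enn_powr (ennreal (norm (f x))) p \<partial>wt_meas a) (1/p) * enn_powr (\<integral>\<^sup>+x. enn_powr (ennreal (norm (Q g' x))) r \<partial>wt_meas a) (1/r)"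
    by (rule nn_Hoelder) (use r in \<open>auto simp: p field_simps measurable_wt_meas\<close>)
  also have "\<dots> \<le> enn_powr (\<integral>\<^sup>+y. ennreal (norm (f y) powr p) \<partial>wt_meas a) (1/p) * (ennreal (decay_const a r * \<bar>t - s\<bar> powr (- (2/q))) * wnorm a p g')"
    using Qdec[OF g'] by (intro mult_mono) auto
  finally show ?thesis by (simp add: g'_def mult_ac)
qed


section \<open>Strichartz estimates\<close>

lemma powr_2_eq_power2: "0 \<le> x \<Longrightarrow> x powr 2 = (x::real)\<^sup>2"
  by (cases "x = 0") auto

lemma enn_powr_SUP: "p > 0 \<Longrightarrow> enn_powr (SUP n. f n) p = (SUP n. enn_powr (f n) p)"
proof (rule antisym)
  assume p: "p > 0"
  show "(SUP n. enn_powr (f n) p) \<le> enn_powr (SUP n. f n) p"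
    using p by (intro SUP_least enn_powr_mono SUP_upper) auto
  define S where "S = (SUP n. enn_powr (f n) p)"
  have "f n \<le> enn_powr S (1/p)" for n
  proof -
    have "enn_powr (enn_powr (f n) p) (1/p) \<le> enn_powr S (1/p)"
      unfolding S_def using p by (intro enn_powr_mono SUP_upper) auto
    thus ?thesis using p by (simp add: enn_powr_powr)
  qed
  hence "(SUP n. f n) \<le> enn_powr S (1/p)" by (intro SUP_least)
  hence "enn_powr (SUP n. f n) p \<le> enn_powr (enn_powr S (1/p)) p" using p by (intro enn_powr_mono) auto
  thus "enn_powr (SUP n. f n) p \<le> (SUP n. enn_powr (f n) p)" using p by (simp add: enn_powr_powr S_def)
qed

text \<open>A triangle inequality up to a constant, obtained from \<open>enn_powr_add_le\<close>
  inside the integral (factor 2 after the root) and again on the root (factor 2^(1/p) <= 2).\<close>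

lemma enn_norm_add:
  assumes [measurable]: "f \<in> borel_measurable M" "g \<in> borel_measurable M" and p: "p \<ge> 1"
  shows "enn_powr (\<integral>\<^sup>+x. enn_powr (f x + g x) p \<partial>M) (1/p) \<le>
    4 * (enn_powr (\<integral>\<^sup>+x. enn_powr (f x) p \<partial>M) (1/p) + enn_powr (\<integral>\<^sup>+x. enn_powr (g x) p \<partial>M) (1/p))"
proof -
  define A where "A = (\<integral>\<^sup>+x. enn_powr (f x) p \<partial>M)"
  define B where "B = (\<integral>\<^sup>+x. enn_powr (g x) p \<partial>M)"
  have "(\<integral>\<^sup>+x. enn_powr (f x + g x) p \<partial>M) \<le> (\<integral>\<^sup>+x. ennreal (2 powr p) * (enn_powr (f x) p + enn_powr (g x) p) \<partial>M)"
    using p by (intro nn_integral_mono enn_powr_add_le) auto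
  also have "\<dots> = ennreal (2 powr p) * (A + B)" by (simp add: nn_integral_cmult nn_integral_add A_def B_def)
  finally have "enn_powr (\<integral>\<^sup>+x. enn_powr (f x + g x) p \<partial>M) (1/p) \<le> enn_powr (ennreal (2 powr p) * (A + B)) (1/p)"
    using p by (intro enn_powr_mono) auto
  also have "\<dots> = ennreal 2 * enn_powr (A + B) (1/p)" using p by (simp add: enn_powr_mult powr_powr)
  also have "\<dots> \<le> ennreal 2 * (ennreal (2 powr (1/p)) * (enn_powr A (1/p) + enn_powr B (1/p)))"
    using p by (intro mult_left_mono enn_powr_add_le) auto
  also have "\<dots> = ennreal (2 * 2 powr (1/p)) * (enn_powr A (1/p) + enn_powr B (1/p))"
    by (simp add: mult.assoc[symmetric] ennreal_mult)
  also have "\<dots> \<le> ennreal 4 * (enn_powr A (1/p) + enn_powr B (1/p))"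
  proof (intro mult_right_mono ennreal_leI)
    have "2 powr (1/p) \<le> 2 powr (1::real)" using p by (intro powr_mono) auto
    thus "2 * 2 powr (1/p) \<le> (4::real)" by simp
  qed auto
  finally show ?thesis by (simp add: A_def B_def)
qed

text \<open>Hoelder with exponents q' and q, then fractional integration of \<gamma>. Both steps
  produce the L^(q') norm of \<gamma>, so the result is its square.\<close>

lemma riesz_pairing:
  assumes q: "q > 2" and H: "hls_const q H"
    and [measurable]: "\<gamma> \<in> borel_measurable borel"
  shows "(\<integral>\<^sup>+t. \<gamma> t * riesz (2/q) \<gamma> t \<partial>lborel) \<le>
    ennreal (H powr (1/q)) * enn_powr (\<integral>\<^sup>+s. enn_powr (\<gamma> s) (q / (q - 1)) \<partial>lborel) (2 * (q - 1) / q)"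
proof -
  define I where "I = (\<integral>\<^sup>+s. enn_powr (\<gamma> s) (q / (q - 1)) \<partial>lborel)"
  have "(\<integral>\<^sup>+t. \<gamma> t * riesz (2/q) \<gamma> t \<partial>lborel) \<le> enn_powr I (1 / (q / (q - 1))) * enn_powr (\<integral>\<^sup>+t. enn_powr (riesz (2/q) \<gamma> t) q \<partial>lborel) (1/q)"
    unfolding I_def by (rule nn_Hoelder) (use q in \<open>auto simp: field_simps\<close>)
  also have "\<dots> \<le> enn_powr I ((q - 1) / q) * enn_powr (ennreal H * enn_powr I (q - 1)) (1/q)"
    unfolding I_def using q H by (intro mult_mono enn_powr_mono) (auto simp: hls_const_def)
  also have "\<dots> = ennreal (H powr (1/q)) * (enn_powr I ((q - 1) / q) * enn_powr I ((q - 1) / q))"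
    using H q by (simp add: hls_const_def enn_powr_mult enn_powr_powr mult_ac)
  also have "enn_powr I ((q - 1) / q) * enn_powr I ((q - 1) / q) = enn_powr I (2 * (q - 1) / q)"
    using q enn_powr_add[of "(q - 1) / q" "(q - 1) / q" I] by (simp add: add_divide_distrib[symmetric])
  finally show ?thesis by (simp add: I_def)
qed

lemma measurable_compose2:
  fixes G :: "real \<Rightarrow> real \<Rightarrow> complex"
  assumes "(\<lambda>z. G (fst z) (snd z)) \<in> borel_measurable (borel \<Otimes>\<^sub>M borel)"
    and [measurable]: "u \<in> borel_measurable N" "v \<in> borel_measurable N"
  shows "(\<lambda>z. G (u z) (v z)) \<in> borel_measurable N"
  using measurable_compose[OF _ assms(1), of "\<lambda>z. (u z, v z)" N] by simp

text \<open>The dual estimate: the pairing equals that of f with \<open>V\<close>, the time integral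
  of the propagated G, and TT* bounds \<open>V\<close> in L^2. The gap |t| < \<epsilon> avoids the
  singularity |t|^(-m) and makes the exchange of integrals absolutely convergent; \<epsilon> leaves
  no trace in the constant.\<close>

lemma schr_pairing:
  assumes a: "a \<ge> 0" and r: "r > 2" and p: "p = r / (r - 1)" and q: "2 / q = (a + 1) * (1/2 - 1/r)" "q > 2"
    and H: "hls_const q H"
    and f: "integrable (wt_meas a) f"
    and Gm [measurable]: "(\<lambda>z. G (fst z) (snd z)) \<in> borel_measurable (borel \<Otimes>\<^sub>M borel)"
    and Gi: "\<And>t. integrable (wt_meas a) (G t)"
    and \<epsilon>: "\<epsilon> > 0" "\<And>t x. \<bar>t\<bar> < \<epsilon> \<Longrightarrow> G t x = 0"
    and GL: "(\<integral>\<^sup>+t. (\<integral>\<^sup>+x. ennreal (norm (G t x)) \<partial>wt_meas a) \<partial>lborel) < top"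
  shows "ennreal (norm (\<integral>t. (\<integral>x. G t x * schr a t f x \<partial>wt_meas a) \<partial>lborel)) \<le>
    ennreal ((decay_const a r * H powr (1/q)) powr (1/2)) * enn_powr (wsq a f) (1/2) *
    enn_powr (\<integral>\<^sup>+t. enn_powr (wnorm a p (G t)) (q / (q - 1)) \<partial>lborel) ((q - 1) / q)"
proof -
  interpret W: sigma_finite_measure "wt_meas a" by (rule sigma_finite_wt_meas)
  have [measurable]: "f \<in> borel_measurable borel" using borel_measurable_integrable[OF f] by (simp add: measurable_wt_meas)
  have Gtm [measurable]: "G t \<in> borel_measurable borel" for t using borel_measurable_integrable[OF Gi] by (simp add: measurable_wt_meas)
  note [measurable (raw)] = measurable_compose2[OF Gm]
  define m where "m = (a + 1) / 2"
  have m: "m > 0" using a by (simp add: m_def)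
  define \<kappa> where "\<kappa> y t = schr a t (G t) y" for y t
  have \<kappa>m [measurable]: "(\<lambda>z. \<kappa> (fst z) (snd z)) \<in> borel_measurable (borel \<Otimes>\<^sub>M borel)" unfolding \<kappa>_def schr_def by measurable
  define L where "L t = (\<integral>\<^sup>+x. ennreal (norm (G t x)) \<partial>wt_meas a)" for t
  have Lm [measurable]: "L \<in> borel_measurable borel" unfolding L_def by measurable
  have Lfin: "L t < top" for t using Gi[of t] by (simp add: L_def integrable_iff_bounded)
  \<comment> \<open>The dispersive constant at |t| = \<epsilon>, valid at all times where G does not
    vanish. It serves integrability only.\<close>
  define D where "D = disp_const a * \<epsilon> powr (- m)"
  have D: "D > 0" using disp_const_pos[OF a] \<epsilon> by (simp add: D_def)
  have \<kappa>b: "ennreal (norm (\<kappa> y t)) \<le> ennreal D * L t" for y t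
  proof (cases "\<bar>t\<bar> < \<epsilon>")
    case True
    thus ?thesis using \<epsilon>(2)[OF True] by (simp add: \<kappa>_def schr_def)
  next
    case False
    have "ennreal (norm (\<kappa> y t)) \<le> ennreal (disp_const a * \<bar>t\<bar> powr (- m)) * L t"
      unfolding \<kappa>_def L_def m_def by (rule norm_schr_le[OF a Gi])
    also have "\<dots> \<le> ennreal D * L t"
      unfolding D_def using False \<epsilon> m disp_const_pos[OF a]
      by (intro mult_right_mono ennreal_leI mult_left_mono powr_mono2') auto
    finally show ?thesis .
  qed
  define \<gamma> where "\<gamma> t = wnorm a p (G t)" for t
  have \<gamma>m [measurable]: "\<gamma> \<in> borel_measurable borel" unfolding \<gamma>_def by measurable
  define Z where "Z = enn_powr (\<integral>\<^sup>+s. enn_powr (\<gamma> s) (q / (q - 1)) \<partial>lborel) (2 * (q - 1) / q)"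
  define c where "c = decay_const a r"
  have c: "c > 0" unfolding c_def by (rule decay_const_pos[OF a r])
  define V where "V y = (\<integral>t. \<kappa> y t \<partial>lborel)" for y
  have Vm [measurable]: "V \<in> borel_measurable borel" unfolding V_def by measurable
  \<comment> \<open>Expanding the square produces a double time integral of the bilinear form at
    times t and s. The decay |t - s|^(-2/q) makes it the pairing of \<gamma> with its own Riesz
    potential.\<close>
  have VL2: "(wsq a V) \<le> ennreal (c * H powr (1/q)) * Z"
  proof (rule nn_integral_gauss_limit)
    show "(\<lambda>y. ennreal ((norm (V y))\<^sup>2)) \<in> borel_measurable (wt_meas a)" by measurable
    show "sets (wt_meas a) = sets borel" by simp
    fix \<delta> :: real assume \<delta>: "\<delta> > 0"
    define \<Omega> where "\<Omega> = density (wt_meas a) (\<lambda>x. ennreal (exp (- \<delta> * x\<^sup>2)))"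
    have sO [measurable_cong]: "sets \<Omega> = sets borel" by (simp add: \<Omega>_def)
    have fO: "finite_measure \<Omega>"
    proof (rule finite_measureI)
      have "emeasure \<Omega> (space \<Omega>) = (\<integral>\<^sup>+x. ennreal (exp (- \<delta> * x\<^sup>2)) \<partial>wt_meas a)"
        unfolding \<Omega>_def by (subst emeasure_density) auto
      also have "\<dots> < top" using gauss_integrable[OF \<delta> a] by (simp add: integrable_iff_bounded)
      finally show "emeasure \<Omega> (space \<Omega>) \<noteq> \<infinity>" by simp
    qed
    have "(\<integral>\<^sup>+x. ennreal (exp (- \<delta> * x\<^sup>2)) * ennreal ((norm (V x))\<^sup>2) \<partial>wt_meas a) = (\<integral>\<^sup>+x. ennreal ((norm (\<integral>t. \<kappa> x t \<partial>lborel))\<^sup>2) \<partial>\<Omega>)"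
      unfolding \<Omega>_def V_def by (subst nn_integral_density) auto
    also have "\<dots> \<le> (\<integral>\<^sup>+t. (\<integral>\<^sup>+s. ennreal (norm (\<integral>y. \<kappa> y t * cnj (\<kappa> y s) \<partial>\<Omega>)) \<partial>lborel) \<partial>lborel)"
    proof (rule nn_integral_square_le_double[OF fO lborel.sigma_finite_measure_axioms])
      show "case_prod \<kappa> \<in> borel_measurable (\<Omega> \<Otimes>\<^sub>M lborel)"
        using \<kappa>m by (simp add: case_prod_beta' cong: measurable_cong_sets sets_pair_measure_cong)
      show "integrable lborel (\<lambda>t. D * enn2real (L t))"
      proof (rule integrableI_bounded)
        have "(\<integral>\<^sup>+t. ennreal (norm (D * enn2real (L t))) \<partial>lborel) = (\<integral>\<^sup>+t. ennreal D * L t \<partial>lborel)"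
          using D Lfin by (intro nn_integral_cong) (simp add: abs_mult ennreal_mult)
        also have "\<dots> = ennreal D * (\<integral>\<^sup>+t. L t \<partial>lborel)" by (subst nn_integral_cmult) auto
        also have "\<dots> < top" using GL by (simp add: L_def ennreal_mult_less_top)
        finally show "(\<integral>\<^sup>+t. ennreal (norm (D * enn2real (L t))) \<partial>lborel) < \<infinity>" by simp
      qed measurable
      show "norm (\<kappa> y t) \<le> D * enn2real (L t)" for y t
      proof -
        obtain l where l: "L t = ennreal l" "l \<ge> 0" using Lfin[of t] by (cases "L t") auto
        show ?thesis using \<kappa>b[of y t] D unfolding l(1) by (simp add: l ennreal_mult[symmetric])
      qed
    qed
    also have "\<dots> \<le> (\<integral>\<^sup>+t. (\<integral>\<^sup>+s. ennreal c * (\<gamma> t * (ennreal (\<bar>t - s\<bar> powr (- (2/q))) * \<gamma> s)) \<partial>lborel) \<partial>lborel)"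
    proof (rule nn_integral_mono)
      fix t :: real
      show "(\<integral>\<^sup>+s. ennreal (norm (\<integral>y. \<kappa> y t * cnj (\<kappa> y s) \<partial>\<Omega>)) \<partial>lborel) \<le> (\<integral>\<^sup>+s. ennreal c * (\<gamma> t * (ennreal (\<bar>t - s\<bar> powr (- (2/q))) * \<gamma> s)) \<partial>lborel)"
      proof (rule nn_integral_mono_AE)
        have pw: "ennreal (norm (\<integral>y. \<kappa> y t * cnj (\<kappa> y s) \<partial>\<Omega>)) \<le> ennreal c * (\<gamma> t * (ennreal (\<bar>t - s\<bar> powr (- (2/q))) * \<gamma> s))"
          if ne: "s \<noteq> t" for s
        proof (cases "t = 0 \<or> s = 0")
          case True
          hence "(\<forall>y. \<kappa> y t = 0) \<or> (\<forall>y. \<kappa> y s = 0)" using \<epsilon> by (auto simp: \<kappa>_def schr_def)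
          hence "(\<integral>y. \<kappa> y t * cnj (\<kappa> y s) \<partial>\<Omega>) = 0" by auto
          thus ?thesis by simp
        next
          case False
          have "(\<integral>y. \<kappa> y t * cnj (\<kappa> y s) \<partial>\<Omega>) = (\<integral>y. exp (- \<delta> * y\<^sup>2) *\<^sub>R (\<kappa> y t * cnj (\<kappa> y s)) \<partial>wt_meas a)"
            unfolding \<Omega>_def \<kappa>_def by (subst integral_density) auto
          also have "\<dots> = (\<integral>y. complex_of_real (exp (- \<delta> * y\<^sup>2)) * (schr a (- (- t)) (G t) y * cnj (schr a (- (- s)) (G s) y)) \<partial>wt_meas a)"
            by (simp add: \<kappa>_def scaleR_conv_of_real)
          finally have e: "(\<integral>y. \<kappa> y t * cnj (\<kappa> y s) \<partial>\<Omega>) = \<dots>" .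
          have "ennreal (norm (\<integral>y. \<kappa> y t * cnj (\<kappa> y s) \<partial>\<Omega>)) \<le> ennreal (decay_const a r * \<bar>(- t) - (- s)\<bar> powr (- (2/q))) *
            (wnorm a p (G t) * wnorm a p (G s))"
            unfolding e using False ne by (intro schr_bilinear[OF a r p q(1) _ _ _ \<delta> Gi Gi]) auto
          also have "\<dots> = ennreal c * (\<gamma> t * (ennreal (\<bar>t - s\<bar> powr (- (2/q))) * \<gamma> s))"
            using c by (simp add: c_def \<gamma>_def ennreal_mult abs_minus_commute mult_ac)
          finally show ?thesis .
        qed
        show "AE s in lborel. ennreal (norm (\<integral>y. \<kappa> y t * cnj (\<kappa> y s) \<partial>\<Omega>)) \<le> ennreal c * (\<gamma> t * (ennreal (\<bar>t - s\<bar> powr (- (2/q))) * \<gamma> s))"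
          using AE_lborel_singleton[of t] by eventually_elim (rule pw)
      qed
    qed
    also have "\<dots> = ennreal c * (\<integral>\<^sup>+t. \<gamma> t * riesz (2/q) \<gamma> t \<partial>lborel)"
      unfolding riesz_def by (simp add: nn_integral_cmult)
    also have "\<dots> \<le> ennreal c * (ennreal (H powr (1/q)) * Z)"
      unfolding Z_def by (intro mult_left_mono riesz_pairing[OF q(2) H]) auto
    also have "\<dots> = ennreal (c * H powr (1/q)) * Z" using c by (simp add: ennreal_mult mult.assoc)
    finally show "(\<integral>\<^sup>+x. ennreal (exp (- \<delta> * x\<^sup>2)) * ennreal ((norm (V x))\<^sup>2) \<partial>wt_meas a) \<le> ennreal (c * H powr (1/q)) * Z" .
  qed
  have "(\<integral>t. (\<integral>x. G t x * schr a t f x \<partial>wt_meas a) \<partial>lborel) = (\<integral>t. (\<integral>y. f y * \<kappa> y t \<partial>wt_meas a) \<partial>lborel)"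
    unfolding \<kappa>_def by (intro Bochner_Integration.integral_cong refl schr_symmetric[OF a f Gi])
  also have "\<dots> = (\<integral>y. (\<integral>t. f y * \<kappa> y t \<partial>lborel) \<partial>wt_meas a)"
  proof (rule integral_swap[OF lborel.sigma_finite_measure_axioms sigma_finite_wt_meas])
    show "(\<lambda>(t, y). f y * \<kappa> y t) \<in> borel_measurable (lborel \<Otimes>\<^sub>M wt_meas a)" unfolding \<kappa>_def schr_def by measurable
    have "(\<integral>\<^sup>+t. (\<integral>\<^sup>+y. ennreal (norm (f y * \<kappa> y t)) \<partial>wt_meas a) \<partial>lborel) \<le> (\<integral>\<^sup>+t. (\<integral>\<^sup>+y. ennreal (norm (f y)) * (ennreal D * L t) \<partial>wt_meas a) \<partial>lborel)"
    proof (intro nn_integral_mono)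
      fix t y
      show "ennreal (norm (f y * \<kappa> y t)) \<le> ennreal (norm (f y)) * (ennreal D * L t)"
        using \<kappa>b[of y t] by (simp add: norm_mult ennreal_mult mult_left_mono)
    qed
    also have "\<dots> = (\<integral>\<^sup>+y. ennreal (norm (f y)) \<partial>wt_meas a) * (ennreal D * (\<integral>\<^sup>+t. L t \<partial>lborel))"
      by (simp add: nn_integral_cmult nn_integral_multc)
    also have "\<dots> < top" using f GL by (simp add: integrable_iff_bounded L_def ennreal_mult_less_top)
    finally show "(\<integral>\<^sup>+t. (\<integral>\<^sup>+y. ennreal (norm (f y * \<kappa> y t)) \<partial>wt_meas a) \<partial>lborel) < top" .
  qed
  also have "\<dots> = (\<integral>y. f y * V y \<partial>wt_meas a)" unfolding V_def by (simp only: integral_mult_right_zero)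
  also have "ennreal (norm \<dots>) \<le> (\<integral>\<^sup>+y. ennreal (norm (f y * V y)) \<partial>wt_meas a)" by (rule norm_integral_le_nn_integral)
  also have "\<dots> = (\<integral>\<^sup>+y. ennreal (norm (f y)) * ennreal (norm (V y)) \<partial>wt_meas a)" by (simp add: norm_mult ennreal_mult)
  also have "\<dots> \<le> enn_powr (\<integral>\<^sup>+y. enn_powr (ennreal (norm (f y))) 2 \<partial>wt_meas a) (1/2) * enn_powr (\<integral>\<^sup>+y. enn_powr (ennreal (norm (V y))) 2 \<partial>wt_meas a) (1/2)"
    by (rule nn_Hoelder) auto
  also have "\<dots> = enn_powr (wsq a f) (1/2) * enn_powr (wsq a V) (1/2)"
    by (simp only: enn_powr_ennreal norm_ge_zero powr_2_eq_power2)
  also have "\<dots> \<le> enn_powr (wsq a f) (1/2) * enn_powr (ennreal (c * H powr (1/q)) * Z) (1/2)"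
    by (intro mult_left_mono enn_powr_mono VL2) auto
  also have "enn_powr (ennreal (c * H powr (1/q)) * Z) (1/2) = ennreal ((c * H powr (1/q)) powr (1/2)) * enn_powr (\<integral>\<^sup>+s. enn_powr (\<gamma> s) (q / (q - 1)) \<partial>lborel) ((q - 1) / q)"
  proof -
    have e: "2 * (q - 1) / q * (1/2) = (q - 1) / q" using q(2) by (simp add: field_simps)
    show ?thesis unfolding enn_powr_mult Z_def enn_powr_powr e using c by simp
  qed
  finally show ?thesis by (simp add: \<gamma>_def c_def mult_ac)
qed

text \<open>
  The pairing is applied to the function \<open>G\<close> that attains equality in Hoelder's inequality for the mixed norm of
  the solution, truncated to \<open>x \<le> n\<close> and \<open>1/(n+1) \<le> \<bar>t\<bar> \<le> n\<close> so that this norm is finite and can be divided out.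
\<close>

lemma strichartz_homogeneous:
  assumes a: "a \<ge> 0" and r: "r > 2" and p: "p = r / (r - 1)" and q: "2 / q = (a + 1) * (1/2 - 1/r)" "q > 2"
    and H: "hls_const q H"
    and f: "integrable (wt_meas a) f"
  shows "enn_powr (\<integral>\<^sup>+t. enn_powr (wnorm a r (schr a t f)) q \<partial>lborel) (1/q) \<le>
    ennreal ((decay_const a r * H powr (1/q)) powr (1/2)) * enn_powr (wsq a f) (1/2)"
proof -
  interpret W: sigma_finite_measure "wt_meas a" by (rule sigma_finite_wt_meas)
  have [measurable]: "f \<in> borel_measurable borel" using borel_measurable_integrable[OF f] by (simp add: measurable_wt_meas)
  have qr: "q / (q - 1) > 0" "q / r > 0" using q r by auto
  have p1: "p > 1" "(r - 1) * p = r" using r by (auto simp: p field_simps)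
  define m where "m = (a + 1) / 2"
  have m: "m > 0" using a by (simp add: m_def)
  define u where "u t x = schr a t f x" for t x
  have um [measurable]: "(\<lambda>z. u (fst z) (snd z)) \<in> borel_measurable (borel \<Otimes>\<^sub>M borel)" unfolding u_def schr_def by measurable
  have um' [measurable]: "u t \<in> borel_measurable borel" for t unfolding u_def by measurable
  define R where "R = ennreal ((decay_const a r * H powr (1/q)) powr (1/2)) * enn_powr (wsq a f) (1/2)"
  define S where "S n = {t::real. 1 / real (Suc n) \<le> \<bar>t\<bar> \<and> \<bar>t\<bar> \<le> real n}" for n
  have Sm [measurable]: "S n \<in> sets borel" for n unfolding S_def by measurable
  \<comment> \<open>The truncated spatial integral without its r-th root, which is why time
    integrals carry the exponent q / r.\<close>
  define N where "N n t = (\<integral>\<^sup>+x. ennreal (norm (u t x) powr r) * indicator {..real n} x \<partial>wt_meas a) * indicator (S n) t" for n t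
  have Nm [measurable]: "N n \<in> borel_measurable borel" for n unfolding N_def by measurable
  have trunc: "enn_powr (\<integral>\<^sup>+t. enn_powr (N n t) (q/r) \<partial>lborel) (1/q) \<le> R" for n
  proof -
    have "(\<integral>\<^sup>+y. ennreal (norm (f y)) \<partial>wt_meas a) < top" using f by (simp add: integrable_iff_bounded)
    then obtain L where L: "(\<integral>\<^sup>+y. ennreal (norm (f y)) \<partial>wt_meas a) = ennreal L" "L \<ge> 0"
      by (cases "\<integral>\<^sup>+y. ennreal (norm (f y)) \<partial>wt_meas a") auto
    define B where "B = disp_const a * (1 / real (Suc n)) powr (- m) * L"
    have B: "B \<ge> 0" using disp_const_pos[OF a] L by (simp add: B_def)
    have uB: "norm (u t x) \<le> B" if "t \<in> S n" for t x
    proof -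
      have "ennreal (norm (u t x)) \<le> ennreal (disp_const a * \<bar>t\<bar> powr (- m)) * ennreal L"
        using norm_schr_le[OF a f, of t x] by (simp add: u_def m_def L)
      hence "norm (u t x) \<le> disp_const a * \<bar>t\<bar> powr (- m) * L"
        using L disp_const_pos[OF a] by (simp add: ennreal_mult[symmetric])
      also have "\<dots> \<le> B" unfolding B_def using that L disp_const_pos[OF a] m
        by (intro mult_right_mono mult_left_mono powr_mono2') (auto simp: S_def)
      finally show ?thesis .
    qed
    define w where "w = emeasure (wt_meas a) {..real n}"
    have w: "w < top"
    proof -
      have "w = (\<integral>\<^sup>+x. indicator {..real n} x \<partial>wt_meas a)" unfolding w_def by (subst nn_integral_indicator) auto
      also have "\<dots> = (\<integral>\<^sup>+x. ennreal (indicator {0<..} x * x powr a) * indicator {..real n} x \<partial>lborel)"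
        by (rule nn_integral_wt_meas) measurable
      also have "\<dots> \<le> (\<integral>\<^sup>+x. ennreal (real n powr a) * indicator {0..real n} x \<partial>lborel)"
        using a by (intro nn_integral_mono) (auto simp: indicator_def intro!: ennreal_leI powr_mono2)
      also have "\<dots> < top" by (subst nn_integral_cmult_indicator) (auto simp: ennreal_mult_less_top)
      finally show ?thesis .
    qed
    define v where "v t x = norm (u t x) * indicator {..real n} x * indicator (S n) t" for t x
    have vm [measurable]: "(\<lambda>z. v (fst z) (snd z)) \<in> borel_measurable (borel \<Otimes>\<^sub>M borel)" unfolding v_def by measurable
    have vm' [measurable]: "v t \<in> borel_measurable borel" for t unfolding v_def by measurable
    have v0: "v t x \<ge> 0" for t x by (simp add: v_def)
    have vB: "v t x \<le> B * indicator {..real n} x * indicator (S n) t" for t x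
      using uB B by (auto simp: v_def indicator_def)
    have Nv: "N n t = (\<integral>\<^sup>+x. ennreal (v t x powr r) \<partial>wt_meas a)" for t
    proof -
      have "N n t = (\<integral>\<^sup>+x. ennreal (norm (u t x) powr r) * indicator {..real n} x * indicator (S n) t \<partial>wt_meas a)"
        unfolding N_def by (rule nn_integral_multc[symmetric]) measurable
      also have "\<dots> = (\<integral>\<^sup>+x. ennreal (v t x powr r) \<partial>wt_meas a)"
        using r by (intro nn_integral_cong) (auto simp: v_def indicator_def)
      finally show ?thesis .
    qed
    have Nle: "N n t \<le> ennreal (B powr r) * w * indicator (S n) t" for t
    proof -
      have "N n t \<le> (\<integral>\<^sup>+x. ennreal (B powr r) * indicator {..real n} x * indicator (S n) t \<partial>wt_meas a)"
        unfolding Nv using r v0 vB by (intro nn_integral_mono) (auto simp: v_def indicator_def intro!: ennreal_leI powr_mono2 uB)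
      also have "\<dots> = ennreal (B powr r) * w * indicator (S n) t"
        by (subst nn_integral_multc, simp, subst nn_integral_cmult_indicator) (auto simp: w_def)
      finally show ?thesis .
    qed
    have Nfin: "N n t < top" for t
      using order_le_less_trans[OF Nle[of t]] w by (auto simp: ennreal_mult_less_top indicator_def)
    define K where "K t = enn2real (N n t)" for t
    have NK: "N n t = ennreal (K t)" and K0: "K t \<ge> 0" for t using Nfin[of t] by (auto simp: K_def)
    have Km [measurable]: "K \<in> borel_measurable borel" unfolding K_def by measurable
    define W0 where "W0 = B powr r * enn2real w"
    have W0: "ennreal (B powr r) * w = ennreal W0" "W0 \<ge> 0" using w by (auto simp: W0_def ennreal_mult less_top[symmetric])
    have KW: "K t \<le> W0 * indicator (S n) t" for t
      using Nle[of t] unfolding NK W0(1) by (cases "t \<in> S n") (auto simp: W0 ennreal_eq_0_iff)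
    have Kp: "K t powr s \<le> W0 powr s * indicator (S n) t" if "s > 0" for s t
      using KW[of t] K0[of t] that by (cases "t \<in> S n") (auto intro!: powr_mono2 simp: order_antisym)
    have Kfin: "(\<integral>\<^sup>+t. ennreal (K t powr s) \<partial>lborel) < top" if "s > 0" for s
    proof -
      have "(\<integral>\<^sup>+t. ennreal (K t powr s) \<partial>lborel) \<le> (\<integral>\<^sup>+t. ennreal (W0 powr s) * indicator {- real n..real n} t \<partial>lborel)"
      proof (intro nn_integral_mono)
        fix t
        show "ennreal (K t powr s) \<le> ennreal (W0 powr s) * indicator {- real n..real n} t"
          using Kp[OF that, of t] by (cases "t \<in> S n") (auto simp: S_def indicator_def intro!: ennreal_leI)
      qed
      also have "\<dots> < top" by (subst nn_integral_cmult_indicator) (auto simp: ennreal_mult_less_top)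
      finally show ?thesis .
    qed
    \<comment> \<open>The Hoelder extremiser: v^(r-1) in space times the (q - r)-th power of the
      spatial norm of v. Since \<open>K\<close> is the r-th power of that norm, the exponent is (q -
      r) / r; it may be negative, and \<open>0 powr b = 0\<close> covers times with K t = 0.\<close>
    define h where "h t x = v t x powr (r - 1) * K t powr ((q - r) / r)" for t x
    have h0: "h t x \<ge> 0" for t x by (simp add: h_def)
    have hm [measurable]: "h t \<in> borel_measurable borel" for t unfolding h_def by measurable
    have vh: "(\<integral>\<^sup>+x. ennreal (v t x * h t x) \<partial>wt_meas a) = ennreal (K t powr (q/r))" for t
    proof -
      have "v t x * h t x = K t powr ((q - r) / r) * v t x powr r" for x
        using v0[of t x] r powr_mult_base[of "v t x" "r - 1"] by (simp add: h_def mult_ac)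
      hence "(\<integral>\<^sup>+x. ennreal (v t x * h t x) \<partial>wt_meas a) = ennreal (K t powr ((q - r) / r)) * N n t"
        unfolding Nv by (simp add: ennreal_mult nn_integral_cmult)
      also have "\<dots> = ennreal (K t powr (q/r))"
      proof (cases "K t = 0")
        case False
        have "q / r = (q - r) / r + 1" using r by (simp add: field_simps)
        hence "K t powr ((q - r) / r) * K t = K t powr (q/r)" using K0[of t] by (simp only: powr_add) simp
        thus ?thesis using K0[of t] by (simp add: NK ennreal_mult[symmetric])
      qed (simp add: NK)
      finally show ?thesis .
    qed
    have hp: "(\<integral>\<^sup>+x. ennreal (h t x powr p) \<partial>wt_meas a) = ennreal (K t powr (p * (q - 1) / r))" for t
    proof -
      have "h t x powr p = K t powr ((q - r) / r * p) * v t x powr r" for x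
        unfolding h_def powr_mult powr_powr p1(2) by (rule mult.commute)
      hence "(\<integral>\<^sup>+x. ennreal (h t x powr p) \<partial>wt_meas a) = ennreal (K t powr ((q - r) / r * p)) * N n t"
        unfolding Nv by (simp add: ennreal_mult nn_integral_cmult)
      also have "\<dots> = ennreal (K t powr (p * (q - 1) / r))"
      proof (cases "K t = 0")
        case False
        have "p * (q - 1) / r = (q - r) / r * p + 1" using r by (simp add: p field_simps)
        hence "K t powr ((q - r) / r * p) * K t = K t powr (p * (q - 1) / r)" using K0[of t] by (simp only: powr_add) simp
        thus ?thesis using K0[of t] by (simp add: NK ennreal_mult[symmetric])
      qed (simp add: NK)
      finally show ?thesis .
    qed
    \<comment> \<open>The extremiser with the conjugate phase of u, so that G u = v h. Where u = 0
      the quotient is 0 by the division convention, in agreement with h = 0.\<close>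
    define G where "G t x = complex_of_real (h t x) * (cnj (u t x) / of_real (norm (u t x)))" for t x
    have Gm [measurable]: "(\<lambda>z. G (fst z) (snd z)) \<in> borel_measurable (borel \<Otimes>\<^sub>M borel)" unfolding G_def h_def by measurable
    have Gm' [measurable]: "G t \<in> borel_measurable borel" for t unfolding G_def h_def by measurable
    have nG: "norm (G t x) = h t x" for t x
      using h0[of t x] by (cases "u t x = 0") (auto simp: G_def norm_mult norm_divide h_def v_def)
    have Gu: "G t x * u t x = of_real (v t x * h t x)" for t x
    proof (cases "u t x = 0 \<or> x > real n \<or> t \<notin> S n")
      case True
      thus ?thesis by (auto simp: G_def h_def v_def)
    next
      case False
      have "cnj (u t x) * u t x = of_real (norm (u t x)) * of_real (norm (u t x))"
        by (metis complex_norm_square mult.commute of_real_mult power2_eq_square)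
      hence e: "cnj (u t x) / of_real (norm (u t x)) * u t x = of_real (norm (u t x))" using False by (simp add: field_simps)
      have "v t x = norm (u t x)" using False by (simp add: v_def)
      thus ?thesis unfolding G_def mult.assoc e by simp
    qed
    \<comment> \<open>On a set of finite measure the p-th power plus 1 dominates h for p > 1. This
      supplies the integrability that the pairing lemma demands.\<close>
    have hle: "ennreal (h t x) \<le> ennreal (h t x powr p) + indicator {..real n} x * indicator {- real n..real n} t" for t x
    proof (cases "h t x \<le> 1")
      case True
      show ?thesis
      proof (cases "x \<le> real n \<and> t \<in> S n")
        case True
        hence i: "indicator {..real n} x * indicator {- real n..real n} t = (1::ennreal)" by (auto simp: S_def indicator_def)
        show ?thesis unfolding i using \<open>h t x \<le> 1\<close> by (intro add_increasing) (auto simp: ennreal_le_1)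
      next
        case False
        hence "h t x = 0" by (auto simp: h_def v_def)
        thus ?thesis by simp
      qed
    next
      case False
      hence "h t x powr 1 \<le> h t x powr p" using p1 by (intro powr_mono) auto
      thus ?thesis using False by (intro add_increasing2 ennreal_leI) auto
    qed
    have hint: "(\<integral>\<^sup>+x. ennreal (norm (G t x)) \<partial>wt_meas a) \<le> ennreal (K t powr (p * (q - 1) / r)) + w * indicator {- real n..real n} t" for t
    proof -
      have "(\<integral>\<^sup>+x. ennreal (norm (G t x)) \<partial>wt_meas a) \<le> (\<integral>\<^sup>+x. ennreal (h t x powr p) + indicator {..real n} x * indicator {- real n..real n} t \<partial>wt_meas a)"
        unfolding nG by (intro nn_integral_mono hle)
      also have "\<dots> = ennreal (K t powr (p * (q - 1) / r)) + w * indicator {- real n..real n} t"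
        by (simp add: nn_integral_add hp nn_integral_multc w_def)
      finally show ?thesis .
    qed
    define J where "J = (\<integral>\<^sup>+t. ennreal (K t powr (q/r)) \<partial>lborel)"
    have Jfin: "J < top" unfolding J_def by (rule Kfin[OF qr(2)])
    have "ennreal (norm (\<integral>t. (\<integral>x. G t x * schr a t f x \<partial>wt_meas a) \<partial>lborel)) \<le> R *
      enn_powr (\<integral>\<^sup>+t. enn_powr (wnorm a p (G t)) (q / (q - 1)) \<partial>lborel) ((q - 1) / q)"
      unfolding R_def
    proof (rule schr_pairing[OF a r p q H f Gm])
      show "integrable (wt_meas a) (G t)" for t
        unfolding integrable_iff_bounded using order_le_less_trans[OF hint[of t]] w
        by (auto simp: measurable_wt_meas ennreal_mult_less_top indicator_def)
      show "1 / real (Suc n) > 0" by simp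
      show "G t x = 0" if "\<bar>t\<bar> < 1 / real (Suc n)" for t x
        using that by (simp add: G_def h_def v_def S_def)
      have pos: "p * (q - 1) / r > 0" using p1 q r by simp
      have "(\<integral>\<^sup>+t. (\<integral>\<^sup>+x. ennreal (norm (G t x)) \<partial>wt_meas a) \<partial>lborel) \<le> (\<integral>\<^sup>+t. ennreal (K t powr (p * (q - 1) / r)) + w * indicator {- real n..real n} t \<partial>lborel)"
        by (intro nn_integral_mono hint)
      also have "\<dots> = (\<integral>\<^sup>+t. ennreal (K t powr (p * (q - 1) / r)) \<partial>lborel) + w * ennreal (2 * real n)"
        by (subst nn_integral_add, simp, simp, subst nn_integral_cmult_indicator) auto
      also have "\<dots> < top" using Kfin[OF pos] w by (simp add: ennreal_mult_less_top)
      finally show "(\<integral>\<^sup>+t. (\<integral>\<^sup>+x. ennreal (norm (G t x)) \<partial>wt_meas a) \<partial>lborel) < top" .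
    qed
    moreover have "(\<integral>t. (\<integral>x. G t x * schr a t f x \<partial>wt_meas a) \<partial>lborel) = of_real (enn2real J)"
    proof -
      have "(\<integral>x. G t x * schr a t f x \<partial>wt_meas a) = of_real (K t powr (q/r))" for t
      proof -
        have "(\<integral>x. v t x * h t x \<partial>wt_meas a) = K t powr (q/r)"
          by (rule has_bochner_integral_integral_eq, rule has_bochner_integral_nn_integral) (auto simp: vh v0 h0 measurable_wt_meas)
        thus ?thesis unfolding u_def[symmetric] Gu integral_complex_of_real by simp
      qed
      moreover have "(\<integral>t. K t powr (q/r) \<partial>lborel) = enn2real J"
        by (rule has_bochner_integral_integral_eq, rule has_bochner_integral_nn_integral) (use Jfin in \<open>auto simp: J_def\<close>)
      ultimately show ?thesis by (simp only: integral_complex_of_real)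
    qed
    moreover have "(\<integral>\<^sup>+t. enn_powr (wnorm a p (G t)) (q / (q - 1)) \<partial>lborel) = J"
    proof -
      have "p * c / r * (1 / p * (q / c)) = q / r" if "c \<noteq> 0" for c using that p1(1) by simp
      from this[of "q - 1"] have "p * (q - 1) / r * (1 / p * (q / (q - 1))) = q / r" using q(2) by simp
      hence "p * (q - 1) / r * (1 / p) * (q / (q - 1)) = q / r" by (simp only: mult.assoc)
      thus ?thesis unfolding J_def nG hp by (simp only: enn_powr_powr enn_powr_ennreal powr_ge_zero powr_powr)
    qed
    \<comment> \<open>Both the pairing and the q'-integral of the norms of G equal J, so the
      estimate reads J <= R J^(1 - 1/q); J is finite by truncation.\<close>
    ultimately have main: "ennreal (norm (complex_of_real (enn2real J))) \<le> R * enn_powr J ((q - 1) / q)" by (simp only:)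
    obtain j where j: "J = ennreal j" "j \<ge> 0" using Jfin by (cases J) auto
    have NJ: "(\<integral>\<^sup>+t. enn_powr (N n t) (q/r) \<partial>lborel) = J" by (simp add: NK K0 J_def)
    show ?thesis
    proof (cases "j = 0 \<or> R = top")
      case True
      thus ?thesis unfolding NJ using j by auto
    next
      case False
      then obtain b where b: "R = ennreal b" "b \<ge> 0" "j > 0" using j by (cases R) auto
      have "j \<le> b * j powr ((q - 1) / q)" using main j b by (simp add: ennreal_mult[symmetric])
      moreover have "j = j powr (1/q) * j powr ((q - 1) / q)"
      proof -
        have "1/q + (q - 1) / q = 1" using q by (simp add: field_simps)
        thus ?thesis using b by (simp flip: powr_add)
      qed
      ultimately have "j powr (1/q) * j powr ((q - 1) / q) \<le> b * j powr ((q - 1) / q)" by simp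
      hence "j powr (1/q) \<le> b" using b by simp
      thus ?thesis unfolding NJ using j b by simp
    qed
  qed
  define U where "U t = (\<integral>\<^sup>+x. ennreal (norm (u t x) powr r) \<partial>wt_meas a)" for t
  have incS: "indicator (S n) t \<le> (indicator (S (Suc n)) t :: ennreal)" for n t
  proof -
    have "1 / real (Suc (Suc n)) \<le> 1 / real (Suc n)" by (intro divide_left_mono) auto
    thus ?thesis by (auto simp: S_def indicator_def)
  qed
  \<comment> \<open>The sets \<open>S n\<close> exhaust all times except t = 0, a null set.\<close>
  have Nsup: "U t = (SUP n. N n t)" if t: "t \<noteq> 0" for t
  proof (rule antisym)
    have "U t = (\<integral>\<^sup>+x. (SUP n. ennreal (norm (u t x) powr r) * indicator {..real n} x) \<partial>wt_meas a)"
      unfolding U_def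
    proof (rule nn_integral_cong, rule antisym)
      fix x
      obtain n :: nat where "x \<le> real n" using real_arch_simple by blast
      hence "ennreal (norm (u t x) powr r) = ennreal (norm (u t x) powr r) * indicator {..real n} x" by simp
      also have "\<dots> \<le> (SUP n. ennreal (norm (u t x) powr r) * indicator {..real n} x)" by (rule SUP_upper) simp
      finally show "ennreal (norm (u t x) powr r) \<le> (SUP n. ennreal (norm (u t x) powr r) * indicator {..real n} x)" .
      show "(SUP n. ennreal (norm (u t x) powr r) * indicator {..real n} x) \<le> ennreal (norm (u t x) powr r)"
        by (rule SUP_least) (auto simp: indicator_def)
    qed
    also have "\<dots> = (SUP n. (\<integral>\<^sup>+x. ennreal (norm (u t x) powr r) * indicator {..real n} x \<partial>wt_meas a))"
      by (rule nn_integral_monotone_convergence_SUP) (auto simp: incseq_def le_fun_def indicator_def measurable_wt_meas)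
    also have "\<dots> \<le> (SUP n. N n t)"
    proof (rule SUP_least)
      fix n
      obtain k1 :: nat where k1: "1 / \<bar>t\<bar> \<le> real k1" using real_arch_simple by blast
      obtain k2 :: nat where k2: "\<bar>t\<bar> \<le> real k2" using real_arch_simple by blast
      define k where "k = max n (max k1 k2)"
      have "1 / \<bar>t\<bar> \<le> real (Suc k)" using k1 by (simp add: k_def)
      hence "1 / real (Suc k) \<le> \<bar>t\<bar>" using t by (simp add: field_simps)
      hence "t \<in> S k" using k2 by (auto simp: S_def k_def)
      hence "N k t = (\<integral>\<^sup>+x. ennreal (norm (u t x) powr r) * indicator {..real k} x \<partial>wt_meas a)" by (simp add: N_def)
      moreover have "(\<integral>\<^sup>+x. ennreal (norm (u t x) powr r) * indicator {..real n} x \<partial>wt_meas a) \<le> (\<integral>\<^sup>+x. ennreal (norm (u t x) powr r) * indicator {..real k} x \<partial>wt_meas a)"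
        by (intro nn_integral_mono) (auto simp: indicator_def k_def)
      ultimately show "(\<integral>\<^sup>+x. ennreal (norm (u t x) powr r) * indicator {..real n} x \<partial>wt_meas a) \<le> (SUP n. N n t)"
        by (intro order_trans[OF _ SUP_upper[of k]]) simp_all
    qed
    finally show "U t \<le> (SUP n. N n t)" .
    show "(SUP n. N n t) \<le> U t"
    proof (rule SUP_least)
      fix n
      have "N n t \<le> (\<integral>\<^sup>+x. ennreal (norm (u t x) powr r) * indicator {..real n} x \<partial>wt_meas a)"
        by (auto simp: N_def indicator_def)
      also have "\<dots> \<le> U t" unfolding U_def by (intro nn_integral_mono) (auto simp: indicator_def)
      finally show "N n t \<le> U t" .
    qed
  qed
  have "(\<integral>\<^sup>+t. enn_powr (enn_powr (U t) (1/r)) q \<partial>lborel) = (\<integral>\<^sup>+t. (SUP n. enn_powr (N n t) (q/r)) \<partial>lborel)"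
  proof (rule nn_integral_cong_AE)
    show "AE t in lborel. enn_powr (enn_powr (U t) (1/r)) q = (SUP n. enn_powr (N n t) (q/r))"
      using AE_lborel_singleton[of 0]
      by eventually_elim (use qr in \<open>simp add: enn_powr_powr Nsup enn_powr_SUP\<close>)
  qed
  also have "\<dots> = (SUP n. (\<integral>\<^sup>+t. enn_powr (N n t) (q/r) \<partial>lborel))"
  proof (rule nn_integral_monotone_convergence_SUP)
    show "incseq (\<lambda>n t. enn_powr (N n t) (q/r))"
    proof (intro incseq_SucI le_funI enn_powr_mono)
      fix n t
      show "N n t \<le> N (Suc n) t" unfolding N_def
        by (intro mult_mono incS nn_integral_mono) (auto simp: indicator_def)
    qed (use qr in auto)
  qed auto
  also have "\<dots> \<le> enn_powr R q"
  proof (rule SUP_least)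
    fix n
    have "enn_powr (enn_powr (\<integral>\<^sup>+t. enn_powr (N n t) (q/r) \<partial>lborel) (1/q)) q \<le> enn_powr R q"
      using q by (intro enn_powr_mono trunc) auto
    thus "(\<integral>\<^sup>+t. enn_powr (N n t) (q/r) \<partial>lborel) \<le> enn_powr R q" using q by (simp add: enn_powr_powr)
  qed
  finally have "enn_powr (\<integral>\<^sup>+t. enn_powr (enn_powr (U t) (1/r)) q \<partial>lborel) (1/q) \<le> enn_powr (enn_powr R q) (1/q)"
    using q by (intro enn_powr_mono) auto
  thus ?thesis using q by (simp add: enn_powr_powr U_def u_def R_def)
qed

text \<open>Minkowski in space, decay for each s distinct from t, fractional integration in time.
  \<open>D\<close> integrates absolute values over all s, so it dominates the Duhamel integral for
  either sign of t.\<close>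

lemma strichartz_inhomogeneous:
  assumes a: "a \<ge> 0" and r: "r > 2" and p: "p = r / (r - 1)" and q: "2 / q = (a + 1) * (1/2 - 1/r)" "q > 2"
    and H: "hls_const q H"
    and Gm [measurable]: "(\<lambda>z. G (fst z) (snd z)) \<in> borel_measurable (borel \<Otimes>\<^sub>M borel)"
    and Gi: "\<And>t. integrable (wt_meas a) (G t)"
  defines "D \<equiv> \<lambda>t x. (\<integral>\<^sup>+s. ennreal (norm (schr a (t - s) (G s) x)) \<partial>lborel)"
  shows "enn_powr (\<integral>\<^sup>+t. enn_powr (enn_powr (\<integral>\<^sup>+x. enn_powr (D t x) r \<partial>wt_meas a) (1/r)) q \<partial>lborel) (1/q) \<le>
    ennreal (decay_const a r * H powr (1/q)) *
    enn_powr (\<integral>\<^sup>+t. enn_powr (wnorm a p (G t)) (q / (q - 1)) \<partial>lborel) ((q - 1) / q)"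
proof -
  interpret W: sigma_finite_measure "wt_meas a" by (rule sigma_finite_wt_meas)
  note [measurable (raw)] = measurable_compose2[OF Gm]
  define \<gamma> where "\<gamma> t = wnorm a p (G t)" for t
  have \<gamma>m [measurable]: "\<gamma> \<in> borel_measurable borel" unfolding \<gamma>_def by measurable
  define c where "c = decay_const a r"
  have c: "c > 0" unfolding c_def by (rule decay_const_pos[OF a r])
  have sl: "enn_powr (\<integral>\<^sup>+x. enn_powr (D t x) r \<partial>wt_meas a) (1/r) \<le> ennreal c * riesz (2/q) \<gamma> t" for t
  proof -
    have "enn_powr (\<integral>\<^sup>+x. enn_powr (D t x) r \<partial>wt_meas a) (1/r) \<le> (\<integral>\<^sup>+s. enn_powr (\<integral>\<^sup>+x. enn_powr (ennreal (norm (schr a (t - s) (G s) x))) r \<partial>wt_meas a) (1/r) \<partial>lborel)"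
      unfolding D_def
    proof (rule nn_Minkowski[OF sigma_finite_wt_meas])
      show "(\<lambda>(x, s). ennreal (norm (schr a (t - s) (G s) x))) \<in> borel_measurable (wt_meas a \<Otimes>\<^sub>M lborel)" unfolding schr_def by measurable
    qed (use r in simp)
    also have "\<dots> \<le> (\<integral>\<^sup>+s. ennreal c * (ennreal (\<bar>t - s\<bar> powr (- (2/q))) * \<gamma> s) \<partial>lborel)"
    proof (rule nn_integral_mono_AE)
      have pw: "enn_powr (\<integral>\<^sup>+x. enn_powr (ennreal (norm (schr a (t - s) (G s) x))) r \<partial>wt_meas a) (1/r) \<le> ennreal c * (ennreal (\<bar>t - s\<bar> powr (- (2/q))) * \<gamma> s)" if "s \<noteq> t" for s
      proof -
        have "enn_powr (\<integral>\<^sup>+x. enn_powr (ennreal (norm (schr a (t - s) (G s) x))) r \<partial>wt_meas a) (1/r) \<le> ennreal (decay_const a r * \<bar>t - s\<bar> powr (- (2/q))) * \<gamma> s"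
          using schr_decay[OF a r p q(1) _ Gi, of "t - s" s] that by (simp add: \<gamma>_def)
        also have "\<dots> = ennreal c * (ennreal (\<bar>t - s\<bar> powr (- (2/q))) * \<gamma> s)" using c by (simp add: c_def ennreal_mult mult.assoc)
        finally show ?thesis .
      qed
      show "AE s in lborel. enn_powr (\<integral>\<^sup>+x. enn_powr (ennreal (norm (schr a (t - s) (G s) x))) r \<partial>wt_meas a) (1/r) \<le> ennreal c * (ennreal (\<bar>t - s\<bar> powr (- (2/q))) * \<gamma> s)"
        using AE_lborel_singleton[of t] by eventually_elim (rule pw)
    qed
    also have "\<dots> = ennreal c * riesz (2/q) \<gamma> t" unfolding riesz_def by (simp add: nn_integral_cmult)
    finally show ?thesis .
  qed
  have "(\<integral>\<^sup>+t. enn_powr (enn_powr (\<integral>\<^sup>+x. enn_powr (D t x) r \<partial>wt_meas a) (1/r)) q \<partial>lborel) \<le> (\<integral>\<^sup>+t. enn_powr (ennreal c * riesz (2/q) \<gamma> t) q \<partial>lborel)"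
    using q by (intro nn_integral_mono enn_powr_mono sl) auto
  also have "\<dots> = ennreal (c powr q) * (\<integral>\<^sup>+t. enn_powr (riesz (2/q) \<gamma> t) q \<partial>lborel)"
    using c by (simp add: enn_powr_mult nn_integral_cmult)
  also have "\<dots> \<le> ennreal (c powr q) * (ennreal H * enn_powr (\<integral>\<^sup>+s. enn_powr (\<gamma> s) (q / (q - 1)) \<partial>lborel) (q - 1))"
    using H by (intro mult_left_mono) (auto simp: hls_const_def)
  finally have "enn_powr (\<integral>\<^sup>+t. enn_powr (enn_powr (\<integral>\<^sup>+x. enn_powr (D t x) r \<partial>wt_meas a) (1/r)) q \<partial>lborel) (1/q) \<le>
    enn_powr (ennreal (c powr q) * (ennreal H * enn_powr (\<integral>\<^sup>+s. enn_powr (\<gamma> s) (q / (q - 1)) \<partial>lborel) (q - 1))) (1/q)"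
    using q by (intro enn_powr_mono) auto
  also have "\<dots> = ennreal (c * H powr (1/q)) * enn_powr (\<integral>\<^sup>+s. enn_powr (\<gamma> s) (q / (q - 1)) \<partial>lborel) ((q - 1) / q)"
    using c q H by (simp add: hls_const_def enn_powr_mult enn_powr_powr powr_powr ennreal_mult mult.assoc)
  finally show ?thesis by (simp add: \<gamma>_def c_def)
qed


section \<open>Passage to the stated norms, kernel and function classes\<close>

lemma Lnorm_eq_wt_meas:
  assumes [measurable]: "g \<in> borel_measurable borel" and g: "\<And>x. x > 0 \<Longrightarrow> g x = f x"
  shows "Lnorm r a f = wnorm a r g"
proof -
  have "(\<integral>\<^sup>+x. ennreal (norm (g x) powr r) \<partial>wt_meas a) = (\<integral>\<^sup>+x. ennreal (indicator {0<..} x * x powr a) * ennreal (norm (g x) powr r) \<partial>lborel)"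
    by (rule nn_integral_wt_meas) measurable
  also have "\<dots> = (\<integral>\<^sup>+x\<in>{0<..}. ennreal (norm (f x) powr r * x powr a) \<partial>lborel)"
    by (intro nn_integral_cong) (auto simp: indicator_def g ennreal_mult mult.commute)
  finally show ?thesis by (simp add: Lnorm_def)
qed

text \<open>Measurability is asked of the majorant \<open>V\<close> alone, so the solution can be
  estimated through a pointwise bound.\<close>

lemma Lnorm_le_wt_meas:
  assumes [measurable]: "V \<in> borel_measurable borel" and V: "\<And>x. x > 0 \<Longrightarrow> ennreal (norm (f x)) \<le> V x" and r: "r > 0"
  shows "Lnorm r a f \<le> enn_powr (\<integral>\<^sup>+x. enn_powr (V x) r \<partial>wt_meas a) (1/r)"
  unfolding Lnorm_def
proof (rule enn_powr_mono)
  have "(\<integral>\<^sup>+x\<in>{0<..}. ennreal (norm (f x) powr r * x powr a) \<partial>lborel) \<le> (\<integral>\<^sup>+x. ennreal (indicator {0<..} x * x powr a) * enn_powr (V x) r \<partial>lborel)"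
  proof (intro nn_integral_mono)
    fix x
    show "ennreal (norm (f x) powr r * x powr a) * indicator {0<..} x \<le> ennreal (indicator {0<..} x * x powr a) * enn_powr (V x) r"
    proof (cases "x > 0")
      case True
      have "ennreal (norm (f x) powr r) \<le> enn_powr (V x) r"
        using enn_powr_mono[of r, OF _ V[OF True]] r by simp
      hence "ennreal (x powr a) * ennreal (norm (f x) powr r) \<le> ennreal (x powr a) * enn_powr (V x) r"
        by (rule mult_left_mono) simp
      thus ?thesis using True by (simp add: ennreal_mult mult.commute)
    qed auto
  qed
  also have "\<dots> = (\<integral>\<^sup>+x. enn_powr (V x) r \<partial>wt_meas a)"
    by (rule nn_integral_wt_meas[symmetric]) measurable
  finally show "(\<integral>\<^sup>+x\<in>{0<..}. ennreal (norm (f x) powr r * x powr a) \<partial>lborel) \<le> (\<integral>\<^sup>+x. enn_powr (V x) r \<partial>wt_meas a)" .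
qed (use r in simp)

text \<open>At t = 0 the two sides differ: \<open>Sa\<close> is the identity there while
  \<open>kern\<close> vanishes. That time is later discarded as a null set.\<close>

lemma Sa_eq_schr:
  assumes a: "a \<ge> 0" and x: "x > 0" and t: "t \<noteq> 0"
    and [measurable]: "g \<in> borel_measurable borel" and g: "\<And>y. y > 0 \<Longrightarrow> g y = f y"
  shows "Sa a t f x = schr a t g x"
proof -
  have "schr a t g x = (\<integral>y. (indicator {0<..} y * y powr a) *\<^sub>R (kern a t x y * g y) \<partial>lborel)"
    unfolding schr_def by (rule integral_wt_meas) measurable
  also have "\<dots> = (\<integral>y. indicator {0<..} y *\<^sub>R (Skernel a x y t * f y * complex_of_real (y powr a)) \<partial>lborel)"
    by (intro Bochner_Integration.integral_cong refl)
      (auto simp: indicator_def g Skernel_eq_kern[OF a x _ t] scaleR_conv_of_real mult_ac)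
  finally show ?thesis using t by (simp add: Sa_def set_lebesgue_integral_def)
qed

text \<open>The sign of the oriented integral for v < u disappears in the norm, and enlarging the
  domain to the whole line removes the endpoints.\<close>

lemma norm_interval_integral_le:
  fixes h :: "real \<Rightarrow> complex"
  shows "ennreal (norm (LBINT s=ereal u..ereal v. h s)) \<le> (\<integral>\<^sup>+s. ennreal (norm (h s)) \<partial>lborel)"
proof -
  have "ennreal (norm (LBINT s:A. h s)) \<le> (\<integral>\<^sup>+s. ennreal (norm (h s)) \<partial>lborel)" for A
  proof -
    have "ennreal (norm (LBINT s:A. h s)) \<le> (\<integral>\<^sup>+s. ennreal (norm (indicator A s *\<^sub>R h s)) \<partial>lborel)"
      unfolding set_lebesgue_integral_def by (rule norm_integral_le_nn_integral)
    also have "\<dots> \<le> (\<integral>\<^sup>+s. ennreal (norm (h s)) \<partial>lborel)"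
      by (intro nn_integral_mono) (auto simp: indicator_def)
    finally show ?thesis .
  qed
  thus ?thesis by (simp add: interval_lebesgue_integral_def)
qed

text \<open>On x < 1 the weight x^a is at most 1 because a >= 0. On x >= 1, M >= a + 2 gives x^a <=
  x^(-2) x^M, and x^(-2) is integrable there.\<close>

lemma integrable_wt_measI:
  fixes g :: "real \<Rightarrow> complex"
  assumes a: "a \<ge> 0" and M: "real M \<ge> a + 2" and [measurable]: "g \<in> borel_measurable borel"
    and g: "\<And>x. x > 0 \<Longrightarrow> (1 + x ^ M) * norm (g x) \<le> B"
  shows "integrable (wt_meas a) g"
  unfolding integrable_iff_bounded
proof
  show "g \<in> borel_measurable (wt_meas a)" by (simp add: measurable_wt_meas)
  have "(1 + 1 ^ M) * norm (g 1) \<le> B" by (rule g) simp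
  hence B: "B \<ge> 0" by (smt (verit) norm_ge_zero mult_nonneg_nonneg one_le_power zero_le_power)
  define T where "T x = ennreal (\<bar>0 - x\<bar> powr (- 2)) * indicator {x. \<bar>0 - x\<bar> \<ge> 1} x" for x :: real
  have Tm [measurable]: "T \<in> borel_measurable borel" unfolding T_def by measurable
  have Ti: "(\<integral>\<^sup>+x. T x \<partial>lborel) = ennreal (2 / 1)"
    unfolding T_def by (rule nn_integral_inverse_square_tail) simp
  have "(\<integral>\<^sup>+x. ennreal (norm (g x)) \<partial>wt_meas a) = (\<integral>\<^sup>+x. ennreal (indicator {0<..} x * x powr a) * ennreal (norm (g x)) \<partial>lborel)"
    by (rule nn_integral_wt_meas) measurable
  also have "\<dots> \<le> (\<integral>\<^sup>+x. ennreal B * (indicator {0..1} x + T x) \<partial>lborel)"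
  proof (intro nn_integral_mono)
    fix x :: real
    show "ennreal (indicator {0<..} x * x powr a) * ennreal (norm (g x)) \<le> ennreal B * (indicator {0..1} x + T x)"
    proof (cases "x > 0")
      case True
      show ?thesis
      proof (cases "x < 1")
        case True
        have "x powr a \<le> 1" using \<open>x > 0\<close> True a powr_mono2[of a x 1] by simp
        moreover have "norm (g x) \<le> (1 + x ^ M) * norm (g x)" using \<open>x > 0\<close> by (simp add: mult_le_cancel_right1)
        ultimately have "x powr a * norm (g x) \<le> 1 * B"
          using g[OF \<open>x > 0\<close>] by (intro mult_mono) auto
        hence "ennreal (x powr a * norm (g x)) \<le> ennreal B * 1" by (simp add: ennreal_leI)
        also have "\<dots> \<le> ennreal B * (indicator {0..1} x + T x)"
          using \<open>x > 0\<close> True by (intro mult_left_mono) (auto simp: indicator_def)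
        finally show ?thesis using \<open>x > 0\<close> by (simp add: ennreal_mult)
      next
        case False
        have "x powr a = x powr (- 2) * x powr (a + 2)" using \<open>x > 0\<close> by (simp flip: powr_add)
        also have "x powr (a + 2) \<le> x powr real M" using M False by (intro powr_mono) auto
        also have "x powr real M = x ^ M" using \<open>x > 0\<close> by (simp add: powr_realpow)
        finally have "x powr a * norm (g x) \<le> x powr (- 2) * x ^ M * norm (g x)"
          by (simp add: mult_left_mono mult_right_mono)
        also have "\<dots> \<le> x powr (- 2) * ((1 + x ^ M) * norm (g x))"
          by (simp add: mult.assoc mult_left_mono algebra_simps)
        also have "\<dots> \<le> x powr (- 2) * B" by (intro mult_left_mono g \<open>x > 0\<close>) auto
        finally have "ennreal (x powr a * norm (g x)) \<le> ennreal (B * x powr (- 2))" by (intro ennreal_leI) (simp add: mult.commute)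
        also have "\<dots> = ennreal B * ennreal (x powr (- 2))" using B by (simp add: ennreal_mult)
        also have "\<dots> \<le> ennreal B * (indicator {0..1} x + T x)"
          using False by (intro mult_left_mono) (auto simp: indicator_def T_def)
        finally show ?thesis using \<open>x > 0\<close> by (simp add: ennreal_mult)
      qed
    qed auto
  qed
  also have "\<dots> = ennreal B * (emeasure lborel {0..1::real} + (\<integral>\<^sup>+x. T x \<partial>lborel))"
    by (simp add: nn_integral_cmult nn_integral_add)
  also have "\<dots> < \<infinity>" unfolding Ti by (simp add: ennreal_mult_less_top)
  finally show "(\<integral>\<^sup>+x. ennreal (norm (g x)) \<partial>wt_meas a) < \<infinity>" .
qed

text \<open>The class constrains phi only on x > 0, so phi may be arbitrary elsewhere. Extension by
  zero makes it Borel on the line and is invisible to the weighted measure.\<close>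

lemma SchwartzPlus_restrict:
  assumes phi: "phi \<in> SchwartzPlus" and a: "a \<ge> 0"
  defines "g \<equiv> \<lambda>x. indicator {0<..} x *\<^sub>R phi x"
  shows "g \<in> borel_measurable borel" "integrable (wt_meas a) g"
proof -
  have diff: "phi differentiable (at x)" if "x > 0" for x
  proof -
    have "((xD ^^ 0) phi) differentiable (at x)" using phi that unfolding SchwartzPlus_def by blast
    thus ?thesis by simp
  qed
  hence "continuous_on {0<..} phi"
    by (intro continuous_at_imp_continuous_on ballI differentiable_imp_continuous_within) auto
  thus m: "g \<in> borel_measurable borel" unfolding g_def by (intro borel_measurable_continuous_on_indicator) auto
  obtain M :: nat where M: "real M \<ge> a + 2" using real_arch_simple by blast
  have bd: "\<exists>B. \<forall>x>0. x ^ n * norm ((xD ^^ 0) phi x) \<le> B" for n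
    using phi unfolding SchwartzPlus_def by blast
  obtain B0 where B0: "\<And>x. x > 0 \<Longrightarrow> norm (phi x) \<le> B0" using bd[of 0] by auto
  obtain B1 where B1: "\<And>x. x > 0 \<Longrightarrow> x ^ M * norm (phi x) \<le> B1" using bd[of M] by auto
  show "integrable (wt_meas a) g"
  proof (rule integrable_wt_measI[OF a M m])
    fix x :: real assume x: "x > 0"
    show "(1 + x ^ M) * norm (g x) \<le> B0 + B1"
      using add_mono[OF B0[OF x] B1[OF x]] x by (simp add: g_def distrib_right)
  qed
qed

lemma SSPlus_restrict:
  assumes F: "F \<in> SSPlus" and a: "a \<ge> 0"
  defines "G \<equiv> \<lambda>t x. indicator {0<..} x *\<^sub>R F x t"
  shows "(\<lambda>z. G (fst z) (snd z)) \<in> borel_measurable (borel \<Otimes>\<^sub>M borel)" "integrable (wt_meas a) (G t)"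
proof -
  have diff: "(\<lambda>z. F (fst z) (snd z)) differentiable (at z)" if "z \<in> {0<..} \<times> UNIV" for z :: "real \<times> real"
  proof -
    obtain x t where z: "z = (x, t)" "x > 0" using \<open>z \<in> _\<close> by (cases z) auto
    have "\<forall>k l. \<forall>x>0. \<forall>t. (\<lambda>z. ((xDx ^^ k) ((Dt ^^ l) F)) (fst z) (snd z)) differentiable (at (x, t))"
      using F unfolding SSPlus_def by blast
    hence "(\<lambda>z. ((xDx ^^ 0) ((Dt ^^ 0) F)) (fst z) (snd z)) differentiable (at (x, t))" using z(2) by blast
    thus ?thesis by (simp add: z(1))
  qed
  hence "continuous_on ({0<..} \<times> UNIV) (\<lambda>z. F (fst z) (snd z))"
    by (intro continuous_at_imp_continuous_on ballI differentiable_imp_continuous_within)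
  hence m0: "(\<lambda>z. indicator ({0<..} \<times> UNIV) z *\<^sub>R F (fst z) (snd z)) \<in> borel_measurable borel"
    by (intro borel_measurable_continuous_on_indicator) (auto intro!: borel_open open_Times)
  have "(\<lambda>z. G (fst z) (snd z)) = (\<lambda>z. indicator ({0<..} \<times> UNIV) z *\<^sub>R F (fst z) (snd z)) \<circ> (\<lambda>z. (snd z, fst z))"
    by (auto simp: G_def indicator_def fun_eq_iff)
  also have "\<dots> \<in> borel_measurable (borel \<Otimes>\<^sub>M borel)"
  proof (rule measurable_comp)
    show "(\<lambda>z. (snd z, fst z)) \<in> (borel \<Otimes>\<^sub>M borel) \<rightarrow>\<^sub>M (borel \<Otimes>\<^sub>M borel)" by measurable
    show "(\<lambda>z. indicator ({0<..} \<times> UNIV) z *\<^sub>R F (fst z) (snd z)) \<in> borel_measurable (borel \<Otimes>\<^sub>M borel)"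
      using m0 by (simp only: borel_prod)
  qed
  finally show mG: "(\<lambda>z. G (fst z) (snd z)) \<in> borel_measurable (borel \<Otimes>\<^sub>M borel)" .
  note [measurable (raw)] = measurable_compose2[OF mG]
  have m: "G t \<in> borel_measurable borel" by measurable
  obtain M :: nat where M: "real M \<ge> a + 2" using real_arch_simple by blast
  \<comment> \<open>With the even index 2M the weight (1 + x^2 + t^2)^M is a polynomial that
    dominates both 1 and x^(2M).\<close>
  have M2: "real (2 * M) \<ge> a + 2" using M a by simp
  obtain B where B: "\<And>x t. x > 0 \<Longrightarrow> (1 + x\<^sup>2 + t\<^sup>2) powr (real (2 * M) / 2) * norm (F x t) \<le> B"
  proof -
    have "\<exists>B. \<forall>k l. k + l \<le> 2 * M \<longrightarrow> (\<forall>x>0. \<forall>t. (1 + x\<^sup>2 + t\<^sup>2) powr (real (2 * M) / 2) * norm (((xDx ^^ k) ((Dt ^^ l) F)) x t) \<le> B)"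
      using F unfolding SSPlus_def by blast
    then obtain B where "\<forall>k l. k + l \<le> 2 * M \<longrightarrow> (\<forall>x>0. \<forall>t. (1 + x\<^sup>2 + t\<^sup>2) powr (real (2 * M) / 2) * norm (((xDx ^^ k) ((Dt ^^ l) F)) x t) \<le> B)" ..
    from this[rule_format, of 0 0] that show ?thesis by auto
  qed
  show "integrable (wt_meas a) (G t)"
  proof (rule integrable_wt_measI[OF a M2 m])
    fix x :: real assume x: "x > 0"
    define T where "T = 1 + x\<^sup>2 + t\<^sup>2"
    have T: "T \<ge> 1" "T \<ge> x\<^sup>2" by (simp_all add: T_def)
    have "1 ^ M \<le> T ^ M" "(x\<^sup>2) ^ M \<le> T ^ M" using T by (intro power_mono; simp)+
    hence "1 + x ^ (2 * M) \<le> 2 * T ^ M" by (simp add: power_mult)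
    moreover have "T powr (real (2 * M) / 2) = T ^ M" using T by (simp add: powr_realpow)
    ultimately have "(1 + x ^ (2 * M)) * norm (F x t) \<le> 2 * (T powr (real (2 * M) / 2) * norm (F x t))"
      using mult_right_mono[of "1 + x ^ (2 * M)" "2 * T ^ M" "norm (F x t)"] by simp
    also have "\<dots> \<le> 2 * B" using B[OF x, of t] by (simp add: T_def)
    finally show "(1 + x ^ (2 * M)) * norm (G t x) \<le> 2 * B" using x by (simp add: G_def)
  qed
qed

text \<open>2 / q < 1 amounts to (a + 1)(r - 2) < 2r. For a > 1 this is exactly the upper bound on
  r; for a <= 1 it is automatic. The strict inequality excludes the endpoint q = 2, where the time
  kernel 1 / |t - s| is not locally integrable.\<close>

lemma admissible_q_gt_2:
  assumes "a \<ge> 0" "admissible a q r"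
  shows "q > 2"
proof -
  have r: "r > 2" and q: "2 / q = (a + 1) * (1/2 - 1/r)" and b: "a > 1 \<Longrightarrow> r < 2 * (a + 1) / (a - 1)"
    using assms(2) by (auto simp: admissible_def)
  have "(a + 1) * (1/2 - 1/r) > 0" using assms(1) r by (intro mult_pos_pos) auto
  hence "q > 0" using q by (metis zero_less_divide_iff zero_less_numeral not_numeral_less_zero)
  have "(a + 1) * (r - 2) < 2 * r"
  proof (cases "a > 1")
    case True
    hence "r * (a - 1) < 2 * (a + 1)" using b by (simp add: field_simps)
    thus ?thesis by (simp add: algebra_simps)
  next
    case False
    hence "(a + 1) * (r - 2) \<le> 2 * (r - 2)" using r by (intro mult_right_mono) auto
    thus ?thesis by simp
  qed
  hence "(a + 1) * (1/2 - 1/r) < 1" using r by (simp add: field_simps)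
  hence "2 / q < 1" by (simp only: q)
  thus "q > 2" using \<open>q > 0\<close> by (simp add: divide_less_eq)
qed

theorem theoremT:
  fixes a q r :: real
  assumes "a \<ge> 0" and "admissible a q r"
  shows "\<exists>C>0. \<forall>phi \<in> SchwartzPlus. \<forall>F \<in> SSPlus.
           mixed_norm q r a (sol a phi F)
             \<le> ennreal C * (Lnorm 2 a phi + mixed_norm (conj_exp q) (conj_exp r) a F)"
proof -
  note a = assms(1)
  have r: "r > 2" and q: "2 / q = (a + 1) * (1/2 - 1/r)" using assms(2) by (auto simp: admissible_def)
  have q2: "q > 2" by (rule admissible_q_gt_2[OF assms])
  define p where "p = r / (r - 1)"
  obtain H where H: "hls_const q H"
    using hardy_littlewood_sobolev[OF q2] by blast
  \<comment> \<open>The constant of the Duhamel term; TT* gives its square root \<open>c1\<close>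
    for the free term.\<close>
  define c2 where "c2 = decay_const a r * H powr (1/q)"
  define c1 where "c1 = c2 powr (1/2)"
  have c: "c1 > 0" "c2 > 0" using decay_const_pos[OF a r] H by (auto simp: c1_def c2_def hls_const_def)
  show ?thesis
  \<comment> \<open>16 = 4 * 4: one factor from separating the two terms in L^r over x, the other
    from separating them in L^q over t.\<close>
  proof (intro exI[of _ "16 * (c1 + c2)"] conjI ballI)
    show "16 * (c1 + c2) > 0" using c by simp
    fix phi F assume phi: "phi \<in> SchwartzPlus" and F: "F \<in> SSPlus"
    define f where "f x = indicator {0<..} x *\<^sub>R phi x" for x
    define G where "G t x = indicator {0<..} x *\<^sub>R F x t" for t x
    have fm [measurable]: "f \<in> borel_measurable borel" and fi: "integrable (wt_meas a) f"
      unfolding f_def[abs_def] by (rule SchwartzPlus_restrict[OF phi a])+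
    have Gm: "(\<lambda>z. G (fst z) (snd z)) \<in> borel_measurable (borel \<Otimes>\<^sub>M borel)" and Gi: "integrable (wt_meas a) (G t)" for t
      unfolding G_def[abs_def] by (rule SSPlus_restrict[OF F a])+
    note [measurable (raw)] = measurable_compose2[OF Gm]
    interpret W: sigma_finite_measure "wt_meas a" by (rule sigma_finite_wt_meas)
    define D where "D t x = (\<integral>\<^sup>+s. ennreal (norm (schr a (t - s) (G s) x)) \<partial>lborel)" for t x
    define A where "A t = wnorm a r (schr a t f)" for t
    define B where "B t = enn_powr (\<integral>\<^sup>+x. enn_powr (D t x) r \<partial>wt_meas a) (1/r)" for t
    have Am [measurable]: "A \<in> borel_measurable borel" unfolding A_def schr_def by measurable
    have Bm [measurable]: "B \<in> borel_measurable borel" unfolding B_def D_def schr_def by measurable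
    have Dm [measurable]: "D t \<in> borel_measurable borel" for t unfolding D_def schr_def by measurable
    have pw: "ennreal (norm (sol a phi F x t)) \<le> ennreal (norm (schr a t f x)) + D t x" if x: "x > 0" and t: "t \<noteq> 0" for x t
    proof -
      have "Sa a t phi x = schr a t f x" by (rule Sa_eq_schr[OF a x t fm]) (simp add: f_def)
      moreover have "ennreal (norm (LBINT s=ereal 0..ereal t. Sa a (t - s) (\<lambda>y. F y s) x)) \<le> D t x"
      proof -
        have "ennreal (norm (LBINT s=ereal 0..ereal t. Sa a (t - s) (\<lambda>y. F y s) x)) \<le> (\<integral>\<^sup>+s. ennreal (norm (Sa a (t - s) (\<lambda>y. F y s) x)) \<partial>lborel)"
          by (rule norm_interval_integral_le)
        also have "\<dots> \<le> D t x"
          unfolding D_def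
        proof (rule nn_integral_mono_AE)
          have "Sa a (t - s) (\<lambda>y. F y s) x = schr a (t - s) (G s) x" if "s \<noteq> t" for s
            using that by (intro Sa_eq_schr[OF a x]) (auto simp: G_def)
          thus "AE s in lborel. ennreal (norm (Sa a (t - s) (\<lambda>y. F y s) x)) \<le> ennreal (norm (schr a (t - s) (G s) x))"
            using AE_lborel_singleton[of t] by (auto elim!: eventually_mono)
        qed
        finally show ?thesis .
      qed
      moreover have "ennreal (norm (sol a phi F x t)) \<le> ennreal (norm (Sa a t phi x)) + ennreal (norm (LBINT s=ereal 0..ereal t. Sa a (t - s) (\<lambda>y. F y s) x))"
        unfolding sol_def using ennreal_leI[OF norm_triangle_ineq] by (simp only: ennreal_plus[OF norm_ge_zero norm_ge_zero])
      ultimately show ?thesis by (metis add_left_mono order_trans)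
    qed
    have sl: "Lnorm r a (\<lambda>x. sol a phi F x t) \<le> 4 * A t + 4 * B t" if t: "t \<noteq> 0" for t
    proof -
      have "Lnorm r a (\<lambda>x. sol a phi F x t) \<le> enn_powr (\<integral>\<^sup>+x. enn_powr (ennreal (norm (schr a t f x)) + D t x) r \<partial>wt_meas a) (1/r)"
        using r pw t by (intro Lnorm_le_wt_meas) auto
      also have "\<dots> \<le> 4 * (enn_powr (\<integral>\<^sup>+x. enn_powr (ennreal (norm (schr a t f x))) r \<partial>wt_meas a) (1/r) + enn_powr (\<integral>\<^sup>+x. enn_powr (D t x) r \<partial>wt_meas a) (1/r))"
        using r by (intro enn_norm_add) auto
      also have "\<dots> = 4 * A t + 4 * B t" by (simp add: A_def B_def distrib_left)
      finally show ?thesis .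
    qed
    have scale: "enn_powr (\<integral>\<^sup>+t. enn_powr (4 * X t) q \<partial>lborel) (1/q) = 4 * enn_powr (\<integral>\<^sup>+t. enn_powr (X t) q \<partial>lborel) (1/q)"
      if [measurable]: "X \<in> borel_measurable borel" for X :: "real \<Rightarrow> ennreal"
    proof -
      have 4: "(4::ennreal) = ennreal 4" by simp
      show ?thesis unfolding 4 using q2 by (simp add: enn_powr_mult nn_integral_cmult powr_powr del: ennreal_numeral)
    qed
    \<comment> \<open>The slice bound holds for t distinct from 0, which suffices for the time
      integral.\<close>
    have "mixed_norm q r a (sol a phi F) \<le> enn_powr (\<integral>\<^sup>+t. enn_powr (4 * A t + 4 * B t) q \<partial>lborel) (1/q)"
      unfolding mixed_norm_def
    proof (rule enn_powr_mono, use q2 in simp, rule nn_integral_mono_AE)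
      show "AE t in lborel. enn_powr (Lnorm r a (\<lambda>x. sol a phi F x t)) q \<le> enn_powr (4 * A t + 4 * B t) q"
        using AE_lborel_singleton[of 0] by eventually_elim (use q2 in \<open>auto intro!: enn_powr_mono sl\<close>)
    qed
    also have "\<dots> \<le> 4 * (enn_powr (\<integral>\<^sup>+t. enn_powr (4 * A t) q \<partial>lborel) (1/q) + enn_powr (\<integral>\<^sup>+t. enn_powr (4 * B t) q \<partial>lborel) (1/q))"
      using q2 by (intro enn_norm_add) auto
    also have "\<dots> = 16 * (enn_powr (\<integral>\<^sup>+t. enn_powr (A t) q \<partial>lborel) (1/q) + enn_powr (\<integral>\<^sup>+t. enn_powr (B t) q \<partial>lborel) (1/q))"
      unfolding scale[OF Am] scale[OF Bm] distrib_left[symmetric] mult.assoc[symmetric] by simp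
    also have "\<dots> \<le> 16 * (ennreal c1 * Lnorm 2 a phi + ennreal c2 * mixed_norm (conj_exp q) (conj_exp r) a F)"
    proof (intro mult_left_mono add_mono)
      have "Lnorm 2 a phi = enn_powr (wsq a f) (1/2)"
        by (subst Lnorm_eq_wt_meas[OF fm]) (simp_all add: f_def powr_2_eq_power2)
      thus "enn_powr (\<integral>\<^sup>+t. enn_powr (A t) q \<partial>lborel) (1/q) \<le> ennreal c1 * Lnorm 2 a phi"
        using strichartz_homogeneous[OF a r p_def q q2 H fi] by (simp only: A_def c1_def c2_def)
      have "Lnorm p a (\<lambda>x. F x t) = wnorm a p (G t)" for t
      proof (rule Lnorm_eq_wt_meas)
        show "G t \<in> borel_measurable borel" by measurable
      qed (simp add: G_def)
      moreover have "1 / (q / (q - 1)) = (q - 1) / q" by simp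
      ultimately have "mixed_norm (conj_exp q) (conj_exp r) a F = enn_powr (\<integral>\<^sup>+t. enn_powr (wnorm a p (G t)) (q / (q - 1)) \<partial>lborel) ((q - 1) / q)"
        by (simp only: mixed_norm_def conj_exp_def p_def)
      thus "enn_powr (\<integral>\<^sup>+t. enn_powr (B t) q \<partial>lborel) (1/q) \<le> ennreal c2 * mixed_norm (conj_exp q) (conj_exp r) a F"
        using strichartz_inhomogeneous[OF a r p_def q q2 H Gm Gi] by (simp only: B_def D_def c2_def)
    qed auto
    also have "\<dots> \<le> 16 * (ennreal (c1 + c2) * Lnorm 2 a phi + ennreal (c1 + c2) * mixed_norm (conj_exp q) (conj_exp r) a F)"
      using c by (intro mult_left_mono add_mono mult_right_mono ennreal_leI) auto
    also have "\<dots> = ennreal (16 * (c1 + c2)) * (Lnorm 2 a phi + mixed_norm (conj_exp q) (conj_exp r) a F)"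
    proof -
      have "ennreal (16 * (c1 + c2)) = 16 * ennreal (c1 + c2)" using c by (subst ennreal_mult) auto
      thus ?thesis by (simp only: distrib_left mult.assoc)
    qed
    finally show "mixed_norm q r a (sol a phi F) \<le> ennreal (16 * (c1 + c2)) * (Lnorm 2 a phi + mixed_norm (conj_exp q) (conj_exp r) a F)" .
  qed
qed

end
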